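(* Let $R$ be a valuation domain with maximal ideal $P$, and assume that for each prime ideal $L$ of $R$ the localization $R_L$ is countably generated as an $R$-module. Let $J=\bigcap_{n\in\mathbb{N}}P^n$ (a prime ideal of $R$). Then the following conditions are equivalent: (1) $R^{\Lambda}$ is separable for each index set $\Lambda$; (2) $R^R$ is separable; (3) $R_J$ is maximal. Moreover, if each ideal of $R$ is countably generated, then these conditions are equivalent to: $R^{\mathbb{N}}$ is separable.
   Context: All rings are commutative and unitary. A module is uniserial if its submodules are totally ordered by inclusion. A valuation ring is a ring that is uniserial as a module over itself; a valuation domain is a valuation ring that is an integral domain. For a set $\Lambda$, $R^{\Lambda}$ is the direct product of copies of $R$ indexed by $\Lambda$, regarded as an $R$-module; $R^R$ is the product indexed by the underlying set of $R$. A submodule $N$ of an $R$-module $M$ is pure if $rN=rM\cap N$ for all $r\in R$. A torsion-free $R$-module $M$ is separable if each pure uniserial submodule of $M$ is a direct summand of $M$. For a ring $V$, the $V$-topology of $V$ is the linear topology in which the non-zero ideals of $V$ form a basis of neighborhoods of $0$; for an ideal $A$ of $V$, the $V/A$-topology of the ring $V/A$ is defined in the same way, and $V/A$ is complete in it if every Cauchy net converges. A valuation ring $V$ with maximal ideal $P'$ is maximal if $V/A$ is complete in the $V/A$-topology for each proper ideal $A$ of $V$ (including $A=0$) such that $A\neq P'a$ for all $0\neq a\in V$. *)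

theory Defs
  imports "HOL-Analysis.Abstract_Topology" "HOL-Algebra.QuotRing" "HOL-Algebra.Ideal_Product"
    "HOL-Algebra.Module"
begin

section \<open>Modules\<close>

definition self_module :: "('a, 'c) ring_scheme \<Rightarrow> ('a, 'a) module" where
  "self_module R = \<lparr>carrier = carrier R, mult = mult R, one = one R,
     zero = zero R, add = add R, smult = mult R\<rparr>"

definition power_module :: "('a, 'c) ring_scheme \<Rightarrow> 'i set \<Rightarrow> ('a, 'i \<Rightarrow> 'a) module" where
  "power_module R \<Lambda> = \<lparr>carrier = \<Lambda> \<rightarrow>\<^sub>E carrier R,
     mult = (\<lambda>x y. \<lambda>i\<in>\<Lambda>. x i \<otimes>\<^bsub>R\<^esub> y i), one = (\<lambda>i\<in>\<Lambda>. \<one>\<^bsub>R\<^esub>),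
     zero = (\<lambda>i\<in>\<Lambda>. \<zero>\<^bsub>R\<^esub>), add = (\<lambda>x y. \<lambda>i\<in>\<Lambda>. x i \<oplus>\<^bsub>R\<^esub> y i),
     smult = (\<lambda>r x. \<lambda>i\<in>\<Lambda>. r \<otimes>\<^bsub>R\<^esub> x i)\<rparr>"

definition uniserial :: "('a, 'c) ring_scheme \<Rightarrow> ('a, 'b, 'd) module_scheme \<Rightarrow> bool" where
  "uniserial R M \<longleftrightarrow> Module.module R M \<and>
     (\<forall>N N'. submodule N R M \<longrightarrow> submodule N' R M \<longrightarrow> N \<subseteq> N' \<or> N' \<subseteq> N)"

definition torsion_free :: "('a, 'c) ring_scheme \<Rightarrow> ('a, 'b, 'd) module_scheme \<Rightarrow> bool" where
  "torsion_free R M \<longleftrightarrow> Module.module R M \<and>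
     (\<forall>r\<in>carrier R. \<forall>x\<in>carrier M. r \<odot>\<^bsub>M\<^esub> x = \<zero>\<^bsub>M\<^esub> \<longrightarrow> r = \<zero>\<^bsub>R\<^esub> \<or> x = \<zero>\<^bsub>M\<^esub>)"

definition pure_submodule ::
  "'b set \<Rightarrow> ('a, 'c) ring_scheme \<Rightarrow> ('a, 'b, 'd) module_scheme \<Rightarrow> bool" where
  "pure_submodule N R M \<longleftrightarrow> submodule N R M \<and>
     (\<forall>r\<in>carrier R. smult M r ` N = smult M r ` carrier M \<inter> N)"

definition direct_summand ::
  "'b set \<Rightarrow> ('a, 'c) ring_scheme \<Rightarrow> ('a, 'b, 'd) module_scheme \<Rightarrow> bool" where
  "direct_summand N R M \<longleftrightarrow> submodule N R M \<and>
     (\<exists>K. submodule K R M \<and> N \<inter> K = {\<zero>\<^bsub>M\<^esub>} \<and> N <+>\<^bsub>M\<^esub> K = carrier M)"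

definition separable :: "('a, 'c) ring_scheme \<Rightarrow> ('a, 'b, 'd) module_scheme \<Rightarrow> bool" where
  "separable R M \<longleftrightarrow> torsion_free R M \<and>
     (\<forall>N. pure_submodule N R M \<and> uniserial R (M\<lparr>carrier := N\<rparr>) \<longrightarrow> direct_summand N R M)"

definition countably_generated_module ::
  "('a, 'c) ring_scheme \<Rightarrow> ('a, 'b, 'd) module_scheme \<Rightarrow> bool" where
  "countably_generated_module R M \<longleftrightarrow> Module.module R M \<and>
     (\<exists>S. countable S \<and> S \<subseteq> carrier M \<and> (\<lambda>N. submodule N R M) hull S = carrier M)"

definition countably_generated_ideal :: "'a set \<Rightarrow> ('a, 'c) ring_scheme \<Rightarrow> bool" where
  "countably_generated_ideal I R \<longleftrightarrow>
     (\<exists>S. countable S \<and> S \<subseteq> carrier R \<and> I = Idl\<^bsub>R\<^esub> S)"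


section \<open>Valuation rings\<close>

definition valuation_ring :: "('a, 'c) ring_scheme \<Rightarrow> bool" where
  "valuation_ring R \<longleftrightarrow> cring R \<and> uniserial R (self_module R)"

definition valuation_domain :: "('a, 'c) ring_scheme \<Rightarrow> bool" where
  "valuation_domain R \<longleftrightarrow> valuation_ring R \<and> domain R"


section \<open>Localization at a prime ideal\<close>

text \<open>The fraction \<open>a / s\<close> is the set of all pairs equivalent to \<open>(a, s)\<close>. Since the type of modules
  extends the type of rings, one record carries both the ring structure of the localization and its
  structure of module over the base ring.\<close>

definition fraction :: "('a, 'c) ring_scheme \<Rightarrow> 'a set \<Rightarrow> 'a \<Rightarrow> 'a \<Rightarrow> ('a \<times> 'a) set" where
  "fraction R L a s = {(b, t). b \<in> carrier R \<and> t \<in> carrier R - L \<and>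
     (\<exists>u\<in>carrier R - L. u \<otimes>\<^bsub>R\<^esub> (a \<otimes>\<^bsub>R\<^esub> t) = u \<otimes>\<^bsub>R\<^esub> (b \<otimes>\<^bsub>R\<^esub> s))}"

definition localization ::
  "('a, 'c) ring_scheme \<Rightarrow> 'a set \<Rightarrow> ('a, ('a \<times> 'a) set) module" where
  "localization R L = \<lparr>
     carrier = {fraction R L a s |a s. a \<in> carrier R \<and> s \<in> carrier R - L},
     mult = (\<lambda>X Y. \<Union>(a, s)\<in>X. \<Union>(b, t)\<in>Y. fraction R L (a \<otimes>\<^bsub>R\<^esub> b) (s \<otimes>\<^bsub>R\<^esub> t)),
     one = fraction R L \<one>\<^bsub>R\<^esub> \<one>\<^bsub>R\<^esub>,
     zero = fraction R L \<zero>\<^bsub>R\<^esub> \<one>\<^bsub>R\<^esub>,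
     add = (\<lambda>X Y. \<Union>(a, s)\<in>X. \<Union>(b, t)\<in>Y.
       fraction R L (a \<otimes>\<^bsub>R\<^esub> t \<oplus>\<^bsub>R\<^esub> b \<otimes>\<^bsub>R\<^esub> s) (s \<otimes>\<^bsub>R\<^esub> t)),
     smult = (\<lambda>r X. \<Union>(a, s)\<in>X. fraction R L (r \<otimes>\<^bsub>R\<^esub> a) s)\<rparr>"


section \<open>The ideal topology, completeness and maximality\<close>

text \<open>The condition below is stable under binary intersections, hence describes a topology, when
  any two non-zero ideals contain a common non-zero ideal, in particular for valuation rings
  (see \<open>openin_ideal_topology\<close>).\<close>

definition ideal_topology :: "('a, 'c) ring_scheme \<Rightarrow> 'a topology" where
  "ideal_topology V = topology (\<lambda>U. U \<subseteq> carrier V \<and>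
     (\<forall>x\<in>U. \<exists>I. ideal I V \<and> I \<noteq> {\<zero>\<^bsub>V\<^esub>} \<and> I +>\<^bsub>V\<^esub> x \<subseteq> U))"

definition directed_preorder :: "'i set \<Rightarrow> ('i \<Rightarrow> 'i \<Rightarrow> bool) \<Rightarrow> bool" where
  "directed_preorder D leq \<longleftrightarrow> D \<noteq> {} \<and> reflp_on D leq \<and> transp_on D leq \<and>
     (\<forall>i\<in>D. \<forall>j\<in>D. \<exists>k\<in>D. leq i k \<and> leq j k)"

definition Cauchy_net ::
  "('a, 'c) ring_scheme \<Rightarrow> 'i set \<Rightarrow> ('i \<Rightarrow> 'i \<Rightarrow> bool) \<Rightarrow> ('i \<Rightarrow> 'a) \<Rightarrow> bool" where
  "Cauchy_net V D leq x \<longleftrightarrow> x \<in> D \<rightarrow> carrier V \<and>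
     (\<forall>U. openin (ideal_topology V) U \<and> \<zero>\<^bsub>V\<^esub> \<in> U \<longrightarrow>
       (\<exists>k\<in>D. \<forall>i\<in>D. \<forall>j\<in>D. leq k i \<and> leq k j \<longrightarrow> x i \<ominus>\<^bsub>V\<^esub> x j \<in> U))"

definition net_converges ::
  "('a, 'c) ring_scheme \<Rightarrow> 'i set \<Rightarrow> ('i \<Rightarrow> 'i \<Rightarrow> bool) \<Rightarrow> ('i \<Rightarrow> 'a) \<Rightarrow> 'a \<Rightarrow> bool" where
  "net_converges V D leq x l \<longleftrightarrow> l \<in> carrier V \<and>
     (\<forall>U. openin (ideal_topology V) U \<and> l \<in> U \<longrightarrow>
       (\<exists>k\<in>D. \<forall>i\<in>D. leq k i \<longrightarrow> x i \<in> U))"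

text \<open>A definition cannot quantify over the type of the index set. Sets of ring elements suffice as
  indices: \<open>complete_ring_all_nets\<close> below extends the convergence to nets indexed by any type.\<close>

definition complete_ring :: "('a, 'c) ring_scheme \<Rightarrow> bool" where
  "complete_ring V \<longleftrightarrow> (\<forall>(D :: 'a set set) leq x.
     directed_preorder D leq \<and> Cauchy_net V D leq x \<longrightarrow> (\<exists>l. net_converges V D leq x l))"

text \<open>The set \<open>P #> a\<close> is \<open>{p \<otimes> a |p. p \<in> P}\<close>.\<close>

definition maximal_valuation_ring :: "('a, 'c) ring_scheme \<Rightarrow> bool" where
  "maximal_valuation_ring V \<longleftrightarrow> valuation_ring V \<and>
     (\<exists>P. maximalideal P V \<and>
       (\<forall>A. ideal A V \<and> A \<noteq> carrier V \<and>
            (\<forall>a\<in>carrier V - {\<zero>\<^bsub>V\<^esub>}. A \<noteq> P #>\<^bsub>V\<^esub> a) \<longrightarrow>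
          complete_ring (V Quot A)))"


section \<open>Basic facts\<close>

context primeideal
begin

lemma comp_mult: "s \<in> carrier R - I \<Longrightarrow> t \<in> carrier R - I \<Longrightarrow> s \<otimes> t \<in> carrier R - I"
  using I_prime by auto

lemma comp_one: "\<one> \<in> carrier R - I"
  using I_notcarr one_imp_carrier by auto

lemma fraction_self: 
  "a \<in> carrier R \<Longrightarrow> s \<in> carrier R - I \<Longrightarrow> (a, s) \<in> fraction R I a s"
  using comp_one by (auto simp: fraction_def)

lemma fraction_eqI:
  assumes a: "a \<in> carrier R" "s \<in> carrier R - I" "b \<in> carrier R" "t \<in> carrier R - I"
    and u: "u \<in> carrier R - I" "u \<otimes> (a \<otimes> t) = u \<otimes> (b \<otimes> s)"
  shows "fraction R I a s = fraction R I b t"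
proof -
  have *: "(c, r) \<in> fraction R I b t"
    if a: "a \<in> carrier R" "s \<in> carrier R - I" "b \<in> carrier R" "t \<in> carrier R - I"
    and u: "u \<in> carrier R - I" "u \<otimes> (a \<otimes> t) = u \<otimes> (b \<otimes> s)"
    and c: "(c, r) \<in> fraction R I a s" for a s b t c r
  proof -
    from c obtain v where c: "c \<in> carrier R" "r \<in> carrier R - I" and
      v: "v \<in> carrier R - I" "v \<otimes> (a \<otimes> r) = v \<otimes> (c \<otimes> s)"
      by (auto simp: fraction_def)
    have "(u \<otimes> (v \<otimes> s)) \<otimes> (b \<otimes> r) = (v \<otimes> r) \<otimes> (u \<otimes> (b \<otimes> s))"
      using a u(1) v(1) c by (simp add: m_ac)
    also have "\<dots> = (v \<otimes> r) \<otimes> (u \<otimes> (a \<otimes> t))"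
      using u by simp
    also have "\<dots> = (u \<otimes> t) \<otimes> (v \<otimes> (a \<otimes> r))"
      using a u(1) v(1) c by (simp add: m_ac)
    also have "\<dots> = (u \<otimes> t) \<otimes> (v \<otimes> (c \<otimes> s))"
      using v by simp
    also have "\<dots> = (u \<otimes> (v \<otimes> s)) \<otimes> (c \<otimes> t)"
      using a u(1) v(1) c by (simp add: m_ac)
    finally show ?thesis
      using a u v c comp_mult unfolding fraction_def by blast
  qed
  show ?thesis
    using *[OF assms] *[OF a(3,4,1,2) u(1) u(2)[symmetric]] by auto
qed

lemma fraction_eq_iff:
  assumes "a \<in> carrier R" "s \<in> carrier R - I" "b \<in> carrier R" "t \<in> carrier R - I"
  shows "fraction R I a s = fraction R I b t \<longleftrightarrow>
    (\<exists>u\<in>carrier R - I. u \<otimes> (a \<otimes> t) = u \<otimes> (b \<otimes> s))"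
proof
  assume "fraction R I a s = fraction R I b t"
  with fraction_self[OF assms(3,4)] have "(b, t) \<in> fraction R I a s" by simp
  then show "\<exists>u\<in>carrier R - I. u \<otimes> (a \<otimes> t) = u \<otimes> (b \<otimes> s)"
    by (auto simp: fraction_def)
qed (use fraction_eqI[OF assms] in blast)

lemma carrier_localization:
  "carrier (localization R I) = {fraction R I a s |a s. a \<in> carrier R \<and> s \<in> carrier R - I}"
  by (simp add: localization_def)

lemma one_localization: "\<one>\<^bsub>localization R I\<^esub> = fraction R I \<one> \<one>"
  and zero_localization: "\<zero>\<^bsub>localization R I\<^esub> = fraction R I \<zero> \<one>"
  by (simp_all add: localization_def)

lemma comp_carrier: "s \<in> carrier R - I \<Longrightarrow> s \<in> carrier R"
  by simp

lemma UN_const1: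
  assumes "p \<in> X" "\<And>a s. (a, s) \<in> X \<Longrightarrow> F a s = c"
  shows "(\<Union>(a, s)\<in>X. F a s) = c"
proof -
  have "(\<Union>(a, s)\<in>X. F a s) = (\<Union>p\<in>X. c)"
    by (rule SUP_cong[OF refl]) (auto simp only: split_paired_all prod.case assms(2))
  also have "\<dots> = c" using assms(1) by blast
  finally show ?thesis .
qed

lemma UN_const2:
  assumes "p \<in> X" "q \<in> Y" "\<And>a s b t. (a, s) \<in> X \<Longrightarrow> (b, t) \<in> Y \<Longrightarrow> F a s b t = c"
  shows "(\<Union>(a, s)\<in>X. \<Union>(b, t)\<in>Y. F a s b t) = c"
  by (rule UN_const1[OF assms(1)], rule UN_const1[OF assms(2)], rule assms(3))

lemma fractionD:
  assumes "(b, t) \<in> fraction R I a s"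
  obtains u where "b \<in> carrier R" "t \<in> carrier R - I" "u \<in> carrier R - I"
    "u \<otimes> (a \<otimes> t) = u \<otimes> (b \<otimes> s)"
  using assms by (auto simp: fraction_def)

lemma mult_localization:
  assumes a: "a \<in> carrier R" "s \<in> carrier R - I" and b: "b \<in> carrier R" "t \<in> carrier R - I"
  shows "fraction R I a s \<otimes>\<^bsub>localization R I\<^esub> fraction R I b t = fraction R I (a \<otimes> b) (s \<otimes> t)"
proof -
  have "fraction R I (a' \<otimes> b') (s' \<otimes> t') = fraction R I (a \<otimes> b) (s \<otimes> t)"
    if "(a', s') \<in> fraction R I a s" "(b', t') \<in> fraction R I b t" for a' s' b' t'
  proof -
    from that(1) obtain u where u: "a' \<in> carrier R" "s' \<in> carrier R - I" "u \<in> carrier R - I"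
      "u \<otimes> (a \<otimes> s') = u \<otimes> (a' \<otimes> s)" by (rule fractionD)
    from that(2) obtain v where v: "b' \<in> carrier R" "t' \<in> carrier R - I" "v \<in> carrier R - I"
      "v \<otimes> (b \<otimes> t') = v \<otimes> (b' \<otimes> t)" by (rule fractionD)
    have "(u \<otimes> v) \<otimes> ((a' \<otimes> b') \<otimes> (s \<otimes> t)) = (u \<otimes> (a' \<otimes> s)) \<otimes> (v \<otimes> (b' \<otimes> t))"
      using a b u(1-3) v(1-3) by (simp add: m_ac)
    also have "\<dots> = (u \<otimes> (a \<otimes> s')) \<otimes> (v \<otimes> (b \<otimes> t'))"
      using u v by simp
    also have "\<dots> = (u \<otimes> v) \<otimes> ((a \<otimes> b) \<otimes> (s' \<otimes> t'))"
      using a b u(1-3) v(1-3) by (simp add: m_ac)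
    finally show ?thesis
      using a b u v comp_mult by (intro fraction_eqI[where u = "u \<otimes> v"]) auto
  qed
  then show ?thesis
    unfolding localization_def monoid.simps ring.simps
    by (rule UN_const2[OF fraction_self[OF a] fraction_self[OF b]])
qed

lemma add_localization:
  assumes a: "a \<in> carrier R" "s \<in> carrier R - I" and b: "b \<in> carrier R" "t \<in> carrier R - I"
  shows "fraction R I a s \<oplus>\<^bsub>localization R I\<^esub> fraction R I b t
    = fraction R I (a \<otimes> t \<oplus> b \<otimes> s) (s \<otimes> t)"
proof -
  have "fraction R I (a' \<otimes> t' \<oplus> b' \<otimes> s') (s' \<otimes> t') = fraction R I (a \<otimes> t \<oplus> b \<otimes> s) (s \<otimes> t)"
    if "(a', s') \<in> fraction R I a s" "(b', t') \<in> fraction R I b t" for a' s' b' t'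
  proof -
    from that(1) obtain u where u: "a' \<in> carrier R" "s' \<in> carrier R - I" "u \<in> carrier R - I"
      "u \<otimes> (a \<otimes> s') = u \<otimes> (a' \<otimes> s)" by (rule fractionD)
    from that(2) obtain v where v: "b' \<in> carrier R" "t' \<in> carrier R - I" "v \<in> carrier R - I"
      "v \<otimes> (b \<otimes> t') = v \<otimes> (b' \<otimes> t)" by (rule fractionD)
    have "(u \<otimes> v) \<otimes> ((a' \<otimes> t' \<oplus> b' \<otimes> s') \<otimes> (s \<otimes> t))
      = (v \<otimes> t \<otimes> t') \<otimes> (u \<otimes> (a' \<otimes> s)) \<oplus> (u \<otimes> s \<otimes> s') \<otimes> (v \<otimes> (b' \<otimes> t))"
      using a b u(1-3) v(1-3) by (simp add: m_ac l_distr r_distr)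
    also have "\<dots> = (v \<otimes> t \<otimes> t') \<otimes> (u \<otimes> (a \<otimes> s')) \<oplus> (u \<otimes> s \<otimes> s') \<otimes> (v \<otimes> (b \<otimes> t'))"
      using u v by simp
    also have "\<dots> = (u \<otimes> v) \<otimes> ((a \<otimes> t \<oplus> b \<otimes> s) \<otimes> (s' \<otimes> t'))"
      using a b u(1-3) v(1-3) by (simp add: m_ac l_distr r_distr)
    finally show ?thesis
      using a b u v comp_mult by (intro fraction_eqI[where u = "u \<otimes> v"]) auto
  qed
  then show ?thesis
    unfolding localization_def monoid.simps ring.simps
    by (rule UN_const2[OF fraction_self[OF a] fraction_self[OF b]])
qed

lemma smult_localization:
  assumes r: "r \<in> carrier R" and a: "a \<in> carrier R" "s \<in> carrier R - I"
  shows "r \<odot>\<^bsub>localization R I\<^esub> fraction R I a s = fraction R I (r \<otimes> a) s"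
proof -
  have "fraction R I (r \<otimes> a') s' = fraction R I (r \<otimes> a) s"
    if "(a', s') \<in> fraction R I a s" for a' s'
  proof -
    from that(1) obtain u where u: "a' \<in> carrier R" "s' \<in> carrier R - I" "u \<in> carrier R - I"
      "u \<otimes> (a \<otimes> s') = u \<otimes> (a' \<otimes> s)" by (rule fractionD)
    have "u \<otimes> (r \<otimes> a' \<otimes> s) = r \<otimes> (u \<otimes> (a' \<otimes> s))"
      using a r u(1-3) by (simp add: m_ac)
    also have "\<dots> = r \<otimes> (u \<otimes> (a \<otimes> s'))" using u by simp
    also have "\<dots> = u \<otimes> (r \<otimes> a \<otimes> s')"
      using a r u(1-3) by (simp add: m_ac)
    finally show ?thesis
      using a r u by (intro fraction_eqI[where u = u]) auto
  qed
  then show ?thesis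
    unfolding localization_def module.simps
    by (rule UN_const1[OF fraction_self[OF a]])
qed

lemma fraction_closed:
  "a \<in> carrier R \<Longrightarrow> s \<in> carrier R - I \<Longrightarrow> fraction R I a s \<in> carrier (localization R I)"
  by (auto simp: carrier_localization)

lemmas localization_ops = one_localization zero_localization mult_localization add_localization
  smult_localization comp_mult comp_one comp_carrier fraction_closed

lemma localization_induct:
  assumes "x \<in> carrier (localization R I)"
    and "\<And>a s. a \<in> carrier R \<Longrightarrow> s \<in> carrier R - I \<Longrightarrow> P (fraction R I a s)"
  shows "P x"
  using assms by (auto simp: carrier_localization)

lemma fraction_eqI1:
  assumes "a \<in> carrier R" "s \<in> carrier R - I" "b \<in> carrier R" "t \<in> carrier R - I"
    and "a \<otimes> t = b \<otimes> s"
  shows "fraction R I a s = fraction R I b t"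
  using assms comp_one by (intro fraction_eqI[where u = \<one>]) auto

theorem cring_localization: "cring (localization R I)"
proof -
  let ?L = "localization R I"
  have "abelian_group ?L"
  proof (rule abelian_groupI)
    fix x assume "x \<in> carrier ?L"
    then show "\<exists>y\<in>carrier ?L. y \<oplus>\<^bsub>?L\<^esub> x = \<zero>\<^bsub>?L\<^esub>"
    proof (rule localization_induct)
      fix a s assume a: "a \<in> carrier R" "s \<in> carrier R - I"
      have "fraction R I (\<ominus> a) s \<oplus>\<^bsub>?L\<^esub> fraction R I a s = fraction R I \<zero> (s \<otimes> s)"
        using a by (simp add: localization_ops l_neg l_minus del: Diff_iff)
      also have "\<dots> = \<zero>\<^bsub>?L\<^esub>"
        unfolding zero_localization
        by (rule fraction_eqI1) (use a in \<open>simp_all add: localization_ops del: Diff_iff\<close>)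
      finally show "\<exists>y\<in>carrier ?L. y \<oplus>\<^bsub>?L\<^esub> fraction R I a s = \<zero>\<^bsub>?L\<^esub>"
        using a by (blast intro: fraction_closed a_inv_closed)
    qed
  next
    fix x y z assume "x \<in> carrier ?L" "y \<in> carrier ?L" "z \<in> carrier ?L"
    then show "x \<oplus>\<^bsub>?L\<^esub> y \<oplus>\<^bsub>?L\<^esub> z = x \<oplus>\<^bsub>?L\<^esub> (y \<oplus>\<^bsub>?L\<^esub> z)"
      by (elim localization_induct)
        (simp add: localization_ops l_distr r_distr m_ac a_ac del: Diff_iff)
  next
    fix x y assume "x \<in> carrier ?L" "y \<in> carrier ?L"
    then show "x \<oplus>\<^bsub>?L\<^esub> y \<in> carrier ?L" "x \<oplus>\<^bsub>?L\<^esub> y = y \<oplus>\<^bsub>?L\<^esub> x"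
      by (elim localization_induct, simp add: localization_ops m_comm a_comm del: Diff_iff)+
  next
    show "\<zero>\<^bsub>?L\<^esub> \<in> carrier ?L" by (simp add: localization_ops del: Diff_iff)
    fix x assume "x \<in> carrier ?L"
    then show "\<zero>\<^bsub>?L\<^esub> \<oplus>\<^bsub>?L\<^esub> x = x"
      by (elim localization_induct) (simp add: localization_ops del: Diff_iff)
  qed
  moreover have "comm_monoid ?L"
  proof (rule comm_monoidI)
    fix x y z assume "x \<in> carrier ?L" "y \<in> carrier ?L" "z \<in> carrier ?L"
    then show "x \<otimes>\<^bsub>?L\<^esub> y \<otimes>\<^bsub>?L\<^esub> z = x \<otimes>\<^bsub>?L\<^esub> (y \<otimes>\<^bsub>?L\<^esub> z)"
      by (elim localization_induct) (simp add: localization_ops m_assoc del: Diff_iff)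
  next
    fix x y assume "x \<in> carrier ?L" "y \<in> carrier ?L"
    then show "x \<otimes>\<^bsub>?L\<^esub> y \<in> carrier ?L" "x \<otimes>\<^bsub>?L\<^esub> y = y \<otimes>\<^bsub>?L\<^esub> x"
      by (elim localization_induct, simp add: localization_ops m_comm del: Diff_iff)+
  next
    show "\<one>\<^bsub>?L\<^esub> \<in> carrier ?L" by (simp add: localization_ops del: Diff_iff)
    fix x assume "x \<in> carrier ?L"
    then show "\<one>\<^bsub>?L\<^esub> \<otimes>\<^bsub>?L\<^esub> x = x"
      by (elim localization_induct) (simp add: localization_ops del: Diff_iff)
  qed
  ultimately show ?thesis
  proof (rule cringI)
    fix x y z assume "x \<in> carrier ?L" "y \<in> carrier ?L" "z \<in> carrier ?L"
    then show "(x \<oplus>\<^bsub>?L\<^esub> y) \<otimes>\<^bsub>?L\<^esub> z = x \<otimes>\<^bsub>?L\<^esub> z \<oplus>\<^bsub>?L\<^esub> y \<otimes>\<^bsub>?L\<^esub> z"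
    proof (elim localization_induct)
      fix a s b t c r
      assume *: "a \<in> carrier R" "s \<in> carrier R - I" "b \<in> carrier R" "t \<in> carrier R - I"
        "c \<in> carrier R" "r \<in> carrier R - I"
      show "(fraction R I a s \<oplus>\<^bsub>?L\<^esub> fraction R I b t) \<otimes>\<^bsub>?L\<^esub> fraction R I c r =
        fraction R I a s \<otimes>\<^bsub>?L\<^esub> fraction R I c r \<oplus>\<^bsub>?L\<^esub> fraction R I b t \<otimes>\<^bsub>?L\<^esub> fraction R I c r"
        using * by (simp add: localization_ops del: Diff_iff, intro fraction_eqI1)
         (simp_all add: localization_ops l_distr r_distr m_ac del: Diff_iff)
    qed
  qed
qed

theorem algebra_localization: "Module.algebra R (localization R I)"
proof -
  let ?L = "localization R I"
  show ?thesis
  proof (rule algebraI)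
    show "cring R" by (rule is_cring)
    show "cring ?L" by (rule cring_localization)
  next
    fix r x assume "r \<in> carrier R" "x \<in> carrier ?L"
    from this(2,1) show "r \<odot>\<^bsub>?L\<^esub> x \<in> carrier ?L"
      by (elim localization_induct) (simp add: localization_ops del: Diff_iff)
  next
    fix r r' x assume r: "r \<in> carrier R" "r' \<in> carrier R" and x: "x \<in> carrier ?L"
    from x show "(r \<oplus> r') \<odot>\<^bsub>?L\<^esub> x = r \<odot>\<^bsub>?L\<^esub> x \<oplus>\<^bsub>?L\<^esub> r' \<odot>\<^bsub>?L\<^esub> x"
    proof (rule localization_induct)
      fix a s assume "a \<in> carrier R" "s \<in> carrier R - I"
      with r show "(r \<oplus> r') \<odot>\<^bsub>?L\<^esub> fraction R I a s =
        r \<odot>\<^bsub>?L\<^esub> fraction R I a s \<oplus>\<^bsub>?L\<^esub> r' \<odot>\<^bsub>?L\<^esub> fraction R I a s"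
        by (simp add: localization_ops del: Diff_iff, intro fraction_eqI1)
         (simp_all add: localization_ops l_distr r_distr m_ac del: Diff_iff)
    qed
    from x r show "(r \<otimes> r') \<odot>\<^bsub>?L\<^esub> x = r \<odot>\<^bsub>?L\<^esub> (r' \<odot>\<^bsub>?L\<^esub> x)"
      by (elim localization_induct) (simp add: localization_ops m_assoc del: Diff_iff)
  next
    fix r x y assume "r \<in> carrier R" "x \<in> carrier ?L" "y \<in> carrier ?L"
    from this(2,3,1) show "r \<odot>\<^bsub>?L\<^esub> (x \<oplus>\<^bsub>?L\<^esub> y) = r \<odot>\<^bsub>?L\<^esub> x \<oplus>\<^bsub>?L\<^esub> r \<odot>\<^bsub>?L\<^esub> y"
      "(r \<odot>\<^bsub>?L\<^esub> x) \<otimes>\<^bsub>?L\<^esub> y = r \<odot>\<^bsub>?L\<^esub> (x \<otimes>\<^bsub>?L\<^esub> y)"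
      by (elim localization_induct, simp add: localization_ops r_distr m_assoc del: Diff_iff)+
  next
    fix x assume "x \<in> carrier ?L"
    then show "\<one> \<odot>\<^bsub>?L\<^esub> x = x"
      by (elim localization_induct) (simp add: localization_ops del: Diff_iff)
  qed
qed

end

lemma ideal_iff_submodule:
  assumes "cring V"
  shows "ideal I V \<longleftrightarrow> submodule I V (self_module V)"
proof -
  interpret cring V by fact
  have *: "subgroup I (add_monoid (self_module V)) = subgroup I (add_monoid V)"
    by (simp add: subgroup_def self_module_def m_inv_def)
  show ?thesis
  proof
    assume "ideal I V" then interpret ideal I V .
    show "submodule I V (self_module V)"
      unfolding submodule_def submodule_axioms_def *
      using a_subgroup I_l_closed by (simp add: self_module_def)
  next
    assume "submodule I V (self_module V)"
    then have s: "subgroup I (add_monoid V)" 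
      and c: "\<And>a x. a \<in> carrier V \<Longrightarrow> x \<in> I \<Longrightarrow> a \<otimes>\<^bsub>V\<^esub> x \<in> I"
      unfolding submodule_def submodule_axioms_def * by (simp_all add: self_module_def)
    show "ideal I V"
    proof (rule idealI)
      fix a x assume "a \<in> I" "x \<in> carrier V"
      moreover from this have "a \<in> carrier V" using subgroup.subset[OF s] by auto
      ultimately show "x \<otimes>\<^bsub>V\<^esub> a \<in> I" "a \<otimes>\<^bsub>V\<^esub> x \<in> I"
        using c[of x a] m_comm[of a x] by simp_all
    qed (fact s ring_axioms)+
  qed
qed

lemma self_module_module: "cring V \<Longrightarrow> Module.module V (self_module V)"
proof -
  assume "cring V" then interpret cring V .
  have "abelian_group (self_module V)"
    by (rule abelian_groupI) (auto simp: self_module_def a_assoc a_comm a_lcomm intro: l_neg a_inv_closed)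
  then show ?thesis
    by (intro moduleI) (use is_cring in \<open>auto simp: self_module_def l_distr r_distr m_assoc\<close>)
qed

lemma valuation_ring_iff:
  "valuation_ring V \<longleftrightarrow>
     cring V \<and> (\<forall>I I'. ideal I V \<longrightarrow> ideal I' V \<longrightarrow> I \<subseteq> I' \<or> I' \<subseteq> I)"
  unfolding valuation_ring_def uniserial_def
  using ideal_iff_submodule[of V] self_module_module by blast

lemma module_power_module:
  assumes "cring R"
  shows "Module.module R (power_module R \<Lambda>)"
proof -
  interpret cring R by fact
  have "abelian_group (power_module R \<Lambda>)"
  proof (rule abelian_groupI)
    fix x assume "x \<in> carrier (power_module R \<Lambda>)"
    then show "\<exists>y\<in>carrier (power_module R \<Lambda>). y \<oplus>\<^bsub>power_module R \<Lambda>\<^esub> x = \<zero>\<^bsub>power_module R \<Lambda>\<^esub>"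
      by (intro bexI[of _ "\<lambda>i\<in>\<Lambda>. \<ominus>\<^bsub>R\<^esub> x i"])
        (auto simp: power_module_def PiE_iff l_neg intro!: restrict_ext)
  qed (auto simp: power_module_def PiE_iff a_assoc a_comm a_lcomm extensional_def restrict_def fun_eq_iff)
  then show ?thesis
    by (intro moduleI)
      (use is_cring in \<open>auto simp: power_module_def PiE_iff l_distr r_distr m_assoc
         extensional_def restrict_def fun_eq_iff\<close>)
qed

lemma openin_ideal_topology:
  assumes "valuation_ring V"
  shows "openin (ideal_topology V) U \<longleftrightarrow> U \<subseteq> carrier V \<and>
     (\<forall>x\<in>U. \<exists>I. ideal I V \<and> I \<noteq> {\<zero>\<^bsub>V\<^esub>} \<and> I +>\<^bsub>V\<^esub> x \<subseteq> U)"
proof -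
  let ?P = "\<lambda>U. U \<subseteq> carrier V \<and>
     (\<forall>x\<in>U. \<exists>I. ideal I V \<and> I \<noteq> {\<zero>\<^bsub>V\<^esub>} \<and> I +>\<^bsub>V\<^esub> x \<subseteq> U)"
  have lin: "I \<subseteq> I' \<or> I' \<subseteq> I" if "ideal I V" "ideal I' V" for I I'
    using assms that by (simp add: valuation_ring_iff)
  have mono: "I +>\<^bsub>V\<^esub> x \<subseteq> I' +>\<^bsub>V\<^esub> x" if "I \<subseteq> I'" for I I' x
    using that by (auto simp: a_r_coset_def')
  have "istopology ?P"
    unfolding istopology_def
  proof (intro conjI allI impI)
    fix S T x assume S: "?P S" and T: "?P T"
    then show "S \<inter> T \<subseteq> carrier V" by blast
    show "\<forall>x\<in>S \<inter> T. \<exists>I. ideal I V \<and> I \<noteq> {\<zero>\<^bsub>V\<^esub>} \<and> I +>\<^bsub>V\<^esub> x \<subseteq> S \<inter> T"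
    proof
      fix x assume "x \<in> S \<inter> T"
      with S T obtain I I' where "ideal I V" "I \<noteq> {\<zero>\<^bsub>V\<^esub>}" "I +>\<^bsub>V\<^esub> x \<subseteq> S"
        "ideal I' V" "I' \<noteq> {\<zero>\<^bsub>V\<^esub>}" "I' +>\<^bsub>V\<^esub> x \<subseteq> T"
        by (metis IntE)
      with lin[of I I'] mono[of I I' x] mono[of I' I x]
      show "\<exists>I. ideal I V \<and> I \<noteq> {\<zero>\<^bsub>V\<^esub>} \<and> I +>\<^bsub>V\<^esub> x \<subseteq> S \<inter> T"
        by (metis le_inf_iff order_trans)
    qed
  next
    fix \<K> assume K: "\<forall>K\<in>\<K>. ?P K"
    then show "\<Union>\<K> \<subseteq> carrier V" by blast
    show "\<forall>x\<in>\<Union>\<K>. \<exists>I. ideal I V \<and> I \<noteq> {\<zero>\<^bsub>V\<^esub>} \<and> I +>\<^bsub>V\<^esub> x \<subseteq> \<Union>\<K>"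
    proof
      fix x assume "x \<in> \<Union>\<K>"
      then obtain S where "S \<in> \<K>" "x \<in> S" by blast
      with K obtain I where "ideal I V" "I \<noteq> {\<zero>\<^bsub>V\<^esub>}" "I +>\<^bsub>V\<^esub> x \<subseteq> S"
        by meson
      with \<open>S \<in> \<K>\<close> show "\<exists>I. ideal I V \<and> I \<noteq> {\<zero>\<^bsub>V\<^esub>} \<and> I +>\<^bsub>V\<^esub> x \<subseteq> \<Union>\<K>"
        by blast
    qed
  qed
  then show ?thesis by (simp add: ideal_topology_def)
qed

theorem complete_ring_all_nets:
  fixes D :: "'i set"
  assumes V: "valuation_ring V" and compl: "complete_ring V"
    and D: "directed_preorder D leq" and x: "Cauchy_net V D leq x"
  shows "\<exists>l. net_converges V D leq x l"
proof (cases "carrier V = {\<zero>\<^bsub>V\<^esub>}")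
  case True
  from D obtain k where "k \<in> D" by (auto simp: directed_preorder_def)
  with True x have "net_converges V D leq x \<zero>\<^bsub>V\<^esub>"
    by (fastforce simp: net_converges_def Cauchy_net_def Pi_iff)
  then show ?thesis ..
next
  case False
  from V interpret cring V by (simp add: valuation_ring_iff)
  note op = openin_ideal_topology[OF V]
  have lin: "I \<subseteq> I' \<or> I' \<subseteq> I" if "ideal I V" "ideal I' V" for I I'
    using V that by (simp add: valuation_ring_iff)
  have coset_open: "openin (ideal_topology V) (I +>\<^bsub>V\<^esub> l)"
    if "ideal I V" "I \<noteq> {\<zero>\<^bsub>V\<^esub>}" "l \<in> carrier V" for I l
  proof -
    interpret I: ideal I V by fact
    have "I +>\<^bsub>V\<^esub> y = I +>\<^bsub>V\<^esub> l" if "y \<in> I +>\<^bsub>V\<^esub> l" for y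
      using a_repr_independence[OF that \<open>l \<in> carrier V\<close> I.a_subgroup] by simp
    with that show ?thesis
      unfolding op by (metis I.a_subset a_r_coset_subset_G order_refl)
  qed
  have coset_zero: "I +>\<^bsub>V\<^esub> \<zero>\<^bsub>V\<^esub> = I" if "ideal I V" for I
    using that by (simp add: a_coset_add_zero additive_subgroup.a_subset ideal.axioms(1))
  define N where "N = {I. ideal I V \<and> I \<noteq> {\<zero>\<^bsub>V\<^esub>}}"
  let ?geq = "\<lambda>I I'. I' \<subseteq> I"
  have "directed_preorder N ?geq"
    unfolding directed_preorder_def
  proof (intro conjI ballI)
    show "N \<noteq> {}" using False oneideal by (auto simp: N_def)
    fix I I' assume "I \<in> N" "I' \<in> N"
    with lin[of I I'] show "\<exists>K\<in>N. K \<subseteq> I \<and> K \<subseteq> I'" by (auto simp: N_def)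
  qed (auto intro: reflp_onI transp_onI)
  moreover have "\<exists>k\<in>D. \<forall>i\<in>D. \<forall>j\<in>D. leq k i \<and> leq k j \<longrightarrow> x i \<ominus>\<^bsub>V\<^esub> x j \<in> I"
    if "I \<in> N" for I
  proof -
    from that have I: "ideal I V" "I \<noteq> {\<zero>\<^bsub>V\<^esub>}" by (auto simp: N_def)
    with coset_open[OF I zero_closed] coset_zero have "openin (ideal_topology V) I" by simp
    moreover from I have "\<zero>\<^bsub>V\<^esub> \<in> I" by (simp add: additive_subgroup.zero_closed ideal.axioms(1))
    ultimately show ?thesis using x unfolding Cauchy_net_def by blast
  qed
  then obtain k where k: "\<And>I. I \<in> N \<Longrightarrow> k I \<in> D"
    "\<And>I i j. \<lbrakk>I \<in> N; i \<in> D; j \<in> D; leq (k I) i; leq (k I) j\<rbrakk> \<Longrightarrow> x i \<ominus>\<^bsub>V\<^esub> x j \<in> I"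
    by metis
  have xc: "x i \<in> carrier V" if "i \<in> D" for i
    using x that by (auto simp: Cauchy_net_def)
  have refl: "leq i i" if "i \<in> D" for i
    using D that by (simp add: directed_preorder_def reflp_on_def)
  have split: "a \<ominus>\<^bsub>V\<^esub> c = (a \<ominus>\<^bsub>V\<^esub> b) \<oplus>\<^bsub>V\<^esub> (b \<ominus>\<^bsub>V\<^esub> c)"
    if "a \<in> carrier V" "b \<in> carrier V" "c \<in> carrier V" for a b c
    using that by (simp add: a_minus_def a_assoc r_neg1)
  have "Cauchy_net V N ?geq (\<lambda>I. x (k I))"
    unfolding Cauchy_net_def
  proof (intro conjI allI impI)
    show "(\<lambda>I. x (k I)) \<in> N \<rightarrow> carrier V" using k xc by auto
    fix U assume "openin (ideal_topology V) U \<and> \<zero>\<^bsub>V\<^esub> \<in> U"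
    then obtain I where I: "ideal I V" "I \<noteq> {\<zero>\<^bsub>V\<^esub>}" "I \<subseteq> U"
      unfolding op using coset_zero by metis
    interpret I: ideal I V by fact
    show "\<exists>K\<in>N. \<forall>I\<in>N. \<forall>J\<in>N. I \<subseteq> K \<and> J \<subseteq> K \<longrightarrow> x (k I) \<ominus>\<^bsub>V\<^esub> x (k J) \<in> U"
    proof (intro bexI[of _ I] ballI impI)
      fix J K assume J: "J \<in> N" and K: "K \<in> N" and sub: "J \<subseteq> I \<and> K \<subseteq> I"
      obtain m where m: "m \<in> D" "leq (k J) m" "leq (k K) m"
        using D k(1)[OF J] k(1)[OF K] unfolding directed_preorder_def by blast
      have "x (k J) \<ominus>\<^bsub>V\<^esub> x m \<in> J" "x m \<ominus>\<^bsub>V\<^esub> x (k K) \<in> K"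
        using k J K m refl by auto
      then have "x (k J) \<ominus>\<^bsub>V\<^esub> x (k K) \<in> I"
        using sub split[of "x (k J)" "x m" "x (k K)"] k(1)[OF J] k(1)[OF K] m xc
        by (metis I.a_closed subsetD)
      with I show "x (k J) \<ominus>\<^bsub>V\<^esub> x (k K) \<in> U" by blast
    qed (use I in \<open>simp add: N_def\<close>)
  qed
  ultimately obtain l where l: "net_converges V N ?geq (\<lambda>I. x (k I)) l"
    using compl unfolding complete_ring_def by meson
  have "net_converges V D leq x l"
    unfolding net_converges_def
  proof (intro conjI allI impI)
    show lc: "l \<in> carrier V" using l by (simp add: net_converges_def)
    fix U assume U: "openin (ideal_topology V) U \<and> l \<in> U"
    then obtain I where I: "ideal I V" "I \<noteq> {\<zero>\<^bsub>V\<^esub>}" "I +>\<^bsub>V\<^esub> l \<subseteq> U"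
      unfolding op by metis
    interpret I: ideal I V by fact
    have "l \<in> I +>\<^bsub>V\<^esub> l" using lc by (rule I.a_rcos_self)
    with coset_open[OF I(1,2) lc] l obtain K0 where K0: "K0 \<in> N"
      "\<And>K. K \<in> N \<Longrightarrow> K \<subseteq> K0 \<Longrightarrow> x (k K) \<in> I +>\<^bsub>V\<^esub> l"
      unfolding net_converges_def by meson
    from lin[of K0 I] K0 I obtain K where K: "K \<in> N" "K \<subseteq> K0" "K \<subseteq> I"
      by (auto simp: N_def)
    show "\<exists>m\<in>D. \<forall>i\<in>D. leq m i \<longrightarrow> x i \<in> U"
    proof (intro bexI[of _ "k K"] ballI impI)
      fix i assume i: "i \<in> D" "leq (k K) i"
      from K0(2)[OF K(1,2)] obtain h where h: "h \<in> I" "x (k K) = h \<oplus>\<^bsub>V\<^esub> l"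
        by (auto simp: a_r_coset_def')
      have d: "x i \<ominus>\<^bsub>V\<^esub> x (k K) \<in> I" using k K i refl by blast
      have "x i = (x i \<ominus>\<^bsub>V\<^esub> x (k K)) \<oplus>\<^bsub>V\<^esub> x (k K)"
        using i k K xc by (simp add: a_minus_def a_assoc l_neg)
      also have "\<dots> = ((x i \<ominus>\<^bsub>V\<^esub> x (k K)) \<oplus>\<^bsub>V\<^esub> h) \<oplus>\<^bsub>V\<^esub> l"
        using h d lc I.Icarr by (metis a_assoc)
      finally have "x i \<in> I +>\<^bsub>V\<^esub> l"
        using h d I.a_closed unfolding a_r_coset_def' by blast
      with I show "x i \<in> U" by blast
    qed (use k K in simp)
  qed
  then show ?thesis ..
qed

end

theory Submission
  imports Defs "HOL-Algebra.Divisibility"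
begin

text \<open>Let \<open>Q\<close> be the field of fractions of \<open>R\<close>. A nonzero pure uniserial submodule \<open>U\<close> of a power of \<open>R\<close> has rank
  one: it consists of the vectors of the power that are \<open>Q\<close>-multiples of any of its nonzero elements \<open>x\<close>. If one
  coordinate of \<open>x\<close> divides all others, then \<open>U\<close> has a generator with a coordinate \<open>1\<close>, and evaluation of that
  coordinate splits \<open>U\<close> off. Otherwise all coordinates lie in \<open>J\<close>, the elements outside \<open>J\<close> act bijectively on \<open>U\<close>,
  and \<open>U\<close> is isomorphic to an ideal of the localization \<open>V\<close> at \<open>J\<close>. If \<open>V\<close> is maximal, then chains of cosets of
  submodules of \<open>U\<close> have common elements (\<open>maximal_linearly_compact\<close>), and this suffices to build a complement of
  \<open>U\<close> by Zorn's lemma (\<open>linearly_compact_pure_summand\<close>).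

  For the converse, consider a set \<open>W\<close> of ring elements that is well-ordered by divisibility, and let \<open>A\<close> be the
  ideal of its common multiples. The vectors \<open>(a / w)\<close> indexed by \<open>w \<in> W\<close>, with \<open>a \<in> A\<close>, form a pure uniserial
  submodule isomorphic to \<open>A\<close>, so separability provides a linear map \<open>F\<close> from the power onto \<open>A\<close> that takes each
  \<open>(a / w)\<close> to \<open>a\<close>. Given a chain \<open>c w\<close> of elements of \<open>A\<close>, each congruent to the earlier ones modulo
  submodules that \<open>F\<close> respects, such as multiples of \<open>A\<close>, the value of \<open>F\<close> at the single vector \<open>(b w / w)\<close>
  is a limit of the chain, where \<open>b\<close> is obtained from \<open>c\<close> by a recursion along \<open>W\<close> that corrects the influence of the
  coordinates before \<open>w\<close> (\<open>chain_limit\<close>).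

  Completeness of a quotient of \<open>V\<close> by an ideal \<open>A\<close> amounts to limits of families \<open>c a\<close> that are coherent modulo the
  principal ideals \<open>a R\<close> with \<open>a\<close> outside \<open>A\<close> (\<open>maximal_if_limits\<close>). If multiples of \<open>A\<close> interleave with these
  principal ideals, then a cofinal set \<open>W\<close> of such elements \<open>a\<close> has the common multiples \<open>A\<close>, and the chain
  argument applies after scaling (\<open>limit_if_interpolated\<close>). Otherwise \<open>A = w L\<close> for a prime ideal \<open>L\<close> properly contained
  in \<open>J\<close>; here the countable generation of the localization at \<open>L\<close> reduces the family to a sequence, and the
  argument is run with a sequence of divisors of an element of \<open>J\<close> outside \<open>L\<close> (\<open>limit_over_prime\<close>). The index set
  only has to be as large as \<open>W\<close>: the underlying set of \<open>R\<close> always suffices, and a countable one does if all ideals are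
  countably generated (\<open>countable_cofinal\<close>).\<close>

section \<open>Total divisibility\<close>

text \<open>The method \<open>algebra\<close> is extended from rings to abelian groups and modules.\<close>

lemmas (in abelian_group) abelian_group_simprules
  [algebra add: abelian_group "zero G" "add G" "a_inv G" "a_minus G"] =
  a_closed zero_closed a_inv_closed minus_closed a_assoc l_zero l_neg a_comm minus_eq
  r_zero r_neg r_neg2 r_neg1 minus_add minus_minus add.inv_one[folded a_inv_def] a_lcomm

lemma (in abelian_group) minus_eq_zero_iff:
  assumes "x \<in> carrier G" "y \<in> carrier G"
  shows "x \<ominus> y = \<zero> \<longleftrightarrow> x = y"
  using assms minus_equality[of x "\<ominus> y"] by (auto simp: minus_eq r_neg)

lemma (in module) smult_left_commute:
  "\<lbrakk>a \<in> carrier R; b \<in> carrier R; x \<in> carrier M\<rbrakk> \<Longrightarrow> a \<odot>\<^bsub>M\<^esub> (b \<odot>\<^bsub>M\<^esub> x) = b \<odot>\<^bsub>M\<^esub> (a \<odot>\<^bsub>M\<^esub> x)"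
  by (simp add: smult_assoc1[symmetric] R.m_comm)

lemmas (in module) module_simprules
  [algebra add: module "zero M" "add M" "a_inv M" "a_minus M"
     "zero R" "add R" "a_inv R" "a_minus R" "one R" "monoid.mult R" "smult M"] =
  M.abelian_group_simprules R.cring_simprules
  smult_closed smult_r_distr smult_l_distr smult_r_minus smult_l_minus smult_l_null smult_r_null
  smult_assoc1 smult_one smult_left_commute

locale valuation_dom = domain R for R (structure) +
  assumes divides_total: "\<lbrakk>a \<in> carrier R; b \<in> carrier R\<rbrakk> \<Longrightarrow> a divides b \<or> b divides a"

lemma (in ring) idealI':
  assumes "I \<subseteq> carrier R" "\<zero> \<in> I" "\<And>x y. x \<in> I \<Longrightarrow> y \<in> I \<Longrightarrow> x \<oplus> y \<in> I"
    "\<And>x r. x \<in> I \<Longrightarrow> r \<in> carrier R \<Longrightarrow> r \<otimes> x \<in> I" "\<And>x r. x \<in> I \<Longrightarrow> r \<in> carrier R \<Longrightarrow> x \<otimes> r \<in> I"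
  shows "ideal I R"
proof (rule idealI[OF ring_axioms _ assms(4,5)])
  have "\<ominus> x \<in> I" if "x \<in> I" for x
    using assms(4)[OF that, of "\<ominus> \<one>"] that assms(1) by (auto simp: l_minus)
  then show "subgroup I (add_monoid R)"
    using assms(1-3) by (auto simp: subgroup_def a_inv_def)
qed

lemma valuation_ring_divides_total:
  assumes "valuation_ring V" "a \<in> carrier V" "b \<in> carrier V"
  shows "a divides\<^bsub>V\<^esub> b \<or> b divides\<^bsub>V\<^esub> a"
proof -
  interpret cring V using assms(1) by (simp add: valuation_ring_iff)
  have "PIdl\<^bsub>V\<^esub> a \<subseteq> PIdl\<^bsub>V\<^esub> b \<or> PIdl\<^bsub>V\<^esub> b \<subseteq> PIdl\<^bsub>V\<^esub> a"
    using assms cgenideal_ideal by (simp add: valuation_ring_iff)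
  moreover have "a \<in> PIdl\<^bsub>V\<^esub> a" "b \<in> PIdl\<^bsub>V\<^esub> b" using assms cgenideal_self by auto
  ultimately have "a \<in> PIdl\<^bsub>V\<^esub> b \<or> b \<in> PIdl\<^bsub>V\<^esub> a" by blast
  then show ?thesis using assms by (auto simp: cgenideal_def factor_def m_comm)
qed

lemma valuation_ringI:
  assumes "cring V" "\<And>a b. a \<in> carrier V \<Longrightarrow> b \<in> carrier V \<Longrightarrow> a divides\<^bsub>V\<^esub> b \<or> b divides\<^bsub>V\<^esub> a"
  shows "valuation_ring V"
  unfolding valuation_ring_iff
proof (intro conjI allI impI, rule assms)
  fix I I' assume I: "ideal I V" "ideal I' V"
  interpret cring V by fact
  show "I \<subseteq> I' \<or> I' \<subseteq> I"
  proof (rule ccontr)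
    assume "\<not> (I \<subseteq> I' \<or> I' \<subseteq> I)"
    then obtain a b where "a \<in> I" "a \<notin> I'" "b \<in> I'" "b \<notin> I" by blast
    moreover from this have "a \<in> carrier V" "b \<in> carrier V" using I by (auto simp: ideal.Icarr)
    ultimately show False
      using assms(2)[of a b] I ideal.I_r_closed by (fastforce simp: factor_def)
  qed
qed

lemma valuation_domainD:
  assumes "valuation_domain R" shows "valuation_dom R"
proof -
  have "domain R" "valuation_ring R" using assms by (auto simp: valuation_domain_def)
  then show ?thesis
    by (intro valuation_dom.intro valuation_dom_axioms.intro valuation_ring_divides_total)
qed

section \<open>Splitting off linearly compact pure submodules\<close>

context module
begin

abbreviation add_M (infixl \<open>\<^bold>+\<close> 65) where "x \<^bold>+ y \<equiv> x \<oplus>\<^bsub>M\<^esub> y"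
abbreviation minus_M (infixl \<open>\<^bold>-\<close> 65) where "x \<^bold>- y \<equiv> x \<ominus>\<^bsub>M\<^esub> y"
abbreviation smult_M (infixl \<open>\<^bold>*\<close> 70) where "r \<^bold>* x \<equiv> r \<odot>\<^bsub>M\<^esub> x"

lemma submodule_closed:
  assumes "submodule N R M"
  shows "x \<in> N \<Longrightarrow> x \<in> carrier M" "\<zero>\<^bsub>M\<^esub> \<in> N" "x \<in> N \<Longrightarrow> y \<in> N \<Longrightarrow> x \<^bold>+ y \<in> N"
    "x \<in> N \<Longrightarrow> \<ominus>\<^bsub>M\<^esub> x \<in> N" "x \<in> N \<Longrightarrow> y \<in> N \<Longrightarrow> x \<^bold>- y \<in> N" "r \<in> carrier R \<Longrightarrow> x \<in> N \<Longrightarrow> r \<^bold>* x \<in> N"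
  using submoduleE[OF assms] submodule.axioms(1)[OF assms] subgroup.one_closed
  unfolding M.minus_eq by fastforce+

lemma pure_submodule_iff:
  assumes tf: "torsion_free R M" and dom: "domain R"
  shows "pure_submodule N R M \<longleftrightarrow> submodule N R M \<and>
    (\<forall>r\<in>carrier R - {\<zero>}. \<forall>z\<in>carrier M. r \<^bold>* z \<in> N \<longrightarrow> z \<in> N)" (is "?l \<longleftrightarrow> _ \<and> ?r")
proof
  assume p: ?l
  then have N: "submodule N R M" by (simp add: pure_submodule_def)
  have "z \<in> N" if "r \<in> carrier R" "r \<noteq> \<zero>" "z \<in> carrier M" "r \<^bold>* z \<in> N" for r z
  proof -
    from p that have "r \<^bold>* z \<in> smult M r ` N" by (auto simp: pure_submodule_def)
    then obtain n where n: "n \<in> N" "r \<^bold>* z = r \<^bold>* n" by blast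
    have "n \<in> carrier M" using submodule_closed(1)[OF N] n by blast
    then have "r \<^bold>* (z \<^bold>- n) = r \<^bold>* z \<^bold>- r \<^bold>* n" using that by algebra
    with n \<open>n \<in> carrier M\<close> have "r \<^bold>* (z \<^bold>- n) = \<zero>\<^bsub>M\<^esub>"
      using that by (simp add: M.minus_eq M.r_neg)
    with tf that \<open>n \<in> carrier M\<close> have "z \<^bold>- n = \<zero>\<^bsub>M\<^esub>" by (auto simp: torsion_free_def)
    then have "z = n" using that \<open>n \<in> carrier M\<close> by (simp add: M.minus_eq_zero_iff)
    with n show ?thesis by simp
  qed
  with N show "submodule N R M \<and> ?r" by blast
next
  assume *: "submodule N R M \<and> ?r"
  note N = submodule_closed[OF conjunct1[OF *]]
  have "smult M r ` N = smult M r ` carrier M \<inter> N" if r: "r \<in> carrier R" for r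
  proof (intro equalityI subsetI)
    fix x assume "x \<in> smult M r ` N"
    with N(1) N(6)[OF r] show "x \<in> smult M r ` carrier M \<inter> N" by blast
  next
    fix x assume "x \<in> smult M r ` carrier M \<inter> N"
    then obtain z where z: "z \<in> carrier M" "x = r \<^bold>* z" "x \<in> N" by blast
    show "x \<in> smult M r ` N"
    proof (cases "r = \<zero>")
      case True
      with z N(1,2) have "x = r \<^bold>* \<zero>\<^bsub>M\<^esub>" by simp
      with N(2) show ?thesis by blast
    next
      case False
      with * r z have "z \<in> N" by blast
      with z(2) show ?thesis by blast
    qed
  qed
  with * show ?l by (auto simp: pure_submodule_def)
qed

text \<open>A complement is built as a submodule \<open>K\<close> that is maximal subject to \<open>U \<inter> K = 0\<close> and purity of \<open>U + K\<close>. If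
  \<open>y\<close> is outside \<open>U + K\<close>, the relations \<open>r z \<in> y + U + K\<close> prescribe cosets of the submodules \<open>r U\<close> in \<open>U\<close>. They are
  compatible because \<open>U + K\<close> is pure, and after subtracting a common element \<open>v\<close> of them from \<open>y\<close> the
  difference can be adjoined to \<open>K\<close>, contradicting maximality.\<close>

theorem linearly_compact_pure_summand:
  assumes vd: "valuation_dom R" and tf: "torsion_free R M" and U: "pure_submodule U R M"
    and lc: "\<And>F. \<lbrakk>F \<subseteq> (carrier R - {\<zero>}) \<times> U; F \<noteq> {};
        \<And>r u r' u'. \<lbrakk>(r, u) \<in> F; (r', u') \<in> F; r divides r'\<rbrakk> \<Longrightarrow> \<exists>w\<in>U. u' \<^bold>- u = r \<^bold>* w\<rbrakk>
      \<Longrightarrow> \<exists>v\<in>U. \<forall>(r, u)\<in>F. \<exists>w\<in>U. v \<^bold>- u = r \<^bold>* w"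
  shows "direct_summand U R M"
proof -
  interpret valuation_dom R by (rule vd)
  \<comment> \<open>\<open>c\<close> collects the membership facts that normalisation by \<open>algebra\<close> needs.\<close>
  note c = TrueI
  note pure_iff = pure_submodule_iff[OF tf domain_axioms]
  have Us: "submodule U R M" using U by (simp add: pure_submodule_def)
  note U' = submodule_closed[OF Us]
  define adm where "adm = {K. submodule K R M \<and> U \<inter> K = {\<zero>\<^bsub>M\<^esub>} \<and>
     (\<forall>r\<in>carrier R - {\<zero>}. \<forall>z\<in>carrier M. r \<^bold>* z \<in> U <+>\<^bsub>M\<^esub> K \<longrightarrow> z \<in> U <+>\<^bsub>M\<^esub> K)}"
  have sum: "z \<in> U <+>\<^bsub>M\<^esub> K \<longleftrightarrow> (\<exists>u\<in>U. \<exists>k\<in>K. z = u \<^bold>+ k)" for z K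
    by (simp add: set_add_def')
  have zero: "{\<zero>\<^bsub>M\<^esub>} \<in> adm"
  proof -
    have "submodule {\<zero>\<^bsub>M\<^esub>} R M" by (rule submoduleI) auto
    moreover have "z \<in> U <+>\<^bsub>M\<^esub> {\<zero>\<^bsub>M\<^esub>} \<longleftrightarrow> z \<in> U" for z
      using U'(1) by (auto simp: sum intro: bexI[of _ z])
    ultimately show ?thesis using U U'(2) unfolding adm_def pure_iff by auto
  qed
  have chain: "\<Union>C \<in> adm" if C: "C \<noteq> {}" "subset.chain adm C" for C
  proof -
    have adm: "K \<in> adm" if "K \<in> C" for K using C that by (auto simp: subset_chain_def)
    have dir: "\<exists>K\<in>C. x \<in> K \<and> y \<in> K" if "x \<in> \<Union>C" "y \<in> \<Union>C" for x y
      using C that unfolding subset_chain_def by blast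
    have sub: "submodule K R M" if "K \<in> C" for K using adm[OF that] by (simp add: adm_def)
    note sub = submodule_closed[OF this]
    have "submodule (\<Union>C) R M"
    proof (rule submoduleI)
      fix x y assume xy: "x \<in> \<Union>C" "y \<in> \<Union>C"
      obtain K where "K \<in> C" "x \<in> K" "y \<in> K" using dir[OF xy] by blast
      with sub(3)[of K x y] show "x \<^bold>+ y \<in> \<Union>C" by blast
    next
      obtain K where "K \<in> C" using C by blast
      with sub(2)[of K] show "\<zero>\<^bsub>M\<^esub> \<in> \<Union>C" by blast
    next
      show "\<Union>C \<subseteq> carrier M" using sub(1) by auto
    next
      fix x assume "x \<in> \<Union>C"
      then obtain K where "K \<in> C" "x \<in> K" by blast
      with sub(4)[of K x] show "\<ominus>\<^bsub>M\<^esub> x \<in> \<Union>C" by blast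
      fix a assume "a \<in> carrier R"
      with \<open>K \<in> C\<close> \<open>x \<in> K\<close> sub(6)[of K a x] show "a \<^bold>* x \<in> \<Union>C" by blast
    qed
    moreover have "U \<inter> \<Union>C = {\<zero>\<^bsub>M\<^esub>}" using adm C by (auto simp: adm_def)
    moreover have "z \<in> U <+>\<^bsub>M\<^esub> \<Union>C"
      if z: "r \<in> carrier R - {\<zero>}" "z \<in> carrier M" "r \<^bold>* z \<in> U <+>\<^bsub>M\<^esub> \<Union>C" for r z
    proof -
      from z obtain K where "K \<in> C" "r \<^bold>* z \<in> U <+>\<^bsub>M\<^esub> K" by (auto simp: sum)
      with adm[of K] z have "z \<in> U <+>\<^bsub>M\<^esub> K" by (auto simp: adm_def)
      with \<open>K \<in> C\<close> show ?thesis by (auto simp: sum)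
    qed
    ultimately show ?thesis by (auto simp: adm_def)
  qed
  obtain K where K: "K \<in> adm" and Kmax: "\<And>K'. K' \<in> adm \<Longrightarrow> K \<subseteq> K' \<Longrightarrow> K' = K"
    using subset_Zorn_nonempty[of adm] zero chain by (metis empty_iff)
  have Ksub: "submodule K R M" and UK: "U \<inter> K = {\<zero>\<^bsub>M\<^esub>}"
    and Npure: "\<And>r z. \<lbrakk>r \<in> carrier R; r \<noteq> \<zero>; z \<in> carrier M; r \<^bold>* z \<in> U <+>\<^bsub>M\<^esub> K\<rbrakk> \<Longrightarrow> z \<in> U <+>\<^bsub>M\<^esub> K"
    using K by (auto simp: adm_def)
  note K' = submodule_closed[OF Ksub]
  have "U <+>\<^bsub>M\<^esub> K = carrier M"
  proof (rule ccontr)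
    assume "U <+>\<^bsub>M\<^esub> K \<noteq> carrier M"
    moreover have "U <+>\<^bsub>M\<^esub> K \<subseteq> carrier M" using U'(1) K'(1) by (auto simp: sum)
    ultimately obtain y where y: "y \<in> carrier M" "y \<notin> U <+>\<^bsub>M\<^esub> K" by blast
    \<comment> \<open>The cosets of \<open>r U\<close> in which the \<open>U\<close>-component of \<open>y\<close> must lie.\<close>
    define F where "F = {(r, u). r \<in> carrier R \<and> r \<noteq> \<zero> \<and> u \<in> U \<and>
       (\<exists>z\<in>carrier M. \<exists>k\<in>K. r \<^bold>* z = (y \<^bold>- u) \<^bold>+ k)}"
    have "\<exists>v\<in>U. \<forall>(r, u)\<in>F. \<exists>w\<in>U. v \<^bold>- u = r \<^bold>* w"
    proof (rule lc)
      show "F \<subseteq> (carrier R - {\<zero>}) \<times> U" by (auto simp: F_def)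
      have "\<one> \<^bold>* y = (y \<^bold>- \<zero>\<^bsub>M\<^esub>) \<^bold>+ \<zero>\<^bsub>M\<^esub>" using y(1) by algebra
      then have "\<exists>z\<in>carrier M. \<exists>k\<in>K. \<one> \<^bold>* z = (y \<^bold>- \<zero>\<^bsub>M\<^esub>) \<^bold>+ k"
        using y(1) K'(2) by blast
      then have "(\<one>, \<zero>\<^bsub>M\<^esub>) \<in> F" unfolding F_def using U'(2) by simp
      then show "F \<noteq> {}" by blast
      fix r u r' u' assume F: "(r, u) \<in> F" "(r', u') \<in> F" and "r divides r'"
      then obtain e where e: "e \<in> carrier R" "r' = r \<otimes> e" by (auto simp: factor_def)
      from F(1) obtain z k where z: "r \<in> carrier R" "r \<noteq> \<zero>" "u \<in> U" "z \<in> carrier M" "k \<in> K"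
        "r \<^bold>* z = (y \<^bold>- u) \<^bold>+ k" by (auto simp: F_def)
      from F(2) obtain z' k' where z': "u' \<in> U" "z' \<in> carrier M" "k' \<in> K"
        "r' \<^bold>* z' = (y \<^bold>- u') \<^bold>+ k'" by (auto simp: F_def)
      note c [simp] = c U'(1)[OF z(3)] U'(1)[OF z'(1)] K'(1)[OF z(5)] K'(1)[OF z'(3)] z(1,4) z'(2) y(1) e(1)
      define x where "x = z \<^bold>- e \<^bold>* z'"
      have xc: "x \<in> carrier M" by (simp add: x_def)
      have "r \<^bold>* x = r \<^bold>* z \<^bold>- (r \<otimes> e) \<^bold>* z'"
        unfolding x_def M.minus_eq by (simp add: smult_r_distr smult_r_minus smult_assoc1)
      also have "\<dots> = ((y \<^bold>- u) \<^bold>+ k) \<^bold>- ((y \<^bold>- u') \<^bold>+ k')"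
        using z(6) z'(4) e(2) by simp
      also have "\<dots> = (u' \<^bold>- u) \<^bold>+ (k \<^bold>- k')" using c by algebra
      finally have rx: "r \<^bold>* x = (u' \<^bold>- u) \<^bold>+ (k \<^bold>- k')" .
      then have "r \<^bold>* x \<in> U <+>\<^bsub>M\<^esub> K"
        using U'(5)[OF z'(1) z(3)] K'(5)[OF z(5) z'(3)] unfolding sum by blast
      from Npure[OF z(1,2) xc this] obtain w l where w: "w \<in> U" "l \<in> K" "x = w \<^bold>+ l"
        by (auto simp: sum)
      note c [simp] = c U'(1)[OF w(1)] K'(1)[OF w(2)]
      have eq: "r \<^bold>* w \<^bold>+ r \<^bold>* l = (u' \<^bold>- u) \<^bold>+ (k \<^bold>- k')"
        using rx w(3) by (simp add: smult_r_distr)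
      have "(u' \<^bold>- u) \<^bold>- r \<^bold>* w = ((u' \<^bold>- u) \<^bold>+ (k \<^bold>- k')) \<^bold>- (k \<^bold>- k') \<^bold>- r \<^bold>* w"
        using c by algebra
      also have "\<dots> = (r \<^bold>* w \<^bold>+ r \<^bold>* l) \<^bold>- (k \<^bold>- k') \<^bold>- r \<^bold>* w"
        using eq by simp
      also have "\<dots> = r \<^bold>* l \<^bold>- (k \<^bold>- k')" using c by algebra
      finally have "(u' \<^bold>- u) \<^bold>- r \<^bold>* w = r \<^bold>* l \<^bold>- (k \<^bold>- k')" .
      moreover have "(u' \<^bold>- u) \<^bold>- r \<^bold>* w \<in> U" using z z' w U' by simp
      moreover have "r \<^bold>* l \<^bold>- (k \<^bold>- k') \<in> K" using z z' w K' by simp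
      ultimately have "(u' \<^bold>- u) \<^bold>- r \<^bold>* w = \<zero>\<^bsub>M\<^esub>" using UK by auto
      then have "u' \<^bold>- u = r \<^bold>* w" by (simp add: M.minus_eq_zero_iff)
      with w(1) show "\<exists>w\<in>U. u' \<^bold>- u = r \<^bold>* w" by blast
    qed
    then obtain v where v: "v \<in> U"
      and v_lim: "\<And>r u. (r, u) \<in> F \<Longrightarrow> \<exists>w\<in>U. v \<^bold>- u = r \<^bold>* w" by blast
    define y' where "y' = y \<^bold>- v"
    have c [simp]: "v \<in> carrier M" "y' \<in> carrier M" using U'(1)[OF v] y(1) by (auto simp: y'_def)
    \<comment> \<open>The pure closure of \<open>K + R y'\<close>.\<close>
    define K1 where "K1 = {z \<in> carrier M. \<exists>t\<in>carrier R. t \<noteq> \<zero> \<and> (\<exists>k\<in>K. \<exists>s\<in>carrier R. t \<^bold>* z = k \<^bold>+ s \<^bold>* y')}"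
    have K1I: "z \<in> K1" if "z \<in> carrier M" "t \<in> carrier R" "t \<noteq> \<zero>" "k \<in> K" "s \<in> carrier R"
      "t \<^bold>* z = k \<^bold>+ s \<^bold>* y'" for z t k s
      using that by (auto simp: K1_def)
    have K1sub: "submodule K1 R M"
    proof (rule submoduleI)
      show "K1 \<subseteq> carrier M" by (auto simp: K1_def)
      show "\<zero>\<^bsub>M\<^esub> \<in> K1" using K'(2) by (intro K1I[of _ \<one> "\<zero>\<^bsub>M\<^esub>" \<zero>]) auto
      have sm: "a \<^bold>* x \<in> K1" if a: "a \<in> carrier R" and "x \<in> K1" for a x
      proof -
        from that(2) obtain t k s where x: "x \<in> carrier M" "t \<in> carrier R" "t \<noteq> \<zero>" "k \<in> K" "s \<in> carrier R"
          "t \<^bold>* x = k \<^bold>+ s \<^bold>* y'" unfolding K1_def by blast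
        note c [simp] = c K'(1)[OF x(4)] x(1,2,5) a
        have "t \<^bold>* (a \<^bold>* x) = a \<^bold>* (t \<^bold>* x)" by (simp add: smult_assoc1[symmetric] R.m_comm)
        also have "\<dots> = a \<^bold>* k \<^bold>+ (a \<otimes> s) \<^bold>* y'"
          unfolding x(6) by (simp add: smult_r_distr smult_assoc1)
        finally show ?thesis using x K'(6)[OF a x(4)] by (intro K1I[of _ t "a \<^bold>* k" "a \<otimes> s"]) auto
      qed
      then show "a \<^bold>* x \<in> K1" if "a \<in> carrier R" "x \<in> K1" for a x using that .
      show "\<ominus>\<^bsub>M\<^esub> x \<in> K1" if "x \<in> K1" for x
        using sm[of "\<ominus> \<one>" x] that by (auto simp: smult_l_minus K1_def)
      fix x x' assume "x \<in> K1" "x' \<in> K1"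
      from this(1) obtain t k s where x: "x \<in> carrier M" "t \<in> carrier R" "t \<noteq> \<zero>" "k \<in> K" "s \<in> carrier R"
          "t \<^bold>* x = k \<^bold>+ s \<^bold>* y'" unfolding K1_def by blast
      from \<open>x' \<in> K1\<close> obtain t' k' s' where x': "x' \<in> carrier M" "t' \<in> carrier R" "t' \<noteq> \<zero>" "k' \<in> K" "s' \<in> carrier R"
          "t' \<^bold>* x' = k' \<^bold>+ s' \<^bold>* y'" unfolding K1_def by blast
      note c [simp] = c K'(1)[OF x(4)] x(1,2,5) K'(1)[OF x'(4)] x'(1,2,5)
      have "(t \<otimes> t') \<^bold>* (x \<^bold>+ x') = t' \<^bold>* (t \<^bold>* x) \<^bold>+ t \<^bold>* (t' \<^bold>* x')"
        by (simp add: smult_assoc1[symmetric] smult_r_distr R.m_comm)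
      also have "\<dots> = (t' \<^bold>* k \<^bold>+ t \<^bold>* k') \<^bold>+ (t' \<otimes> s \<oplus> t \<otimes> s') \<^bold>* y'"
        unfolding x(6) x'(6) using c by algebra
      finally show "x \<^bold>+ x' \<in> K1"
        using x x' K' by (intro K1I[of _ "t \<otimes> t'" "t' \<^bold>* k \<^bold>+ t \<^bold>* k'" "t' \<otimes> s \<oplus> t \<otimes> s'"])
          (auto simp: integral_iff)
    qed
    note K1' = submodule_closed[OF K1sub]
    have KK1: "K \<subseteq> K1" using K'(1) by (intro subsetI K1I[of _ \<one> _ \<zero>]) auto
    have y1: "y' \<in> K1" using K'(2) by (intro K1I[of _ \<one> "\<zero>\<^bsub>M\<^esub>" \<one>]) auto
    have yN: "y \<in> U <+>\<^bsub>M\<^esub> K" if "u \<in> U" "k \<in> K" "s \<in> carrier R" "s \<noteq> \<zero>" "u = k \<^bold>+ s \<^bold>* y'" for u k s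
    proof (rule Npure)
      note c [simp] = c U'(1)[OF that(1)] K'(1)[OF that(2)] that(3) y(1)
      have "s \<^bold>* y = (u \<^bold>+ s \<^bold>* v) \<^bold>+ (\<ominus>\<^bsub>M\<^esub> k)" unfolding that(5) y'_def using c by algebra
      with U'(3)[OF that(1) U'(6)[OF that(3) v]] K'(4)[OF that(2)]
      show "s \<^bold>* y \<in> U <+>\<^bsub>M\<^esub> K" unfolding sum by blast
    qed (use that y in auto)
    have "U \<inter> K1 = {\<zero>\<^bsub>M\<^esub>}"
    proof -
      have "z = \<zero>\<^bsub>M\<^esub>" if z: "z \<in> U" "z \<in> K1" for z
      proof -
        from z(2) obtain t k s where x: "z \<in> carrier M" "t \<in> carrier R" "t \<noteq> \<zero>" "k \<in> K" "s \<in> carrier R"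
          "t \<^bold>* z = k \<^bold>+ s \<^bold>* y'" unfolding K1_def by blast
        have tz: "t \<^bold>* z \<in> U" by (rule U'(6)[OF x(2) z(1)])
        show ?thesis
        proof (cases "s = \<zero>")
          case True
          with x K'(1)[OF x(4)] c have "t \<^bold>* z \<in> K" by simp
          with tz UK have "t \<^bold>* z = \<zero>\<^bsub>M\<^esub>" by blast
          with tf x show ?thesis by (auto simp: torsion_free_def)
        next
          case False
          with yN[OF tz x(4,5) False x(6)] y(2) show ?thesis by blast
        qed
      qed
      then show ?thesis using U'(2) K1'(2) by blast
    qed
    moreover have "z \<in> U <+>\<^bsub>M\<^esub> K1"
      if z: "r \<in> carrier R" "r \<noteq> \<zero>" "z \<in> carrier M" "r \<^bold>* z \<in> U <+>\<^bsub>M\<^esub> K1" for r z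
    proof -
      from z(4) obtain u k1 where u: "u \<in> U" "k1 \<in> K1" "r \<^bold>* z = u \<^bold>+ k1" by (auto simp: sum)
      from u(2) obtain t k s where x: "k1 \<in> carrier M" "t \<in> carrier R" "t \<noteq> \<zero>" "k \<in> K" "s \<in> carrier R"
          "t \<^bold>* k1 = k \<^bold>+ s \<^bold>* y'" unfolding K1_def by blast
      note c [simp] = c U'(1)[OF u(1)] K'(1)[OF x(4)] x(1,2,5) z(1,3) y(1)
      have "(t \<otimes> r) \<^bold>* z = t \<^bold>* u \<^bold>+ (k \<^bold>+ s \<^bold>* y')"
        by (simp add: smult_assoc1 u(3) smult_r_distr x(6))
      also have "\<dots> = (t \<^bold>* u \<^bold>+ k) \<^bold>+ s \<^bold>* y'" using c by algebra
      finally have eq: "(t \<otimes> r) \<^bold>* z = (t \<^bold>* u \<^bold>+ k) \<^bold>+ s \<^bold>* y'" .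
      define q where "q = t \<otimes> r"
      have q: "q \<in> carrier R" "q \<noteq> \<zero>" using x z by (auto simp: q_def integral_iff)
      note c [simp] = c q(1)
      consider (l) "q divides s" | (r) "s divides q" using divides_total[of q s] by auto
      then show ?thesis
      proof cases
        case l
        then obtain s' where s': "s' \<in> carrier R" "s = q \<otimes> s'" by (auto simp: factor_def)
        note c [simp] = c s'(1)
        have "q \<^bold>* (z \<^bold>- s' \<^bold>* y') = q \<^bold>* z \<^bold>- s \<^bold>* y'"
          unfolding s'(2) using c by algebra
        also have "\<dots> = ((t \<^bold>* u \<^bold>+ k) \<^bold>+ s \<^bold>* y') \<^bold>- s \<^bold>* y'"
          using eq by (simp add: q_def)
        also have "\<dots> = t \<^bold>* u \<^bold>+ k" using c by algebra
        finally have "q \<^bold>* (z \<^bold>- s' \<^bold>* y') \<in> U <+>\<^bsub>M\<^esub> K"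
          using U'(6)[OF x(2) u(1)] x(4) unfolding sum by blast
        with Npure[OF q] have "z \<^bold>- s' \<^bold>* y' \<in> U <+>\<^bsub>M\<^esub> K" by simp
        then obtain u1 l1 where w: "u1 \<in> U" "l1 \<in> K" "z \<^bold>- s' \<^bold>* y' = u1 \<^bold>+ l1"
          unfolding sum by blast
        note c [simp] = c U'(1)[OF w(1)] K'(1)[OF w(2)]
        have "z = (z \<^bold>- s' \<^bold>* y') \<^bold>+ s' \<^bold>* y'" using c by algebra
        also have "\<dots> = u1 \<^bold>+ (l1 \<^bold>+ s' \<^bold>* y')" unfolding w(3) using c by algebra
        finally show ?thesis using w(1) K1'(3)[OF subsetD[OF KK1 w(2)] K1'(6)[OF s'(1) y1]] unfolding sum by blast
      next
        case r
        then obtain t' where t': "t' \<in> carrier R" "q = s \<otimes> t'" by (auto simp: factor_def)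
        note c [simp] = c t'(1)
        have s0: "s \<noteq> \<zero>" and t0: "t' \<noteq> \<zero>" using t' q x by auto
        have "s \<^bold>* (t' \<^bold>* z \<^bold>- y') = q \<^bold>* z \<^bold>- s \<^bold>* y'"
          unfolding t'(2) using c by algebra
        also have "\<dots> = ((t \<^bold>* u \<^bold>+ k) \<^bold>+ s \<^bold>* y') \<^bold>- s \<^bold>* y'"
          using eq by (simp add: q_def)
        also have "\<dots> = t \<^bold>* u \<^bold>+ k" using c by algebra
        finally have "s \<^bold>* (t' \<^bold>* z \<^bold>- y') \<in> U <+>\<^bsub>M\<^esub> K"
          using U'(6)[OF x(2) u(1)] x(4) unfolding sum by blast
        with Npure[OF x(5) s0] have "t' \<^bold>* z \<^bold>- y' \<in> U <+>\<^bsub>M\<^esub> K" by simp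
        then obtain u1 l1 where w: "u1 \<in> U" "l1 \<in> K" "t' \<^bold>* z \<^bold>- y' = u1 \<^bold>+ l1"
          unfolding sum by blast
        note c [simp] = c U'(1)[OF w(1)] K'(1)[OF w(2)]
        have "t' \<^bold>* z = (t' \<^bold>* z \<^bold>- y') \<^bold>+ y'" using c by algebra
        then have tz: "t' \<^bold>* z = (u1 \<^bold>+ l1) \<^bold>+ y'" using w(3) by simp
        also have "\<dots> = (y \<^bold>- (v \<^bold>- u1)) \<^bold>+ l1" unfolding y'_def using c by algebra
        finally have "(t', v \<^bold>- u1) \<in> F"
          using t' t0 w U'(5)[OF v w(1)] z(3) by (auto simp: F_def)
        from v_lim[OF this] obtain w' where w': "w' \<in> U" "v \<^bold>- (v \<^bold>- u1) = t' \<^bold>* w'" by blast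
        note c [simp] = c U'(1)[OF w'(1)]
        have "v \<^bold>- (v \<^bold>- u1) = u1" using c by algebra
        with w'(2) have u1: "u1 = t' \<^bold>* w'" by simp
        have "t' \<^bold>* (z \<^bold>- w') = t' \<^bold>* z \<^bold>- t' \<^bold>* w'" using c by algebra
        also have "\<dots> = ((u1 \<^bold>+ l1) \<^bold>+ y') \<^bold>- u1" using tz u1 by simp
        also have "\<dots> = l1 \<^bold>+ \<one> \<^bold>* y'" using c by algebra
        finally have "z \<^bold>- w' \<in> K1" using t0 w(2) by (intro K1I[of _ t' l1 \<one>]) auto
        moreover have "z = w' \<^bold>+ (z \<^bold>- w')" using c by algebra
        ultimately show ?thesis using w'(1) unfolding sum by blast
      qed
    qed
    ultimately have "K1 \<in> adm" using K1sub by (auto simp: adm_def)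
    from Kmax[OF this KK1] y1 have "y' \<in> K" by simp
    moreover have "y = v \<^bold>+ y'" using y(1) c unfolding y'_def by algebra
    ultimately show False using y(2) v unfolding sum by blast
  qed
  with Us Ksub UK show ?thesis by (auto simp: direct_summand_def)
qed

end

section \<open>Completeness of quotients and linear compactness\<close>

context
  fixes V :: "('a, 'c) ring_scheme" (structure) and A :: "'a set"
  assumes V: "valuation_ring V" and A: "ideal A V"
begin

interpretation cring V using V by (simp add: valuation_ring_iff)
interpretation A: ideal A V by (rule A)

lemma quotient_valuation_ring: "valuation_ring (V Quot A)"
proof (rule valuation_ringI)
  show "cring (V Quot A)" by (rule A.quotient_is_cring[OF is_cring])
  fix X Y assume "X \<in> carrier (V Quot A)" "Y \<in> carrier (V Quot A)"
  then obtain a b where a: "a \<in> carrier V" "X = A +> a" "b \<in> carrier V" "Y = A +> b"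
    by (auto simp: FactRing_def A_RCOSETS_def')
  have *: "(A +> x) divides\<^bsub>V Quot A\<^esub> (A +> y)"
    if xy: "x \<in> carrier V" "y \<in> carrier V" "x divides y" for x y
  proof -
    from xy obtain t where t: "t \<in> carrier V" "y = x \<otimes> t" by (auto simp: factor_def)
    then have "A +> y = (A +> x) \<otimes>\<^bsub>V Quot A\<^esub> (A +> t)"
      using xy ring_hom_mult[OF A.rcos_ring_hom] by simp
    then show ?thesis using ring_hom_closed[OF A.rcos_ring_hom t(1)] by (auto simp: factor_def)
  qed
  show "X divides\<^bsub>V Quot A\<^esub> Y \<or> Y divides\<^bsub>V Quot A\<^esub> X"
    using valuation_ring_divides_total[OF V a(1,3)] * a by auto
qed

lemma quotient_carrier: "X \<in> carrier (V Quot A) \<longleftrightarrow> (\<exists>a\<in>carrier V. X = A +> a)"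
  by (auto simp: FactRing_def A_RCOSETS_def')

lemma coset_minus:
  assumes "a \<in> carrier V" "b \<in> carrier V"
  shows "(A +> a) \<ominus>\<^bsub>V Quot A\<^esub> (A +> b) = A +> (a \<ominus> b)"
proof -
  interpret h: ring_hom_cring V "V Quot A" "(+>) A"
    by (rule A.rcos_ring_hom_cring[OF is_cring])
  show ?thesis using assms by (simp add: minus_eq h.S.minus_eq)
qed

lemma coset_in_image_iff:
  assumes "ideal B V" "A \<subseteq> B" "a \<in> carrier V"
  shows "A +> a \<in> (+>) A ` B \<longleftrightarrow> a \<in> B"
proof
  interpret B: ideal B V by fact
  assume "A +> a \<in> (+>) A ` B"
  then obtain b where b: "b \<in> B" "A +> a = A +> b" by blast
  then have "a \<ominus> b \<in> B"
    using quotient_eq_iff_same_a_r_cos[OF A assms(3), of b] assms(2) B.Icarr by auto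
  then have "(a \<ominus> b) \<oplus> b \<in> B" using b(1) by simp
  moreover have "(a \<ominus> b) \<oplus> b = a" using assms(3) B.Icarr[OF b(1)] by algebra
  ultimately show "a \<in> B" by simp
qed blast

lemma image_ideal_nonzero:
  assumes "ideal B V" "A \<subset> B"
  shows "ideal ((+>) A ` B) (V Quot A)" "(+>) A ` B \<noteq> {\<zero>\<^bsub>V Quot A\<^esub>}"
proof -
  show "ideal ((+>) A ` B) (V Quot A)" by (rule ring_ideal_imp_quot_ideal[OF A assms(1)])
  from assms obtain b where b: "b \<in> B" "b \<notin> A" by blast
  then have "b \<in> carrier V" using assms(1) by (auto simp: ideal.Icarr)
  with b have "A +> b \<noteq> A" using A.rcos_const_imp_mem by blast
  with b show "(+>) A ` B \<noteq> {\<zero>\<^bsub>V Quot A\<^esub>}" by (auto simp: FactRing_def)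
qed

lemma vimage_ideal:
  assumes "ideal K (V Quot A)" "K \<noteq> {\<zero>\<^bsub>V Quot A\<^esub>}"
  shows "ideal {a \<in> carrier V. A +> a \<in> K} V" "A \<subset> {a \<in> carrier V. A +> a \<in> K}"
proof -
  have zero: "A +> a = \<zero>\<^bsub>V Quot A\<^esub>" if "a \<in> A" for a
    using a_rcos_zero[OF A that] by (simp add: FactRing_def)
  interpret h: ring_hom_cring V "V Quot A" "(+>) A"
    by (rule A.rcos_ring_hom_cring[OF is_cring])
  interpret K: ideal K "V Quot A" by fact
  show "ideal {a \<in> carrier V. A +> a \<in> K} V" by (rule ring_hom_ring.ideal_vimage[OF A.rcos_ring_hom_ring assms(1)])
  have "A \<subseteq> {a \<in> carrier V. A +> a \<in> K}"
  proof
    fix a assume "a \<in> A"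
    with zero[OF this] A.Icarr[OF this] K.zero_closed show "a \<in> {a \<in> carrier V. A +> a \<in> K}" by simp
  qed
  moreover obtain X where "X \<in> K" "X \<noteq> \<zero>\<^bsub>V Quot A\<^esub>"
    using assms(2) K.zero_closed by blast
  moreover from this obtain a where "a \<in> carrier V" "X = A +> a"
    using K.Icarr[of X] quotient_carrier by blast
  moreover from calculation have "a \<notin> A" using zero by blast
  ultimately show "A \<subset> {a \<in> carrier V. A +> a \<in> K}" by blast
qed

text \<open>Since the nonzero ideals of the quotient are the images of the ideals properly containing \<open>A\<close>, convergence in
  the quotient can be handled with representatives and ideals of \<open>V\<close> only.\<close>

lemma Cauchy_net_quotient_iff:
  assumes x: "x \<in> D \<rightarrow> carrier V"
  shows "Cauchy_net (V Quot A) D leq (\<lambda>i. A +> x i) \<longleftrightarrow>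
    (\<forall>B. ideal B V \<and> A \<subset> B \<longrightarrow>
      (\<exists>k\<in>D. \<forall>i\<in>D. \<forall>j\<in>D. leq k i \<and> leq k j \<longrightarrow> x i \<ominus> x j \<in> B))" (is "?l \<longleftrightarrow> ?r")
proof -
  note op = openin_ideal_topology[OF quotient_valuation_ring]
  interpret Q: cring "V Quot A" by (rule A.quotient_is_cring[OF is_cring])
  have zero: "K +>\<^bsub>V Quot A\<^esub> \<zero>\<^bsub>V Quot A\<^esub> = K" if "ideal K (V Quot A)" for K
    using that by (simp add: Q.a_coset_add_zero additive_subgroup.a_subset ideal.axioms(1))
  have diff: "(A +> x i) \<ominus>\<^bsub>V Quot A\<^esub> (A +> x j) = A +> (x i \<ominus> x j)" if "i \<in> D" "j \<in> D" for i j
    using x that by (intro coset_minus) auto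
  show ?thesis
  proof
    assume l: ?l
    show ?r
    proof (intro allI impI)
      fix B assume B: "ideal B V \<and> A \<subset> B"
      let ?K = "(+>) A ` B"
      from B have K: "ideal ?K (V Quot A)" "?K \<noteq> {\<zero>\<^bsub>V Quot A\<^esub>}" using image_ideal_nonzero by auto
      have "?K +>\<^bsub>V Quot A\<^esub> y = ?K" if "y \<in> ?K" for y
        using K(1) that Q.a_rcos_zero by simp
      with K have "openin (ideal_topology (V Quot A)) ?K"
        unfolding op using ideal.Icarr[OF K(1)] by (metis order_refl subsetI)
      moreover have "\<zero>\<^bsub>V Quot A\<^esub> \<in> ?K" using K(1) by (simp add: additive_subgroup.zero_closed ideal.axioms(1))
      ultimately obtain k where k: "k \<in> D" and
        *: "\<And>i j. i \<in> D \<Longrightarrow> j \<in> D \<Longrightarrow> leq k i \<Longrightarrow> leq k j \<Longrightarrow> A +> (x i \<ominus> x j) \<in> ?K"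
        using l diff unfolding Cauchy_net_def by metis
      have "x i \<ominus> x j \<in> B" if "i \<in> D" "j \<in> D" "leq k i" "leq k j" for i j
      proof -
        have "x i \<ominus> x j \<in> carrier V" using x that by auto
        with *[OF that] coset_in_image_iff[of B] B show ?thesis by blast
      qed
      with k show "\<exists>k\<in>D. \<forall>i\<in>D. \<forall>j\<in>D. leq k i \<and> leq k j \<longrightarrow> x i \<ominus> x j \<in> B" by blast
    qed
  next
    assume r: ?r
    show ?l
      unfolding Cauchy_net_def
    proof (intro conjI allI impI)
      show "(\<lambda>i. A +> x i) \<in> D \<rightarrow> carrier (V Quot A)"
        using x unfolding Pi_def quotient_carrier by blast
      fix U assume "openin (ideal_topology (V Quot A)) U \<and> \<zero>\<^bsub>V Quot A\<^esub> \<in> U"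
      then obtain K where K: "ideal K (V Quot A)" "K \<noteq> {\<zero>\<^bsub>V Quot A\<^esub>}" "K \<subseteq> U"
        unfolding op using zero by metis
      from r vimage_ideal[OF K(1,2)] obtain k where "k \<in> D"
        "\<And>i j. i \<in> D \<Longrightarrow> j \<in> D \<Longrightarrow> leq k i \<Longrightarrow> leq k j \<Longrightarrow> A +> (x i \<ominus> x j) \<in> K"
        by (metis (mono_tags, lifting) mem_Collect_eq)
      with K(3) diff show "\<exists>k\<in>D. \<forall>i\<in>D. \<forall>j\<in>D. leq k i \<and> leq k j \<longrightarrow>
          (A +> x i) \<ominus>\<^bsub>V Quot A\<^esub> (A +> x j) \<in> U"
        by (metis subsetD)
    qed
  qed
qed

lemma net_converges_quotient_iff:
  assumes x: "x \<in> D \<rightarrow> carrier V" and l: "l \<in> carrier V"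
  shows "net_converges (V Quot A) D leq (\<lambda>i. A +> x i) (A +> l) \<longleftrightarrow>
    (\<forall>B. ideal B V \<and> A \<subset> B \<longrightarrow> (\<exists>k\<in>D. \<forall>i\<in>D. leq k i \<longrightarrow> x i \<ominus> l \<in> B))" (is "?l \<longleftrightarrow> ?r")
proof -
  note op = openin_ideal_topology[OF quotient_valuation_ring]
  interpret Q: cring "V Quot A" by (rule A.quotient_is_cring[OF is_cring])
  have lc: "A +> l \<in> carrier (V Quot A)" using l by (auto simp: quotient_carrier)
  have coset: "A +> x i \<in> K +>\<^bsub>V Quot A\<^esub> (A +> l) \<longleftrightarrow> A +> (x i \<ominus> l) \<in> K"
    if i: "i \<in> D" and K: "ideal K (V Quot A)" for i K
  proof -
    interpret K: ideal K "V Quot A" by fact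
    have xi: "x i \<in> carrier V" using x i by blast
    then have "A +> x i \<in> carrier (V Quot A)" by (auto simp: quotient_carrier)
    from K.a_rcos_module_minus[OF Q.ring_axioms lc this] coset_minus[OF xi l]
    show ?thesis by simp
  qed
  show ?thesis
  proof
    assume L: ?l
    show ?r
    proof (intro allI impI)
      fix B assume B: "ideal B V \<and> A \<subset> B"
      let ?K = "(+>) A ` B"
      from B have K: "ideal ?K (V Quot A)" "?K \<noteq> {\<zero>\<^bsub>V Quot A\<^esub>}" using image_ideal_nonzero by auto
      interpret K: ideal ?K "V Quot A" by (rule K(1))
      let ?U = "?K +>\<^bsub>V Quot A\<^esub> (A +> l)"
      have "?K +>\<^bsub>V Quot A\<^esub> y = ?U" if "y \<in> ?U" for y
        using Q.a_repr_independence[OF that lc K.a_subgroup] by simp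
      with K have "openin (ideal_topology (V Quot A)) ?U"
        unfolding op using Q.a_r_coset_subset_G[OF K.a_subset lc] by (metis order_refl)
      moreover have "A +> l \<in> ?U" by (rule K.a_rcos_self[OF lc])
      ultimately obtain k where k: "k \<in> D" and
        *: "\<And>i. i \<in> D \<Longrightarrow> leq k i \<Longrightarrow> A +> (x i \<ominus> l) \<in> ?K"
        using L coset[OF _ K(1)] unfolding net_converges_def by metis
      have "x i \<ominus> l \<in> B" if "i \<in> D" "leq k i" for i
      proof -
        have "x i \<ominus> l \<in> carrier V" using x l that by auto
        with *[OF that] coset_in_image_iff[of B] B show ?thesis by blast
      qed
      with k show "\<exists>k\<in>D. \<forall>i\<in>D. leq k i \<longrightarrow> x i \<ominus> l \<in> B" by blast
    qed
  next
    assume r: ?r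
    show ?l
      unfolding net_converges_def
    proof (intro conjI allI impI lc)
      fix U assume "openin (ideal_topology (V Quot A)) U \<and> A +> l \<in> U"
      then obtain K where K: "ideal K (V Quot A)" "K \<noteq> {\<zero>\<^bsub>V Quot A\<^esub>}"
        "K +>\<^bsub>V Quot A\<^esub> (A +> l) \<subseteq> U"
        unfolding op by metis
      from r vimage_ideal[OF K(1,2)] obtain k where "k \<in> D"
        "\<And>i. i \<in> D \<Longrightarrow> leq k i \<Longrightarrow> A +> (x i \<ominus> l) \<in> K"
        by (metis (mono_tags, lifting) mem_Collect_eq)
      with K(3) coset[OF _ K(1)] show "\<exists>k\<in>D. \<forall>i\<in>D. leq k i \<longrightarrow> A +> x i \<in> U"
        by (metis subsetD)
    qed
  qed
qed

end

lemma valuation_ring_unit: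
  assumes V: "valuation_ring V" and P: "maximalideal P V" and t: "t \<in> carrier V" "t \<notin> P"
  shows "t \<in> Units V"
proof -
  interpret cring V using V by (simp add: valuation_ring_iff)
  interpret P: maximalideal P V by (rule P)
  have I: "ideal (PIdl\<^bsub>V\<^esub> t) V" "t \<in> PIdl\<^bsub>V\<^esub> t" using t cgenideal_ideal cgenideal_self by auto
  then have "P \<subseteq> PIdl\<^bsub>V\<^esub> t" using V P.is_ideal t(2) by (auto simp: valuation_ring_iff)
  then have "PIdl\<^bsub>V\<^esub> t = carrier V"
    using P.I_maximal[OF I(1)] I t(2) ideal.Icarr[OF I(1)] by blast
  then have "\<one>\<^bsub>V\<^esub> \<in> PIdl\<^bsub>V\<^esub> t" by simp
  then obtain s where "s \<in> carrier V" "\<one>\<^bsub>V\<^esub> = s \<otimes>\<^bsub>V\<^esub> t" by (auto simp: cgenideal_def)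
  then show ?thesis using t m_comm by (auto simp: Units_def)
qed

text \<open>Let \<open>A\<close> be the intersection of the ideals \<open>B i\<close>. If \<open>A\<close> is one of them, a representative of that coset is common
  to all. Otherwise \<open>A\<close> is not of the form \<open>P a\<close> with \<open>a \<noteq> 0\<close>, since every ideal properly containing \<open>P a\<close>
  contains \<open>a\<close>; so the quotient by \<open>A\<close> is complete, and the representatives form a Cauchy net there.\<close>

theorem maximal_linearly_compact:
  fixes V (structure)
  assumes max: "maximal_valuation_ring V" and D: "D \<noteq> {}"
    and B: "\<And>i. i \<in> D \<Longrightarrow> ideal (B i) V" and x: "\<And>i. i \<in> D \<Longrightarrow> x i \<in> carrier V"
    and compat: "\<And>i j. \<lbrakk>i \<in> D; j \<in> D; B j \<subseteq> B i\<rbrakk> \<Longrightarrow> x j \<ominus> x i \<in> B i"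
  shows "\<exists>l\<in>carrier V. \<forall>i\<in>D. l \<ominus> x i \<in> B i"
proof -
  from max have V: "valuation_ring V" by (simp add: maximal_valuation_ring_def)
  from max obtain P where P: "maximalideal P V"
    and compl: "\<And>A. \<lbrakk>ideal A V; A \<noteq> carrier V; \<And>a. a \<in> carrier V \<Longrightarrow> a \<noteq> \<zero> \<Longrightarrow> A \<noteq> P #> a\<rbrakk>
      \<Longrightarrow> complete_ring (V Quot A)"
    by (auto simp: maximal_valuation_ring_def)
  interpret cring V using V by (simp add: valuation_ring_iff)
  interpret P: maximalideal P V by (rule P)
  have lin: "I \<subseteq> I' \<or> I' \<subseteq> I" if "ideal I V" "ideal I' V" for I I'
    using V that by (simp add: valuation_ring_iff)
  define A where "A = (\<Inter>i\<in>D. B i)"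
  have A: "ideal A V" unfolding A_def using D B by (intro i_Intersect[of "B ` D", simplified]) auto
  interpret A: ideal A V by (rule A)
  show ?thesis
  proof (cases "\<exists>i\<in>D. B i = A")
    case True
    then obtain i where "i \<in> D" "B i = A" by blast
    moreover have "A \<subseteq> B j" if "j \<in> D" for j using that by (auto simp: A_def)
    ultimately have "x i \<ominus> x j \<in> B j" if "j \<in> D" for j using compat[of j i] that by simp
    with x \<open>i \<in> D\<close> show ?thesis by blast
  next
    case False
    have AB: "A \<subset> B i" if "i \<in> D" for i using False that by (auto simp: A_def)
    have "complete_ring (V Quot A)"
    proof (rule compl[OF A])
      from D obtain i where "i \<in> D" by blast
      with AB[of i] ideal.Icarr[OF B[of i]] show "A \<noteq> carrier V" by blast
      fix a assume a: "a \<in> carrier V" "a \<noteq> \<zero>"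
      show "A \<noteq> P #> a"
      proof
        assume AP: "A = P #> a"
        have "a \<in> B i" if i: "i \<in> D" for i
        proof -
          interpret B: ideal "B i" V by (rule B[OF i])
          from AB[OF i] obtain b where b: "b \<in> B i" "b \<notin> A" by blast
          note bc = B.Icarr[OF b(1)]
          from valuation_ring_divides_total[OF V bc a(1)] show ?thesis
          proof
            assume "b divides a"
            then show ?thesis using b B.I_r_closed by (auto simp: factor_def)
          next
            assume "a divides b"
            then obtain t where t: "t \<in> carrier V" "b = a \<otimes> t" by (auto simp: factor_def)
            with b(2) a have "t \<notin> P" unfolding AP by (auto simp: r_coset_def m_comm)
            with valuation_ring_unit[OF V P t(1)] have "t \<in> Units V" .
            then have "a = b \<otimes> inv t" using t a by (simp add: m_assoc)
            with b B.I_r_closed \<open>t \<in> Units V\<close> show ?thesis by simp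
          qed
        qed
        then have "a \<in> P #> a" using AP by (auto simp: A_def)
        then obtain p where p: "p \<in> P" "a = p \<otimes> a" by (auto simp: r_coset_def)
        note pc = P.Icarr[OF p(1)]
        have "\<one> \<ominus> p \<notin> P"
        proof
          assume "\<one> \<ominus> p \<in> P"
          then have "(\<one> \<ominus> p) \<oplus> p \<in> P" using p(1) by simp
          moreover have "(\<one> \<ominus> p) \<oplus> p = \<one>" using pc by algebra
          ultimately show False using P.one_imp_carrier P.I_notcarr by simp
        qed
        with valuation_ring_unit[OF V P] pc have u: "\<one> \<ominus> p \<in> Units V" by simp
        have "(\<one> \<ominus> p) \<otimes> a = a \<ominus> p \<otimes> a" using a pc by algebra
        also have "\<dots> = \<zero>" using p(2) a pc by (simp add: minus_eq r_neg)
        finally have "inv (\<one> \<ominus> p) \<otimes> ((\<one> \<ominus> p) \<otimes> a) = \<zero>" using u by simp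
        moreover have "inv (\<one> \<ominus> p) \<otimes> ((\<one> \<ominus> p) \<otimes> a) = a"
          using u a by (subst m_assoc[symmetric]) auto
        ultimately have "a = \<zero>" by simp
        with a show False by simp
      qed
    qed
    define leq where "leq i j \<longleftrightarrow> B j \<subseteq> B i" for i j
    have xD: "x \<in> D \<rightarrow> carrier V" using x by blast
    have "directed_preorder D leq"
      unfolding directed_preorder_def leq_def
    proof (intro conjI ballI D)
      fix i j assume "i \<in> D" "j \<in> D"
      with lin[OF B B, of i j] show "\<exists>k\<in>D. B k \<subseteq> B i \<and> B k \<subseteq> B j" by blast
    qed (auto intro: reflp_onI transp_onI)
    moreover have "Cauchy_net (V Quot A) D leq (\<lambda>i. A +> x i)"
      unfolding Cauchy_net_quotient_iff[OF V A xD]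
    proof (intro allI impI)
      fix C assume C: "ideal C V \<and> A \<subset> C"
      then obtain k where k: "k \<in> D" "\<not> C \<subseteq> B k" by (auto simp: A_def)
      with C lin[of C "B k"] B have Bk: "B k \<subseteq> C" by blast
      interpret B: ideal "B k" V by (rule B[OF k(1)])
      have "x i \<ominus> x j \<in> C" if "i \<in> D" "j \<in> D" "leq k i" "leq k j" for i j
      proof -
        have "x i \<ominus> x k \<in> B k" "x j \<ominus> x k \<in> B k" using compat that k by (auto simp: leq_def)
        then have "(x i \<ominus> x k) \<ominus> (x j \<ominus> x k) \<in> B k"
          unfolding minus_eq[of "x i \<ominus> x k"] by simp
        moreover have "(x i \<ominus> x k) \<ominus> (x j \<ominus> x k) = x i \<ominus> x j"
          using x[OF that(1)] x[OF that(2)] x[OF k(1)] by algebra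
        ultimately show ?thesis using Bk by auto
      qed
      with k show "\<exists>k\<in>D. \<forall>i\<in>D. \<forall>j\<in>D. leq k i \<and> leq k j \<longrightarrow> x i \<ominus> x j \<in> C" by blast
    qed
    ultimately obtain L where L: "net_converges (V Quot A) D leq (\<lambda>i. A +> x i) L"
      using complete_ring_all_nets[OF quotient_valuation_ring[OF V A] \<open>complete_ring (V Quot A)\<close>] by blast
    then obtain l where l: "l \<in> carrier V" "L = A +> l"
      using quotient_carrier[OF V A] by (auto simp: net_converges_def)
    have "l \<ominus> x i \<in> B i" if i: "i \<in> D" for i
    proof -
      interpret B: ideal "B i" V by (rule B[OF i])
      from L AB[OF i] B[OF i] obtain k where k: "k \<in> D" "\<And>j. j \<in> D \<Longrightarrow> leq k j \<Longrightarrow> x j \<ominus> l \<in> B i"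
        unfolding l(2) net_converges_quotient_iff[OF V A xD l(1)] by meson
      from lin[OF B[OF i] B[OF k(1)]] obtain j where j: "j \<in> D" "B j \<subseteq> B i" "B j \<subseteq> B k"
        using i k(1) by blast
      have "x j \<ominus> l \<in> B i" "x j \<ominus> x i \<in> B i" using k j compat i by (auto simp: leq_def)
      then have "(x j \<ominus> x i) \<ominus> (x j \<ominus> l) \<in> B i"
        unfolding minus_eq[of "x j \<ominus> x i"] by simp
      moreover have "(x j \<ominus> x i) \<ominus> (x j \<ominus> l) = l \<ominus> x i"
        using x[OF j(1)] x[OF i] l(1) by algebra
      ultimately show ?thesis by simp
    qed
    with l show ?thesis by blast
  qed
qed

section \<open>Uniserial submodules\<close>

context module
begin

lemma submoduleI':
  assumes "H \<subseteq> carrier M" "\<zero>\<^bsub>M\<^esub> \<in> H" "\<And>a b. \<lbrakk>a \<in> H; b \<in> H\<rbrakk> \<Longrightarrow> a \<^bold>+ b \<in> H"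
    "\<And>r x. \<lbrakk>r \<in> carrier R; x \<in> H\<rbrakk> \<Longrightarrow> r \<^bold>* x \<in> H"
  shows "submodule H R M"
proof (rule submoduleI[OF assms(1,2) _ assms(3,4)])
  fix a assume "a \<in> H"
  with assms(4)[of "\<ominus> \<one>" a] assms(1) show "\<ominus>\<^bsub>M\<^esub> a \<in> H" by (auto simp: smult_l_minus)
qed

lemma submodule_of_submodule_iff:
  assumes U: "submodule U R M"
  shows "submodule N R (M\<lparr>carrier := U\<rparr>) \<longleftrightarrow> submodule N R M \<and> N \<subseteq> U"
proof -
  interpret U: module R "M\<lparr>carrier := U\<rparr>"
    by (rule submodule.submodule_is_module[OF U module_axioms])
  note U' = submodule_closed[OF U]
  show ?thesis
  proof
    assume "submodule N R (M\<lparr>carrier := U\<rparr>)"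
    note N = U.submodule_closed[OF this]
    show "submodule N R M \<and> N \<subseteq> U"
    proof
      show "N \<subseteq> U" using N(1) by auto
      then show "submodule N R M" using N(2,3,6) U'(1) by (intro submoduleI') auto
    qed
  next
    assume a: "submodule N R M \<and> N \<subseteq> U"
    note N = submodule_closed[OF conjunct1[OF a]]
    show "submodule N R (M\<lparr>carrier := U\<rparr>)" using a N(2,3,6) by (intro U.submoduleI') auto
  qed
qed

lemma cyclic_submodule:
  assumes "u \<in> carrier M" shows "submodule {r \<^bold>* u |r. r \<in> carrier R} R M"
proof (rule submoduleI')
  show "\<zero>\<^bsub>M\<^esub> \<in> {r \<^bold>* u |r. r \<in> carrier R}" using assms by (auto intro!: exI[of _ \<zero>])
  fix a b assume "a \<in> {r \<^bold>* u |r. r \<in> carrier R}" "b \<in> {r \<^bold>* u |r. r \<in> carrier R}"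
  then obtain r s where "r \<in> carrier R" "a = r \<^bold>* u" "s \<in> carrier R" "b = s \<^bold>* u" by blast
  with assms show "a \<^bold>+ b \<in> {r \<^bold>* u |r. r \<in> carrier R}"
    by (auto simp: smult_l_distr intro!: exI[of _ "r \<oplus> s"])
next
  fix r x assume "r \<in> carrier R" "x \<in> {r \<^bold>* u |r. r \<in> carrier R}"
  with assms show "r \<^bold>* x \<in> {r \<^bold>* u |r. r \<in> carrier R}"
    by (auto simp: smult_assoc1[symmetric])
qed (use assms in auto)

lemma uniserial_iff:
  assumes U: "submodule U R M"
  shows "uniserial R (M\<lparr>carrier := U\<rparr>) \<longleftrightarrow>
    (\<forall>u\<in>U. \<forall>v\<in>U. \<exists>r\<in>carrier R. u = r \<^bold>* v \<or> v = r \<^bold>* u)" (is "?l \<longleftrightarrow> ?r")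
proof -
  note U' = submodule_closed[OF U]
  show ?thesis
  proof
    assume l: ?l
    show ?r
    proof (intro ballI)
      fix u v assume uv: "u \<in> U" "v \<in> U"
      let ?C = "\<lambda>u. {r \<^bold>* u |r. r \<in> carrier R}"
      have "submodule (?C w) R (M\<lparr>carrier := U\<rparr>)" if "w \<in> U" for w
        using cyclic_submodule[OF U'(1)[OF that]] U'(6)[OF _ that]
        unfolding submodule_of_submodule_iff[OF U] by blast
      with l uv have "?C u \<subseteq> ?C v \<or> ?C v \<subseteq> ?C u" by (simp add: uniserial_def)
      moreover have "w \<in> ?C w" if "w \<in> U" for w
        using U'(1)[OF that] by (auto intro!: exI[of _ \<one>])
      ultimately show "\<exists>r\<in>carrier R. u = r \<^bold>* v \<or> v = r \<^bold>* u" using uv by blast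
    qed
  next
    assume r: ?r
    have "N \<subseteq> N' \<or> N' \<subseteq> N" if "submodule N R M" "N \<subseteq> U" "submodule N' R M" "N' \<subseteq> U" for N N'
    proof (rule ccontr)
      assume "\<not> (N \<subseteq> N' \<or> N' \<subseteq> N)"
      then obtain u v where "u \<in> N" "u \<notin> N'" "v \<in> N'" "v \<notin> N" by blast
      with r that submodule_closed(6)[OF that(1)] submodule_closed(6)[OF that(3)]
      show False by (metis subsetD)
    qed
    with submodule.submodule_is_module[OF U module_axioms] show ?l
      unfolding uniserial_def submodule_of_submodule_iff[OF U] by blast
  qed
qed

end

section \<open>The prime ideal \<open>J\<close>\<close>

lemma (in domain) nat_pow_nonzero:
  "\<lbrakk>p \<in> carrier R; p \<noteq> \<zero>\<rbrakk> \<Longrightarrow> p [^] (n::nat) \<noteq> \<zero>"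
  by (induction n) (simp_all add: integral_iff)

locale valuation_dom_max = valuation_dom +
  fixes P J :: "'a set"
  assumes P: "maximalideal P R" and J_def: "J = (\<Inter>n::nat. P [^]\<^bsub>ideals_set R\<^esub> n)"
begin

sublocale P: maximalideal P R by (rule P)

lemma valuation_ring: "valuation_ring R"
  by (rule valuation_ringI[OF is_cring divides_total])

lemma unitI: "t \<in> carrier R \<Longrightarrow> t \<notin> P \<Longrightarrow> t \<in> Units R"
  by (rule valuation_ring_unit[OF valuation_ring P])

lemma nonunit: "t \<in> P \<Longrightarrow> t \<notin> Units R"
  using P.I_notcarr P.I_l_closed P.one_imp_carrier by (metis Units_closed Units_inv_closed Units_l_inv)

lemma power_ideal: "ideal (P [^]\<^bsub>ideals_set R\<^esub> (n::nat)) R"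
  by (induction n) (simp_all add: nat_pow_def ideals_set_def oneideal ideal_prod_is_ideal P.is_ideal)

lemma power_Suc: "P [^]\<^bsub>ideals_set R\<^esub> (Suc n) = (P [^]\<^bsub>ideals_set R\<^esub> n) \<cdot> P"
  and power_0: "P [^]\<^bsub>ideals_set R\<^esub> (0::nat) = carrier R"
  by (simp_all add: nat_pow_def ideals_set_def)

lemma ideals_set_one [simp]: "\<one>\<^bsub>ideals_set R\<^esub> = carrier R"
  and ideals_set_mult [simp]: "I \<otimes>\<^bsub>ideals_set R\<^esub> K = I \<cdot> K"
  by (simp_all add: ideals_set_def)

lemma J_ideal: "ideal J R"
proof -
  have "ideal (\<Inter>(range (\<lambda>n::nat. P [^]\<^bsub>ideals_set R\<^esub> n))) R"
    by (rule i_Intersect) (use power_ideal in auto)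
  then show ?thesis by (simp add: J_def)
qed

sublocale J: ideal J R by (rule J_ideal)

lemma J_subset_P: "J \<subseteq> P"
proof -
  have "P [^]\<^bsub>ideals_set R\<^esub> (Suc 0) \<subseteq> P"
    using ideal_prod_inter[OF power_ideal[of 0] P.is_ideal] unfolding power_Suc by blast
  then show ?thesis unfolding J_def by blast
qed

lemma divides_J: "\<lbrakk>s \<in> carrier R; s \<notin> J; a \<in> J\<rbrakk> \<Longrightarrow> s divides a"
  using divides_total[of s a] J.Icarr[of a] J.I_r_closed[of a] by (auto simp: factor_def)

text \<open>By induction on \<open>n\<close>, the family lies in the \<open>n\<close>-th power of \<open>P\<close>, as each member is the multiple of another one by
  an element of \<open>P\<close>.\<close>

lemma no_minimal_imp_J:
  assumes carr: "\<And>i. i \<in> I \<Longrightarrow> x i \<in> carrier R"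
    and mult: "\<And>i. i \<in> I \<Longrightarrow> \<exists>j\<in>I. \<not> x i divides x j" and "i \<in> I"
  shows "x i \<in> J"
proof -
  have "\<forall>i\<in>I. x i \<in> P [^]\<^bsub>ideals_set R\<^esub> n" for n :: nat
  proof (induction n)
    case 0 then show ?case using carr by (simp add: power_0)
  next
    case (Suc n)
    show ?case
    proof
      fix i assume i: "i \<in> I"
      with mult obtain j where j: "j \<in> I" "\<not> x i divides x j" by blast
      with divides_total[of "x i" "x j"] carr i obtain t where t: "t \<in> carrier R" "x i = x j \<otimes> t"
        by (auto simp: factor_def)
      have "t \<in> P"
      proof (rule ccontr)
        assume "t \<notin> P"
        with unitI t have "t \<in> Units R" by blast
        then have "x j = x i \<otimes> inv t" using t carr[OF j(1)] by (simp add: m_assoc)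
        with \<open>t \<in> Units R\<close> j(2) show False by (auto simp: factor_def)
      qed
      with Suc j(1) t show "x i \<in> P [^]\<^bsub>ideals_set R\<^esub> (Suc n)"
        unfolding power_Suc by (auto intro: ideal_prod.prod)
    qed
  qed
  with \<open>i \<in> I\<close> show ?thesis by (auto simp: J_def)
qed

lemma power_principal:
  assumes "p \<in> carrier R" "P = PIdl p"
  shows "x \<in> P [^]\<^bsub>ideals_set R\<^esub> (n::nat) \<longleftrightarrow> x \<in> carrier R \<and> p [^] n divides x"
proof -
  have 1: "p [^] n \<in> P [^]\<^bsub>ideals_set R\<^esub> n" for n :: nat
  proof (induction n)
    case (Suc n)
    then show ?case unfolding power_Suc nat_pow_Suc
      using cgenideal_self[OF assms(1)] assms(2) by (intro ideal_prod.prod) auto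
  qed (simp add: power_0)
  have 2: "P [^]\<^bsub>ideals_set R\<^esub> n \<subseteq> PIdl (p [^] n)" for n :: nat
  proof (induction n)
    case (Suc n)
    show ?case
    proof
      fix s assume "s \<in> P [^]\<^bsub>ideals_set R\<^esub> (Suc n)"
      then have "s \<in> (P [^]\<^bsub>ideals_set R\<^esub> n) \<cdot> P" by (simp add: power_Suc)
      then show "s \<in> PIdl (p [^] Suc n)"
      proof induction
        case (prod i j)
        have "i \<in> PIdl (p [^] n)" "j \<in> PIdl p" using prod Suc equalityD1[OF assms(2)] by blast+
        then obtain a b where "a \<in> carrier R" "i = a \<otimes> p [^] n" "b \<in> carrier R" "j = b \<otimes> p"
          unfolding cgenideal_def by blast
        with assms(1) show ?case
          by (auto simp: cgenideal_def m_ac intro!: exI[of _ "a \<otimes> b"])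
      next
        case (sum s1 s2)
        have "ideal (PIdl (p [^] Suc n)) R" using assms(1) by (intro cgenideal_ideal) simp
        then show ?case
          using additive_subgroup.a_closed[OF ideal.axioms(1) sum.IH(1) sum.IH(2)] by blast
      qed
    qed
  qed (simp add: power_0 cgenideal_def subset_iff, metis r_one)
  interpret I: ideal "P [^]\<^bsub>ideals_set R\<^esub> n" R by (rule power_ideal)
  show ?thesis
  proof
    assume "x \<in> P [^]\<^bsub>ideals_set R\<^esub> n"
    moreover from this 2[of n] obtain a where "a \<in> carrier R" "x = a \<otimes> p [^] n"
      unfolding cgenideal_def by blast
    ultimately show "x \<in> carrier R \<and> p [^] n divides x"
      using I.Icarr assms(1) by (auto simp: factor_def m_comm)
  next
    assume "x \<in> carrier R \<and> p [^] n divides x"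
    then show "x \<in> P [^]\<^bsub>ideals_set R\<^esub> n" using I.I_r_closed[OF 1[of n]] by (auto simp: factor_def)
  qed
qed

lemma nonprincipal_exceeds:
  assumes "\<And>p. p \<in> carrier R \<Longrightarrow> P \<noteq> PIdl p" "a \<in> P"
  shows "\<exists>b\<in>P. \<not> a divides b"
proof (rule ccontr)
  assume "\<not> ?thesis"
  then have "P \<subseteq> PIdl a" using P.Icarr[OF assms(2)] by (auto simp: factor_def cgenideal_def m_comm)
  moreover have "PIdl a \<subseteq> P" by (rule cgenideal_minimal[OF P.is_ideal assms(2)])
  ultimately show False using assms P.Icarr by blast
qed

lemma J_eq_P:
  assumes "\<And>p. p \<in> carrier R \<Longrightarrow> P \<noteq> PIdl p" shows "J = P"
proof
  show "P \<subseteq> J"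
  proof
    fix a assume "a \<in> P"
    then show "a \<in> J"
      using no_minimal_imp_J[of P "\<lambda>x. x" a] P.Icarr nonprincipal_exceeds[OF assms] by blast
  qed
qed (rule J_subset_P)

text \<open>If \<open>P\<close> is generated by \<open>p \<noteq> 0\<close>, the elements outside \<open>J\<close> are the divisors of powers of \<open>p\<close>, and these are
  closed under products. If \<open>P\<close> is not principal, then \<open>J = P\<close>.\<close>

theorem J_prime: "primeideal J R"
proof (cases "\<exists>p\<in>carrier R. P = PIdl p")
  case False
  then have "J = P" using J_eq_P by blast
  then show ?thesis using maximalideal_prime[OF P] by simp
next
  case True
  then obtain p where p: "p \<in> carrier R" "P = PIdl p" by blast
  note pow = power_principal[OF p]
  have pn: "p [^] n \<in> carrier R" for n :: nat using p by simp
  have pP: "p \<in> P" using cgenideal_self[OF p(1)] p(2) by simp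
  show ?thesis
  proof (cases "p = \<zero>")
    case True
    have "PIdl p \<subseteq> {\<zero>}" using True by (auto simp: cgenideal_def)
    then have "J \<subseteq> {\<zero>}" using J_subset_P equalityD1[OF p(2)] by blast
    then have "J = {\<zero>}" using J.zero_closed by blast
    then show ?thesis by (simp add: zeroprimeideal)
  next
    case False
    have notJ: "\<exists>n::nat. s divides p [^] n" if s: "s \<in> carrier R" "s \<notin> J" for s
    proof -
      from s obtain n :: nat where "s \<notin> P [^]\<^bsub>ideals_set R\<^esub> n" by (auto simp: J_def)
      with s pow divides_total[OF s(1) pn[of n]] show ?thesis by blast
    qed
    show ?thesis
    proof (rule primeidealI[OF J_ideal is_cring])
      show "carrier R \<noteq> J" using J_subset_P P.I_notcarr P.Icarr by blast
      fix a b assume ab: "a \<in> carrier R" "b \<in> carrier R" "a \<otimes> b \<in> J"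
      show "a \<in> J \<or> b \<in> J"
      proof (rule ccontr)
        assume "\<not> ?thesis"
        then obtain m n :: nat where "a divides p [^] m" "b divides p [^] n"
          using notJ ab by blast
        then obtain c d where c: "c \<in> carrier R" "p [^] m = a \<otimes> c" and d: "d \<in> carrier R" "p [^] n = b \<otimes> d"
          by (auto simp: factor_def)
        have "p [^] (m + n) = (a \<otimes> b) \<otimes> (c \<otimes> d)"
          using ab c(1) d(1) p(1) by (simp add: nat_pow_mult[symmetric] c(2) d(2) m_ac)
        with ab c d have "p [^] (m + n) \<in> J" by (simp add: J.I_r_closed)
        then have "p [^] (m + n) \<in> P [^]\<^bsub>ideals_set R\<^esub> (Suc (m + n))" unfolding J_def by blast
        then obtain e where e: "e \<in> carrier R" "p [^] (m + n) = p [^] (Suc (m + n)) \<otimes> e"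
          unfolding pow by (auto simp: factor_def)
        then have "p [^] (m + n) \<otimes> \<one> = p [^] (m + n) \<otimes> (p \<otimes> e)"
          using p(1) by (simp add: m_assoc)
        moreover have "p [^] (m + n) \<noteq> \<zero>"
          using False p(1) by (simp add: nat_pow_nonzero)
        ultimately have "\<one> = p \<otimes> e" using m_lcancel[of "p [^] (m + n)" \<one> "p \<otimes> e"] e(1) p(1) by simp
        then have "\<one> \<in> P" using P.I_r_closed[OF pP e(1)] by simp
        then show False using P.one_imp_carrier P.I_notcarr by blast
      qed
    qed
  qed
qed

text \<open>The chain consists of the powers of a generator of \<open>P\<close> or, if \<open>P\<close> is not principal, of the quotients \<open>e / q n\<close>
  for a sequence \<open>q n\<close> in \<open>P\<close> that starts with \<open>e\<close> and in which each member is a proper multiple of the next one.\<close>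

lemma divisor_chain:
  assumes e: "e \<in> J" "e \<noteq> \<zero>"
  obtains w :: "nat \<Rightarrow> 'a" where "\<And>n. w n \<in> carrier R" "\<And>n. w n divides e"
    "\<And>n. w n divides w (Suc n)" "\<And>n. \<not> w (Suc n) divides w n"
proof (cases "\<exists>p\<in>carrier R. P = PIdl p")
  case True
  then obtain p where p: "p \<in> carrier R" "P = PIdl p" by blast
  have pP: "p \<in> P" using cgenideal_self[OF p(1)] p(2) by simp
  have "e \<in> PIdl p" using e(1) J_subset_P equalityD1[OF p(2)] by blast
  then obtain a where "a \<in> carrier R" "e = a \<otimes> p" unfolding cgenideal_def by blast
  then have "p \<noteq> \<zero>" using e(2) by auto
  show thesis
  proof (rule that[of "\<lambda>n. p [^] n"])
    fix n :: nat
    show "p [^] n \<in> carrier R" using p by simp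
    have "e \<in> P [^]\<^bsub>ideals_set R\<^esub> n" using e by (auto simp: J_def)
    then show "p [^] n divides e" using power_principal[OF p] by blast
    show "p [^] n divides p [^] Suc n" using p(1) by (auto simp: factor_def)
    show "\<not> p [^] Suc n divides p [^] n"
    proof
      assume "p [^] Suc n divides p [^] n"
      then obtain c where c: "c \<in> carrier R" "p [^] n = p [^] Suc n \<otimes> c" by (auto simp: factor_def)
      then have "p [^] n \<otimes> \<one> = p [^] n \<otimes> (p \<otimes> c)" using p(1) by (simp add: m_assoc)
      moreover have "p [^] n \<noteq> \<zero>" using \<open>p \<noteq> \<zero>\<close> p(1) by (simp add: nat_pow_nonzero)
      ultimately have "\<one> = p \<otimes> c" using m_lcancel[of "p [^] n" \<one> "p \<otimes> c"] c(1) p(1) by simp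
      then have "\<one> \<in> P" using P.I_r_closed[OF pP c(1)] by simp
      then show False using P.one_imp_carrier P.I_notcarr by blast
    qed
  qed
next
  case False
  then have "\<exists>b\<in>P. \<not> a divides b" if "a \<in> P" for a using nonprincipal_exceeds that by blast
  then obtain f where f: "\<And>a. a \<in> P \<Longrightarrow> f a \<in> P" "\<And>a. a \<in> P \<Longrightarrow> \<not> a divides f a" by metis
  define q where "q = rec_nat e (\<lambda>_. f)"
  have q1: "q n \<in> P" for n using e J_subset_P f(1) by (induction n) (auto simp: q_def)
  with f(2) have q: "\<And>n. q n \<in> P" "q 0 = e" "\<And>n. \<not> q n divides q (Suc n)" by (simp_all add: q_def)
  have qc: "q n \<in> carrier R" for n using q(1) P.Icarr by blast
  have "\<exists>t\<in>carrier R. q n = q (Suc n) \<otimes> t" for n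
    using divides_total[OF qc qc, of n "Suc n"] q(3) by (auto simp: factor_def)
  then obtain t where t: "\<And>n. t n \<in> carrier R" "\<And>n. q n = q (Suc n) \<otimes> t n" by metis
  define w where "w = rec_nat \<one> (\<lambda>n v. v \<otimes> t n)"
  have w: "w 0 = \<one>" "w (Suc n) = w n \<otimes> t n" for n by (simp_all add: w_def)
  have wc: "w n \<in> carrier R" for n by (induction n) (simp_all add: w t)
  have we: "w n \<otimes> q n = e" for n
  proof (induction n)
    case (Suc n)
    have "w (Suc n) \<otimes> q (Suc n) = w n \<otimes> (q (Suc n) \<otimes> t n)" using wc qc t(1) by (simp add: w m_ac)
    with Suc t(2) show ?case by metis
  qed (use e J.Icarr in \<open>simp add: w q\<close>)
  have w0: "w n \<noteq> \<zero>" for n using we[of n] e(2) qc[of n] by auto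
  show thesis
  proof (rule that[of w])
    fix n
    show "w n \<in> carrier R" by (rule wc)
    show "w n divides e" using we[of n] qc[of n] by (auto simp: factor_def)
    show "w n divides w (Suc n)" using t(1) by (auto simp: factor_def w)
    show "\<not> w (Suc n) divides w n"
    proof
      assume "w (Suc n) divides w n"
      then obtain c where c: "c \<in> carrier R" "w n = w (Suc n) \<otimes> c" by (auto simp: factor_def)
      then have "w n \<otimes> \<one> = w n \<otimes> (t n \<otimes> c)" using wc t(1) by (simp add: w m_assoc)
      then have "\<one> = t n \<otimes> c" using m_lcancel[of "w n" \<one> "t n \<otimes> c"] w0[of n] c(1) wc t(1)[of n] by simp
      then have "q (Suc n) = q (Suc n) \<otimes> (t n \<otimes> c)" by (metis qc r_one)
      also have "\<dots> = (q (Suc n) \<otimes> t n) \<otimes> c" using t(1) qc c(1) by (simp add: m_assoc)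
      also have "\<dots> = q n \<otimes> c" by (simp only: t(2)[symmetric])
      finally show False using q(3)[of n] c by (auto simp: factor_def)
    qed
  qed
qed

end

section \<open>Separability of powers from maximality\<close>

lemma power_module_simps:
  "x \<in> carrier (power_module R \<Lambda>) \<longleftrightarrow> x \<in> \<Lambda> \<rightarrow>\<^sub>E carrier R"
  "\<zero>\<^bsub>power_module R \<Lambda>\<^esub> = (\<lambda>i\<in>\<Lambda>. \<zero>\<^bsub>R\<^esub>)"
  "x \<oplus>\<^bsub>power_module R \<Lambda>\<^esub> y = (\<lambda>i\<in>\<Lambda>. x i \<oplus>\<^bsub>R\<^esub> y i)"
  "r \<odot>\<^bsub>power_module R \<Lambda>\<^esub> x = (\<lambda>i\<in>\<Lambda>. r \<otimes>\<^bsub>R\<^esub> x i)"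
  by (simp_all add: power_module_def)

lemma power_module_eqI:
  assumes "x \<in> carrier (power_module R \<Lambda>)" "y \<in> carrier (power_module R \<Lambda>)" "\<And>i. i \<in> \<Lambda> \<Longrightarrow> x i = y i"
  shows "x = y"
  using assms by (auto simp: power_module_simps intro: PiE_ext)

lemma power_module_uminus:
  assumes "cring R" "x \<in> carrier (power_module R \<Lambda>)"
  shows "\<ominus>\<^bsub>power_module R \<Lambda>\<^esub> x = (\<lambda>i\<in>\<Lambda>. \<ominus>\<^bsub>R\<^esub> x i)"
proof -
  interpret module R "power_module R \<Lambda>" by (rule module_power_module[OF assms(1)])
  show ?thesis
    by (rule M.minus_equality) (use assms(2) in \<open>auto simp: power_module_simps PiE_iff R.l_neg intro!: restrict_ext\<close>)
qed

lemma power_module_minus: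
  assumes "cring R" "x \<in> carrier (power_module R \<Lambda>)" "y \<in> carrier (power_module R \<Lambda>)" "i \<in> \<Lambda>"
  shows "(x \<ominus>\<^bsub>power_module R \<Lambda>\<^esub> y) i = x i \<ominus>\<^bsub>R\<^esub> y i"
  using power_module_uminus[OF assms(1,3)] assms(4) by (simp add: a_minus_def power_module_simps)

lemma (in domain) torsion_free_power_module: "torsion_free R (power_module R \<Lambda>)"
  unfolding torsion_free_def
proof (intro conjI ballI impI)
  show "Module.module R (power_module R \<Lambda>)" by (rule module_power_module[OF is_cring])
  fix r x assume *: "r \<in> carrier R" "x \<in> carrier (power_module R \<Lambda>)"
    "r \<odot>\<^bsub>power_module R \<Lambda>\<^esub> x = \<zero>\<^bsub>power_module R \<Lambda>\<^esub>"
  have "r = \<zero> \<or> x i = \<zero>" if "i \<in> \<Lambda>" for i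
  proof -
    from *(3) that have "r \<otimes> x i = \<zero>" by (auto simp: power_module_simps dest: fun_cong[of _ _ i])
    with *(1,2) that integral[of r "x i"] show ?thesis by (auto simp: power_module_simps)
  qed
  then show "r = \<zero> \<or> x = \<zero>\<^bsub>power_module R \<Lambda>\<^esub>"
    using *(2) power_module_eqI[of x R \<Lambda> "\<zero>\<^bsub>power_module R \<Lambda>\<^esub>"] by (auto simp: power_module_simps)
qed

context valuation_dom_max
begin

interpretation JP: primeideal J R by (rule J_prime)

abbreviation "V \<equiv> localization R J"

interpretation V: cring V by (rule JP.cring_localization)

lemma fraction_eq_iff:
  assumes "a \<in> carrier R" "s \<in> carrier R - J" "b \<in> carrier R" "t \<in> carrier R - J"
  shows "fraction R J a s = fraction R J b t \<longleftrightarrow> a \<otimes> t = b \<otimes> s"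
proof
  assume "fraction R J a s = fraction R J b t"
  then obtain u where u: "u \<in> carrier R - J" "u \<otimes> (a \<otimes> t) = u \<otimes> (b \<otimes> s)"
    using JP.fraction_eq_iff[OF assms] by blast
  then have "u \<noteq> \<zero>" using J.zero_closed by auto
  with u assms m_lcancel[of u "a \<otimes> t" "b \<otimes> s"] show "a \<otimes> t = b \<otimes> s" by auto
qed (use JP.fraction_eqI1[OF assms] in blast)

abbreviation of_R :: "'a \<Rightarrow> ('a \<times> 'a) set" where "of_R a \<equiv> fraction R J a \<one>"

lemma one_notin_J: "\<one> \<in> carrier R - J" by (rule JP.comp_one)

lemma of_R_closed: "a \<in> carrier R \<Longrightarrow> of_R a \<in> carrier V"
  using JP.fraction_closed one_notin_J by blast

lemma of_R_eq_iff: "\<lbrakk>a \<in> carrier R; b \<in> carrier R\<rbrakk> \<Longrightarrow> of_R a = of_R b \<longleftrightarrow> a = b"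
  using fraction_eq_iff[OF _ one_notin_J _ one_notin_J] by simp

lemma of_R_add: "\<lbrakk>a \<in> carrier R; b \<in> carrier R\<rbrakk> \<Longrightarrow> of_R (a \<oplus> b) = of_R a \<oplus>\<^bsub>V\<^esub> of_R b"
  using JP.add_localization[OF _ one_notin_J _ one_notin_J] by simp

lemma of_R_mult: "\<lbrakk>a \<in> carrier R; b \<in> carrier R\<rbrakk> \<Longrightarrow> of_R (a \<otimes> b) = of_R a \<otimes>\<^bsub>V\<^esub> of_R b"
  using JP.mult_localization[OF _ one_notin_J _ one_notin_J] by simp

lemma of_R_hom: "ring_hom_cring R V of_R"
proof (intro ring_hom_cringI ring_hom_ringI2)
  show "of_R \<in> ring_hom R V"
    by (rule ring_hom_memI) (simp_all add: of_R_closed of_R_add of_R_mult JP.one_localization)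
qed (rule is_cring V.is_cring ring_axioms V.ring_axioms)+

interpretation of_R: ring_hom_cring R V of_R by (rule of_R_hom)

lemma of_R_minus: "\<lbrakk>a \<in> carrier R; b \<in> carrier R\<rbrakk> \<Longrightarrow> of_R (a \<ominus> b) = of_R a \<ominus>\<^bsub>V\<^esub> of_R b"
  by (simp add: minus_eq V.minus_eq)

text \<open>Since every element outside \<open>J\<close> divides every element of \<open>J\<close>, fractions with numerator in
  \<open>J\<close> have denominator one.\<close>

lemma fraction_in_J:
  assumes "a \<in> J" "s \<in> carrier R - J"
  obtains b where "b \<in> J" "fraction R J a s = of_R b" "a = s \<otimes> b"
proof -
  from divides_J[of s a] assms obtain b where b: "b \<in> carrier R" "a = s \<otimes> b" by (auto simp: factor_def)
  with assms JP.I_prime[of s b] have "b \<in> J" by auto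
  moreover have "fraction R J a s = of_R b"
    using assms b one_notin_J by (subst fraction_eq_iff) (auto simp: m_comm)
  ultimately show thesis using that b by blast
qed

text \<open>Let \<open>x\<close> be a nonzero element of \<open>U\<close>. If the coordinate \<open>x i0\<close> divides all others, then \<open>x / x i0\<close> generates
  \<open>U\<close>, and the vectors vanishing at \<open>i0\<close> form a complement. If no coordinate of \<open>x\<close> divides all others, the same
  holds for all nonzero elements of \<open>U\<close>, so all coordinates lie in \<open>J\<close> and are divisible by the elements outside
  \<open>J\<close>. Then any coordinate at which \<open>x\<close> does not vanish embeds \<open>U\<close> into the localization such that the submodules
  \<open>r U\<close> become ideals, and linear compactness splits \<open>U\<close> off.\<close>

theorem separable_if_maximal:
  fixes \<Lambda> :: "'i set"
  assumes max: "maximal_valuation_ring V"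
  shows "separable R (power_module R \<Lambda>)"
proof -
  let ?M = "power_module R \<Lambda>"
  interpret M: module R ?M by (rule module_power_module[OF is_cring])
  note pm = power_module_simps
  have tf: "torsion_free R ?M" by (rule torsion_free_power_module)
  have "direct_summand U R ?M" if pure: "pure_submodule U R ?M" and uni: "uniserial R (?M\<lparr>carrier := U\<rparr>)" for U
  proof -
    have Us: "submodule U R ?M" and div: "\<And>r z. \<lbrakk>r \<in> carrier R; r \<noteq> \<zero>; z \<in> carrier ?M; r \<odot>\<^bsub>?M\<^esub> z \<in> U\<rbrakk> \<Longrightarrow> z \<in> U"
      using pure M.pure_submodule_iff[OF tf domain_axioms] by auto
    note U = M.submodule_closed[OF Us]
    have cmp: "\<exists>r\<in>carrier R. u = r \<odot>\<^bsub>?M\<^esub> v \<or> v = r \<odot>\<^bsub>?M\<^esub> u" if "u \<in> U" "v \<in> U" for u v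
      using uni that M.uniserial_iff[OF Us] by blast
    have Uc: "u i \<in> carrier R" if "u \<in> U" "i \<in> \<Lambda>" for u i
      using U(1)[OF that(1)] that(2) by (auto simp: pm)
    show ?thesis
    proof (cases "U = {\<zero>\<^bsub>?M\<^esub>}")
      case True
      have "z \<in> U <+>\<^bsub>?M\<^esub> carrier ?M" if "z \<in> carrier ?M" for z
        using True that M.M.l_zero[OF that] unfolding set_add_def' by force
      moreover have "U <+>\<^bsub>?M\<^esub> carrier ?M \<subseteq> carrier ?M" using U(1) by (auto simp: set_add_def')
      ultimately show ?thesis
        unfolding direct_summand_def using Us M.carrier_is_submodule True by blast
    next
      case False
      then obtain x where x: "x \<in> U" "x \<noteq> \<zero>\<^bsub>?M\<^esub>" using U(2) by blast
      have nonzero: "u = \<zero>\<^bsub>?M\<^esub>" if u: "u \<in> U" and i: "i \<in> \<Lambda>" "x i \<noteq> \<zero>" "u i = \<zero>" for u i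
      proof -
        from cmp[OF u x(1)] obtain r where r: "r \<in> carrier R" "u = r \<odot>\<^bsub>?M\<^esub> x \<or> x = r \<odot>\<^bsub>?M\<^esub> u" by blast
        then consider "u = r \<odot>\<^bsub>?M\<^esub> x" | "x = r \<odot>\<^bsub>?M\<^esub> u" by blast
        then show ?thesis
        proof cases
          case 1
          then have "r \<otimes> x i = \<zero>" using i by (simp add: pm)
          with r(1) i Uc[OF x(1) i(1)] have "r = \<zero>" using integral by blast
          with 1 U(1)[OF x(1)] show ?thesis by simp
        next
          case 2
          then have "x i = r \<otimes> u i" using i(1) by (metis pm(4) restrict_apply')
          with i r show ?thesis by simp
        qed
      qed
      show ?thesis
      proof (cases "\<exists>i\<in>\<Lambda>. \<forall>j\<in>\<Lambda>. x i divides x j")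
        case True
        then obtain i0 where i0: "i0 \<in> \<Lambda>" "\<And>j. j \<in> \<Lambda> \<Longrightarrow> x i0 divides x j" by blast
        then have "\<forall>j\<in>\<Lambda>. \<exists>t\<in>carrier R. x j = x i0 \<otimes> t" by (auto simp: factor_def)
        then obtain t where t: "\<And>j. j \<in> \<Lambda> \<Longrightarrow> t j \<in> carrier R" "\<And>j. j \<in> \<Lambda> \<Longrightarrow> x j = x i0 \<otimes> t j" by metis
        note xi0 = Uc[OF x(1) i0(1)]
        have xnz: "x i0 \<noteq> \<zero>"
        proof
          assume "x i0 = \<zero>"
          then have "x j = \<zero>" if "j \<in> \<Lambda>" for j using t that by simp
          then have "x = \<zero>\<^bsub>?M\<^esub>"
            using U(1)[OF x(1)] M.M.zero_closed by (intro power_module_eqI) (auto simp: pm)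
          with x(2) show False by simp
        qed
        define y where "y = (\<lambda>j\<in>\<Lambda>. t j)"
        have yM: "y \<in> carrier ?M" using t by (auto simp: y_def pm)
        have "x i0 \<odot>\<^bsub>?M\<^esub> y = x"
          using M.smult_closed[OF xi0 yM] U(1)[OF x(1)] t by (intro power_module_eqI) (auto simp: y_def pm)
        with div[OF xi0 xnz yM] x(1) have yU: "y \<in> U" by simp
        have "t i0 = \<one>" using t(2)[OF i0(1)] t(1)[OF i0(1)] xi0 xnz m_lcancel[of "x i0" "t i0" \<one>] by simp
        then have y1: "y i0 = \<one>" using i0 by (simp add: y_def)
        define K where "K = {z \<in> carrier ?M. z i0 = \<zero>}"
        have "submodule K R ?M"
        proof (rule M.submoduleI')
          show "K \<subseteq> carrier ?M" by (auto simp: K_def)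
          show "\<zero>\<^bsub>?M\<^esub> \<in> K" using i0(1) M.M.zero_closed by (simp add: K_def pm(2))
          fix a b assume "a \<in> K" "b \<in> K"
          then show "a \<oplus>\<^bsub>?M\<^esub> b \<in> K" using i0(1) M.M.a_closed[of a b] by (simp add: K_def pm(3))
        next
          fix r a assume "r \<in> carrier R" "a \<in> K"
          then show "r \<odot>\<^bsub>?M\<^esub> a \<in> K" using i0(1) M.smult_closed[of r a] by (simp add: K_def pm(4))
        qed
        moreover have "U \<inter> K = {\<zero>\<^bsub>?M\<^esub>}"
        proof -
          have "\<zero>\<^bsub>?M\<^esub> \<in> K" using i0(1) M.M.zero_closed by (simp add: K_def pm(2))
          moreover have "u = \<zero>\<^bsub>?M\<^esub>" if "u \<in> U" "u \<in> K" for u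
            using nonzero[OF that(1) i0(1) xnz] that(2) by (simp add: K_def)
          ultimately show ?thesis using U(2) by blast
        qed
        moreover have "U <+>\<^bsub>?M\<^esub> K = carrier ?M"
        proof (intro equalityI subsetI)
          fix z assume z: "z \<in> carrier ?M"
          then have zi: "z i0 \<in> carrier R" using i0(1) by (auto simp: pm)
          let ?u = "z i0 \<odot>\<^bsub>?M\<^esub> y"
          have u: "?u \<in> U" by (rule U(6)[OF zi yU])
          have "z = ?u \<oplus>\<^bsub>?M\<^esub> (z \<ominus>\<^bsub>?M\<^esub> ?u)" using z U(1)[OF u] by algebra
          moreover have "z \<ominus>\<^bsub>?M\<^esub> ?u \<in> K"
            using power_module_minus[OF is_cring z U(1)[OF u] i0(1)] z U(1)[OF u] i0(1) y1 zi
            by (simp add: K_def pm(4) minus_eq r_neg)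
          ultimately show "z \<in> U <+>\<^bsub>?M\<^esub> K" using u unfolding set_add_def' by blast
        next
          fix z assume "z \<in> U <+>\<^bsub>?M\<^esub> K"
          then show "z \<in> carrier ?M" using U(1) by (auto simp: set_add_def' K_def)
        qed
        ultimately show ?thesis using Us by (auto simp: direct_summand_def)
      next
        case False
        have xJ: "x i \<in> J" if "i \<in> \<Lambda>" for i
          using no_minimal_imp_J[of \<Lambda> x i] Uc[OF x(1)] that False by blast
        have nomin: "u i \<in> J" if u: "u \<in> U" and i: "i \<in> \<Lambda>" for u i
        proof -
          from cmp[OF u x(1)] obtain r where r: "r \<in> carrier R" "u = r \<odot>\<^bsub>?M\<^esub> x \<or> x = r \<odot>\<^bsub>?M\<^esub> u" by blast
          then consider "u = r \<odot>\<^bsub>?M\<^esub> x" | "x = r \<odot>\<^bsub>?M\<^esub> u" by blast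
          then show ?thesis
          proof cases
            case 1
            then show ?thesis using i r(1) xJ J.I_l_closed by (auto simp: pm)
          next
            case 2
            have xr: "x j = r \<otimes> u j" if "j \<in> \<Lambda>" for j using 2 that by (metis pm(4) restrict_apply')
            have "\<exists>k\<in>\<Lambda>. \<not> u j divides u k" if j: "j \<in> \<Lambda>" for j
            proof -
              from False j obtain k where k: "k \<in> \<Lambda>" "\<not> x j divides x k" by blast
              have "\<not> u j divides u k"
              proof
                assume "u j divides u k"
                then obtain c where "c \<in> carrier R" "u k = u j \<otimes> c" by (auto simp: factor_def)
                then have "x k = x j \<otimes> c" using r(1) Uc[OF u j] by (simp add: xr[OF k(1)] xr[OF j] m_assoc)
                with k(2) \<open>c \<in> carrier R\<close> show False by (auto simp: factor_def)
              qed
              with k(1) show ?thesis by blast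
            qed
            then show ?thesis using no_minimal_imp_J[of \<Lambda> u i] Uc[OF u] i by blast
          qed
        qed
        have sdiv: "\<exists>v\<in>U. u = s \<odot>\<^bsub>?M\<^esub> v" if s: "s \<in> carrier R" "s \<notin> J" and u: "u \<in> U" for s u
        proof -
          have "\<forall>i\<in>\<Lambda>. \<exists>t\<in>carrier R. u i = s \<otimes> t"
            using divides_J[OF s nomin[OF u]] by (auto simp: factor_def)
          then obtain t where t: "\<And>j. j \<in> \<Lambda> \<Longrightarrow> t j \<in> carrier R" "\<And>j. j \<in> \<Lambda> \<Longrightarrow> u j = s \<otimes> t j" by metis
          define v where "v = (\<lambda>j\<in>\<Lambda>. t j)"
          have vM: "v \<in> carrier ?M" using t by (auto simp: v_def pm)
          have eq: "s \<odot>\<^bsub>?M\<^esub> v = u"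
            using M.smult_closed[OF s(1) vM] U(1)[OF u] t by (intro power_module_eqI) (auto simp: v_def pm)
          have "s \<noteq> \<zero>" using s J.zero_closed by blast
          with div[OF s(1) _ vM] u eq show ?thesis by blast
        qed
        obtain i0 where i0: "i0 \<in> \<Lambda>" "x i0 \<noteq> \<zero>"
        proof -
          have "\<exists>i\<in>\<Lambda>. x i \<noteq> \<zero>"
          proof (rule ccontr)
            assume "\<not> ?thesis"
            then have "x = \<zero>\<^bsub>?M\<^esub>"
              using U(1)[OF x(1)] M.M.zero_closed by (intro power_module_eqI) (auto simp: pm)
            with x(2) show False by simp
          qed
          with that show thesis by blast
        qed
        define \<psi> where "\<psi> u = of_R (u i0)" for u
        have Ui: "u i0 \<in> carrier R" if "u \<in> U" for u using Uc[OF that i0(1)] .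
        have \<psi>c: "\<psi> u \<in> carrier V" if "u \<in> U" for u using of_R_closed Ui[OF that] by (simp add: \<psi>_def)
        have \<psi>add: "\<psi> (u \<oplus>\<^bsub>?M\<^esub> v) = \<psi> u \<oplus>\<^bsub>V\<^esub> \<psi> v" if "u \<in> U" "v \<in> U" for u v
          using of_R_add Ui that i0(1) by (simp add: \<psi>_def pm(3))
        have \<psi>minus: "\<psi> (u \<ominus>\<^bsub>?M\<^esub> v) = \<psi> u \<ominus>\<^bsub>V\<^esub> \<psi> v" if "u \<in> U" "v \<in> U" for u v
          using of_R_minus Ui that power_module_minus[OF is_cring U(1)[OF that(1)] U(1)[OF that(2)] i0(1)]
          by (simp add: \<psi>_def)
        have \<psi>inj: "u = v" if uv: "u \<in> U" "v \<in> U" "\<psi> u = \<psi> v" for u v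
        proof -
          have "u i0 = v i0" using uv(3) of_R_eq_iff Ui uv by (simp add: \<psi>_def)
          then have "(u \<ominus>\<^bsub>?M\<^esub> v) i0 = \<zero>"
            using power_module_minus[OF is_cring U(1)[OF uv(1)] U(1)[OF uv(2)] i0(1)] Ui[OF uv(2)]
            by (simp add: minus_eq r_neg)
          with nonzero[OF U(5)[OF uv(1,2)] i0(1,2)] have "u \<ominus>\<^bsub>?M\<^esub> v = \<zero>\<^bsub>?M\<^esub>" by blast
          then show ?thesis using M.M.minus_eq_zero_iff U(1) uv by blast
        qed
        define B where "B p = \<psi> ` {fst p \<odot>\<^bsub>?M\<^esub> w |w. w \<in> U}" for p :: "'a \<times> ('i \<Rightarrow> 'a)"
        have BU: "fst p \<odot>\<^bsub>?M\<^esub> w \<in> U" if "fst p \<in> carrier R" "w \<in> U" for p :: "'a \<times> ('i \<Rightarrow> 'a)" and w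
          by (rule U(6)[OF that])
        have Bideal: "ideal (B p) V" if p: "fst p \<in> carrier R" for p
        proof -
          have mult: "c \<otimes>\<^bsub>V\<^esub> b \<in> B p" if b: "b \<in> B p" and c: "c \<in> carrier V" for b c
          proof -
            from b obtain w where w: "w \<in> U" "b = \<psi> (fst p \<odot>\<^bsub>?M\<^esub> w)" by (auto simp: B_def)
            from c obtain a s where a: "a \<in> carrier R" "s \<in> carrier R - J" "c = fraction R J a s"
              by (auto simp: JP.carrier_localization)
            from sdiv[of s w] a w(1) obtain v where v: "v \<in> U" "w = s \<odot>\<^bsub>?M\<^esub> v" by auto
            have "c \<otimes>\<^bsub>V\<^esub> b = fraction R J (a \<otimes> (fst p \<otimes> (s \<otimes> v i0))) (s \<otimes> \<one>)"
              unfolding a(3) w(2) \<psi>_def using i0(1) p a Ui[OF v(1)] one_notin_J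
              by (subst JP.mult_localization[symmetric]) (auto simp: v(2) pm(4))
            also have "\<dots> = of_R (fst p \<otimes> (a \<otimes> v i0))"
              using p a Ui[OF v(1)] one_notin_J by (subst fraction_eq_iff) (auto simp: m_ac)
            also have "\<dots> = \<psi> (fst p \<odot>\<^bsub>?M\<^esub> (a \<odot>\<^bsub>?M\<^esub> v))" using i0(1) by (simp add: \<psi>_def pm(4))
            finally show ?thesis using U(6)[OF a(1) v(1)] unfolding B_def by blast
          qed
          show ?thesis
          proof (rule V.idealI')
            show "B p \<subseteq> carrier V" using \<psi>c BU[OF p] by (auto simp: B_def)
            have "\<zero>\<^bsub>?M\<^esub> = fst p \<odot>\<^bsub>?M\<^esub> \<zero>\<^bsub>?M\<^esub>" using p by simp
            moreover have "\<psi> \<zero>\<^bsub>?M\<^esub> = \<zero>\<^bsub>V\<^esub>" using i0(1) by (simp add: \<psi>_def pm(2))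
            ultimately show "\<zero>\<^bsub>V\<^esub> \<in> B p" using U(2) unfolding B_def by (metis (mono_tags, lifting) image_eqI mem_Collect_eq)
            fix b b' assume "b \<in> B p" "b' \<in> B p"
            then obtain w w' where w: "w \<in> U" "b = \<psi> (fst p \<odot>\<^bsub>?M\<^esub> w)" "w' \<in> U" "b' = \<psi> (fst p \<odot>\<^bsub>?M\<^esub> w')"
              by (auto simp: B_def)
            have "b \<oplus>\<^bsub>V\<^esub> b' = \<psi> (fst p \<odot>\<^bsub>?M\<^esub> (w \<oplus>\<^bsub>?M\<^esub> w'))"
              using \<psi>add[OF BU[OF p w(1)] BU[OF p w(3)]] w U(1) p by (simp add: M.smult_r_distr)
            then show "b \<oplus>\<^bsub>V\<^esub> b' \<in> B p" using U(3)[OF w(1,3)] unfolding B_def by blast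
          next
            fix b c assume bc: "b \<in> B p" "c \<in> carrier V"
            then show "c \<otimes>\<^bsub>V\<^esub> b \<in> B p" by (rule mult)
            moreover have "b \<in> carrier V" using bc(1) \<psi>c BU[OF p] by (auto simp: B_def)
            ultimately show "b \<otimes>\<^bsub>V\<^esub> c \<in> B p" using V.m_comm[of b c] bc by simp
          qed
        qed
        show ?thesis
        proof (rule M.linearly_compact_pure_summand[OF _ tf pure])
          show "valuation_dom R" by unfold_locales
          fix F assume F: "F \<subseteq> (carrier R - {\<zero>}) \<times> U" "F \<noteq> {}"
            and cmpt: "\<And>r u r' u'. \<lbrakk>(r, u) \<in> F; (r', u') \<in> F; r divides r'\<rbrakk>
               \<Longrightarrow> \<exists>w\<in>U. u' \<ominus>\<^bsub>?M\<^esub> u = r \<odot>\<^bsub>?M\<^esub> w"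
          have Fr: "fst p \<in> carrier R" and Fu: "snd p \<in> U" if "p \<in> F" for p using F(1) that by auto
          have "\<exists>l\<in>carrier V. \<forall>p\<in>F. l \<ominus>\<^bsub>V\<^esub> \<psi> (snd p) \<in> B p"
          proof (rule maximal_linearly_compact[OF max F(2)])
            fix p assume "p \<in> F"
            then show "ideal (B p) V" "\<psi> (snd p) \<in> carrier V" using Bideal Fr \<psi>c Fu by auto
            fix q assume "q \<in> F" and Bqp: "B q \<subseteq> B p"
            have step: "\<psi> (snd q') \<ominus>\<^bsub>V\<^esub> \<psi> (snd p') \<in> B p'"
              if "p' \<in> F" "q' \<in> F" "fst p' divides fst q'" for p' q'
            proof -
              from cmpt[of "fst p'" "snd p'" "fst q'" "snd q'"] that
              obtain w where "w \<in> U" "snd q' \<ominus>\<^bsub>?M\<^esub> snd p' = fst p' \<odot>\<^bsub>?M\<^esub> w" by auto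
              with \<psi>minus[OF Fu[OF that(2)] Fu[OF that(1)]] show ?thesis unfolding B_def by auto
            qed
            show "\<psi> (snd q) \<ominus>\<^bsub>V\<^esub> \<psi> (snd p) \<in> B p"
              using divides_total[OF Fr[OF \<open>p \<in> F\<close>] Fr[OF \<open>q \<in> F\<close>]]
            proof
              assume "fst q divides fst p"
              with step[OF \<open>q \<in> F\<close> \<open>p \<in> F\<close>] Bqp have *: "\<psi> (snd p) \<ominus>\<^bsub>V\<^esub> \<psi> (snd q) \<in> B p" by blast
              interpret B: ideal "B p" V by (rule Bideal[OF Fr[OF \<open>p \<in> F\<close>]])
              have "\<ominus>\<^bsub>V\<^esub> (\<psi> (snd p) \<ominus>\<^bsub>V\<^esub> \<psi> (snd q)) \<in> B p" using * by simp
              moreover have "\<ominus>\<^bsub>V\<^esub> (\<psi> (snd p) \<ominus>\<^bsub>V\<^esub> \<psi> (snd q)) = \<psi> (snd q) \<ominus>\<^bsub>V\<^esub> \<psi> (snd p)"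
                using \<psi>c[OF Fu[OF \<open>p \<in> F\<close>]] \<psi>c[OF Fu[OF \<open>q \<in> F\<close>]] by algebra
              ultimately show ?thesis by simp
            qed (rule step[OF \<open>p \<in> F\<close> \<open>q \<in> F\<close>])
          qed
          then obtain l where l: "l \<in> carrier V" "\<And>p. p \<in> F \<Longrightarrow> l \<ominus>\<^bsub>V\<^esub> \<psi> (snd p) \<in> B p" by blast
          obtain p where p: "p \<in> F" using F(2) by blast
          from l(2)[OF p] obtain w where w: "w \<in> U" "l \<ominus>\<^bsub>V\<^esub> \<psi> (snd p) = \<psi> (fst p \<odot>\<^bsub>?M\<^esub> w)"
            by (auto simp: B_def)
          define v where "v = snd p \<oplus>\<^bsub>?M\<^esub> fst p \<odot>\<^bsub>?M\<^esub> w"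
          have v: "v \<in> U" unfolding v_def by (rule U(3)[OF Fu[OF p] BU[OF Fr[OF p] w(1)]])
          have "l = (l \<ominus>\<^bsub>V\<^esub> \<psi> (snd p)) \<oplus>\<^bsub>V\<^esub> \<psi> (snd p)"
            using l(1) \<psi>c[OF Fu[OF p]] by algebra
          also have "\<dots> = \<psi> v"
            unfolding w(2) v_def using \<psi>add[OF Fu[OF p] BU[OF Fr[OF p] w(1)]]
              \<psi>c[OF Fu[OF p]] \<psi>c[OF BU[OF Fr[OF p] w(1)]] by (simp add: V.a_comm)
          finally have lv: "l = \<psi> v" .
          have "\<exists>w\<in>U. v \<ominus>\<^bsub>?M\<^esub> snd p = fst p \<odot>\<^bsub>?M\<^esub> w" if p: "p \<in> F" for p
          proof -
            from l(2)[OF p] obtain w where w: "w \<in> U" "\<psi> v \<ominus>\<^bsub>V\<^esub> \<psi> (snd p) = \<psi> (fst p \<odot>\<^bsub>?M\<^esub> w)"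
              by (auto simp: B_def lv)
            then have "\<psi> (v \<ominus>\<^bsub>?M\<^esub> snd p) = \<psi> (fst p \<odot>\<^bsub>?M\<^esub> w)" using \<psi>minus v Fu[OF p] by simp
            then have "v \<ominus>\<^bsub>?M\<^esub> snd p = fst p \<odot>\<^bsub>?M\<^esub> w"
              by (rule \<psi>inj[OF U(5)[OF v Fu[OF p]] BU[OF Fr[OF p] w(1)]])
            with w(1) show ?thesis by blast
          qed
          with v show "\<exists>v\<in>U. \<forall>(r, u)\<in>F. \<exists>w\<in>U. v \<ominus>\<^bsub>?M\<^esub> u = r \<odot>\<^bsub>?M\<^esub> w" by fastforce
        qed
      qed
    qed
  qed
  with tf show ?thesis by (auto simp: separable_def)
qed

end

section \<open>Limits of well-ordered chains from a retraction\<close>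

context valuation_dom
begin

text \<open>The quotient in the field of fractions, for \<open>w \<noteq> 0\<close> dividing \<open>a\<close>.\<close>

definition quo :: "'a \<Rightarrow> 'a \<Rightarrow> 'a" (infixl \<open>\<oslash>\<close> 72) where
  "a \<oslash> w = (THE t. t \<in> carrier R \<and> a = w \<otimes> t)"

lemma quo_eqI:
  assumes "w \<in> carrier R" "w \<noteq> \<zero>" "t \<in> carrier R" "a = w \<otimes> t" shows "a \<oslash> w = t"
  unfolding quo_def using assms m_lcancel[of w] by (intro the_equality) auto

lemma quo_closed: "\<lbrakk>w \<in> carrier R; w \<noteq> \<zero>; w divides a\<rbrakk> \<Longrightarrow> a \<oslash> w \<in> carrier R"
  and mult_quo: "\<lbrakk>w \<in> carrier R; w \<noteq> \<zero>; w divides a\<rbrakk> \<Longrightarrow> w \<otimes> (a \<oslash> w) = a"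
  using quo_eqI by (auto simp: factor_def)

lemma quo_zero: "\<lbrakk>w \<in> carrier R; w \<noteq> \<zero>\<rbrakk> \<Longrightarrow> \<zero> \<oslash> w = \<zero>"
  by (rule quo_eqI) auto

lemma quo_add:
  assumes "w \<in> carrier R" "w \<noteq> \<zero>" "w divides a" "w divides b"
  shows "(a \<oplus> b) \<oslash> w = (a \<oslash> w) \<oplus> (b \<oslash> w)"
  using assms quo_closed mult_quo by (intro quo_eqI) (auto simp: r_distr)

lemma quo_mult:
  assumes "w \<in> carrier R" "w \<noteq> \<zero>" "w divides a" "r \<in> carrier R"
  shows "(r \<otimes> a) \<oslash> w = r \<otimes> (a \<oslash> w)"
proof (rule quo_eqI)
  show "r \<otimes> a = w \<otimes> (r \<otimes> (a \<oslash> w))"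
    using assms m_lcomm[of w r "a \<oslash> w"] quo_closed[OF assms(1-3)] mult_quo[OF assms(1-3)] by simp
qed (use assms quo_closed in auto)

lemma divides_trans': "\<lbrakk>a divides b; b divides c; a \<in> carrier R\<rbrakk> \<Longrightarrow> a divides c"
  by (auto simp: factor_def m_assoc)

lemma divides_refl': "a \<in> carrier R \<Longrightarrow> a divides a"
  by (auto simp: factor_def intro!: bexI[of _ \<one>])

definition common_multiples :: "'a set \<Rightarrow> 'a set" where
  "common_multiples W = {a \<in> carrier R. \<forall>w\<in>W. w divides a}"

lemma divides_add: "\<lbrakk>w \<in> carrier R; w divides a; w divides b\<rbrakk> \<Longrightarrow> w divides (a \<oplus> b)"
  by (auto simp: factor_def r_distr[symmetric])

lemma divides_mult: "\<lbrakk>w \<in> carrier R; w divides a; r \<in> carrier R\<rbrakk> \<Longrightarrow> w divides (r \<otimes> a)"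
  by (auto simp: factor_def m_lcomm[of r w])

lemma divides_mult_left:
  "\<lbrakk>a \<in> carrier R; b \<in> carrier R; b divides c\<rbrakk> \<Longrightarrow> (a \<otimes> b) divides (a \<otimes> c)"
  by (auto simp: factor_def m_assoc)

lemma ideal_divides: "\<lbrakk>ideal I R; a \<in> I; a divides b\<rbrakk> \<Longrightarrow> b \<in> I"
  using ideal.I_r_closed by (fastforce simp: factor_def)

lemma common_multiples_ideal:
  assumes "W \<subseteq> carrier R" shows "ideal (common_multiples W) R"
proof (rule idealI')
  fix x y assume "x \<in> common_multiples W" "y \<in> common_multiples W"
  then show "x \<oplus> y \<in> common_multiples W"
    using assms divides_add by (auto simp: common_multiples_def)
next
  fix x r assume *: "x \<in> common_multiples W" "r \<in> carrier R"
  then show "r \<otimes> x \<in> common_multiples W"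
    using assms divides_mult by (auto simp: common_multiples_def)
  moreover have "x \<in> carrier R" using * by (simp add: common_multiples_def)
  ultimately show "x \<otimes> r \<in> common_multiples W" using *(2) m_comm by simp
next
  show "\<zero> \<in> common_multiples W"
    using assms by (auto simp: common_multiples_def factor_def intro!: bexI[of _ \<zero>])
qed (auto simp: common_multiples_def)

end

text \<open>A linear map \<open>F\<close> defined on the vectors indexed by \<open>W\<close>, with values in the ideal of common multiples of
  \<open>W\<close>, that inverts the embedding \<open>a \<mapsto> (a / w)\<close> of this ideal. Vectors are functions of which only the values on
  \<open>W\<close> matter, whence the congruence assumption.\<close>

locale retraction = valuation_dom_max +
  fixes W :: "'a set" and F :: "('a \<Rightarrow> 'a) \<Rightarrow> 'a"
  assumes W: "W \<subseteq> carrier R" "W \<inter> common_multiples W = {}"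
    and F_closed: "y \<in> W \<rightarrow> carrier R \<Longrightarrow> F y \<in> common_multiples W"
    and F_cong: "\<lbrakk>y \<in> W \<rightarrow> carrier R; y' \<in> W \<rightarrow> carrier R; \<And>w. w \<in> W \<Longrightarrow> y w = y' w\<rbrakk> \<Longrightarrow> F y = F y'"
    and F_add: "\<lbrakk>y \<in> W \<rightarrow> carrier R; y' \<in> W \<rightarrow> carrier R\<rbrakk> \<Longrightarrow> F (\<lambda>w. y w \<oplus> y' w) = F y \<oplus> F y'"
    and F_smult: "\<lbrakk>y \<in> W \<rightarrow> carrier R; r \<in> carrier R\<rbrakk> \<Longrightarrow> F (\<lambda>w. r \<otimes> y w) = r \<otimes> F y"
    and F_retract: "a \<in> common_multiples W \<Longrightarrow> F (\<lambda>w. a \<oslash> w) = a"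
begin

abbreviation "A \<equiv> common_multiples W"

sublocale A: ideal A R by (rule common_multiples_ideal[OF W(1)])

lemma W_nonzero: "w \<in> W \<Longrightarrow> w \<noteq> \<zero>"
  using W(2) A.zero_closed by blast

lemma W_carrier: "w \<in> W \<Longrightarrow> w \<in> carrier R"
  using W(1) by blast

lemma W_divides: "\<lbrakk>w \<in> W; a \<in> A\<rbrakk> \<Longrightarrow> w divides a"
  unfolding common_multiples_def by blast

lemma A_quo: "\<lbrakk>w \<in> W; a \<in> A\<rbrakk> \<Longrightarrow> a \<oslash> w \<in> carrier R"
  by (rule quo_closed[OF W_carrier W_nonzero W_divides])

text \<open>The contribution of the coordinates in \<open>X\<close> to the value of \<open>F\<close> at \<open>(y w / w)\<close>; below, \<open>X\<close> is an initial part of \<open>W\<close> or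
  the part between two initial parts.\<close>

definition G :: "'a set \<Rightarrow> ('a \<Rightarrow> 'a) \<Rightarrow> 'a" where
  "G X y = F (\<lambda>w. if w \<in> X then y w \<oslash> w else \<zero>)"

lemma part_closed: "y \<in> W \<rightarrow> A \<Longrightarrow> (\<lambda>w. if w \<in> X then y w \<oslash> w else \<zero>) \<in> W \<rightarrow> carrier R"
  using A_quo[OF _ funcset_mem] by auto

lemma G_closed: "y \<in> W \<rightarrow> A \<Longrightarrow> G X y \<in> A"
  unfolding G_def by (rule F_closed[OF part_closed])

lemma G_add:
  assumes "y \<in> W \<rightarrow> A" "y' \<in> W \<rightarrow> A" shows "G X (\<lambda>w. y w \<oplus> y' w) = G X y \<oplus> G X y'"
  unfolding G_def
proof (subst F_add[OF part_closed[OF assms(1)] part_closed[OF assms(2)], symmetric], rule F_cong)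
  show "(\<lambda>w. if w \<in> X then (y w \<oplus> y' w) \<oslash> w else \<zero>) \<in> W \<rightarrow> carrier R"
    using assms by (intro part_closed) auto
  show "(\<lambda>w. (if w \<in> X then y w \<oslash> w else \<zero>) \<oplus> (if w \<in> X then y' w \<oslash> w else \<zero>)) \<in> W \<rightarrow> carrier R"
    using part_closed[OF assms(1)] part_closed[OF assms(2)] by (simp add: Pi_iff)
  fix w assume "w \<in> W"
  moreover from this have "y w \<in> A" "y' w \<in> A" using assms by auto
  ultimately show "(if w \<in> X then (y w \<oplus> y' w) \<oslash> w else \<zero>) =
    (if w \<in> X then y w \<oslash> w else \<zero>) \<oplus> (if w \<in> X then y' w \<oslash> w else \<zero>)"
    using quo_add[OF W_carrier W_nonzero W_divides W_divides] by simp
qed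

lemma G_split:
  assumes "y \<in> W \<rightarrow> A" "X \<inter> Y = {}" shows "G (X \<union> Y) y = G X y \<oplus> G Y y"
  unfolding G_def
proof (subst F_add[OF part_closed[OF assms(1)] part_closed[OF assms(1)], symmetric], rule F_cong)
  show "(\<lambda>w. (if w \<in> X then y w \<oslash> w else \<zero>) \<oplus> (if w \<in> Y then y w \<oslash> w else \<zero>)) \<in> W \<rightarrow> carrier R"
    using part_closed[OF assms(1)] by (simp add: Pi_iff)
  fix w assume "w \<in> W"
  then have "y w \<oslash> w \<in> carrier R" using A_quo assms(1) by blast
  with assms(2) show "(if w \<in> X \<union> Y then y w \<oslash> w else \<zero>) =
    (if w \<in> X then y w \<oslash> w else \<zero>) \<oplus> (if w \<in> Y then y w \<oslash> w else \<zero>)" by auto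
qed (rule part_closed[OF assms(1)])

lemma G_const: "a \<in> A \<Longrightarrow> G W (\<lambda>_. a) = a"
proof -
  assume a: "a \<in> A"
  have "G W (\<lambda>_. a) = F (\<lambda>w. a \<oslash> w)"
    unfolding G_def by (rule F_cong) (use a A_quo in auto)
  with a F_retract show ?thesis by simp
qed

lemma G_cong: "\<lbrakk>y \<in> W \<rightarrow> A; y' \<in> W \<rightarrow> A; \<And>w. w \<in> W \<Longrightarrow> w \<in> X \<Longrightarrow> y w = y' w\<rbrakk> \<Longrightarrow> G X y = G X y'"
  unfolding G_def by (rule F_cong[OF part_closed part_closed]) auto

definition L :: "'a \<Rightarrow> 'a set" where "L m = {w \<in> W. \<not> m divides w}"

text \<open>On the initial part before \<open>m\<close>, \<open>F\<close> takes the vector \<open>a / w\<close> to a multiple of \<open>a\<close> by an element of \<open>P\<close>,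
  since it takes the vector \<open>m / w\<close> to a proper multiple of \<open>m\<close>. So \<open>u m\<close> below is a unit: the tail of the vector
  \<open>a / w\<close> from \<open>m\<close> on still determines \<open>a\<close>.\<close>

definition u :: "'a \<Rightarrow> 'a" where
  "u m = \<one> \<ominus> (F (\<lambda>w. if w \<in> L m then m \<oslash> w else \<zero>) \<oslash> m)"

lemma u_unit_and_eq:
  assumes m: "m \<in> W"
  shows "u m \<in> Units R" "\<And>a. a \<in> A \<Longrightarrow> G (L m) (\<lambda>_. a) = a \<ominus> u m \<otimes> a"
proof -
  define y where "y w = (if w \<in> L m then m \<oslash> w else \<zero>)" for w
  define t where "t = F y \<oslash> m"
  have dvd: "w divides m" if "w \<in> L m" for w
    using that divides_total[of w m] W_carrier m by (auto simp: L_def)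
  have y: "y \<in> W \<rightarrow> carrier R"
    using dvd quo_closed W_carrier W_nonzero by (auto simp: y_def)
  have FA: "F y \<in> A" by (rule F_closed[OF y])
  have t: "t \<in> carrier R" "m \<otimes> t = F y"
    unfolding t_def using quo_closed mult_quo W_carrier[OF m] W_nonzero[OF m] W_divides[OF m FA] by auto
  have um: "u m = \<one> \<ominus> t" unfolding u_def t_def y_def ..
  have "t \<in> P"
  proof (rule ccontr)
    assume "t \<notin> P"
    with unitI t have tu: "t \<in> Units R" by blast
    then have "m = F y \<otimes> inv t" using t W_carrier[OF m] by (simp add: m_assoc flip: t(2))
    with A.I_r_closed[OF FA, of "inv t"] tu have "m \<in> A" by simp
    with m W(2) show False by blast
  qed
  have "\<one> \<ominus> t \<notin> P"
  proof
    assume "\<one> \<ominus> t \<in> P"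
    then have "(\<one> \<ominus> t) \<oplus> t \<in> P" using \<open>t \<in> P\<close> by simp
    moreover have "(\<one> \<ominus> t) \<oplus> t = \<one>" using t(1) by algebra
    ultimately show False using P.one_imp_carrier P.I_notcarr by simp
  qed
  with unitI um t(1) show "u m \<in> Units R" by simp
  fix a assume a: "a \<in> A"
  define q where "q = a \<oslash> m"
  have q: "q \<in> carrier R" "m \<otimes> q = a"
    unfolding q_def using quo_closed mult_quo W_carrier[OF m] W_nonzero[OF m] W_divides[OF m a] by auto
  have "G (L m) (\<lambda>_. a) = F (\<lambda>w. q \<otimes> y w)"
    unfolding G_def
  proof (rule F_cong)
    show "(\<lambda>w. if w \<in> L m then a \<oslash> w else \<zero>) \<in> W \<rightarrow> carrier R" using part_closed[of "\<lambda>_. a"] a by blast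
    show "(\<lambda>w. q \<otimes> y w) \<in> W \<rightarrow> carrier R" using y q by (auto simp: Pi_iff)
    fix w assume "w \<in> W"
    then show "(if w \<in> L m then a \<oslash> w else \<zero>) = q \<otimes> y w"
      using q dvd[of w] quo_mult[of w m q] W_carrier[OF m] W_carrier[of w] W_nonzero[of w] m_comm[of m q]
      by (auto simp: y_def)
  qed
  also have "\<dots> = q \<otimes> (m \<otimes> t)" using F_smult[OF y q(1)] t(2) by simp
  also have "\<dots> = (m \<otimes> q) \<otimes> t" using q(1) t(1) W_carrier[OF m] by algebra
  also have "\<dots> = a \<otimes> t" using q(2) by simp
  also have "\<dots> = a \<ominus> u m \<otimes> a" unfolding um using t(1) A.Icarr[OF a] by algebra
  finally show "G (L m) (\<lambda>_. a) = a \<ominus> u m \<otimes> a" .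
qed

text \<open>Solving \<open>c m = u m \<otimes> b m \<oplus> G (L m) b\<close> recursively for \<open>b\<close> turns a chain \<open>c\<close> into a chain \<open>b\<close> with the
  same moduli such that \<open>F\<close> maps the vector of the \<open>b w / w\<close> to a limit of \<open>c\<close>.\<close>

theorem chain_limit:
  assumes wf: "wf {(v, w). v \<in> W \<and> w \<in> W \<and> \<not> w divides v}"
    and c: "c \<in> W \<rightarrow> A"
    and S: "\<And>m. m \<in> W \<Longrightarrow> S m \<subseteq> A" "\<And>m. m \<in> W \<Longrightarrow> ideal (S m) R"
    and stable: "\<And>m y. \<lbrakk>m \<in> W; y \<in> W \<rightarrow> S m\<rbrakk> \<Longrightarrow> F (\<lambda>w. y w \<oslash> w) \<in> S m"
    and chain: "\<And>m l. \<lbrakk>m \<in> W; l \<in> W; m divides l\<rbrakk> \<Longrightarrow> c l \<ominus> c m \<in> S m"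
  shows "\<exists>\<beta>\<in>A. \<forall>m\<in>W. \<beta> \<ominus> c m \<in> S m"
proof -
  let ?r = "{(v, w). v \<in> W \<and> w \<in> W \<and> \<not> w divides v}"
  have Lr: "w \<in> L m \<longleftrightarrow> (w, m) \<in> ?r" if "m \<in> W" for w m using that by (auto simp: L_def)
  define b where "b = wfrec ?r (\<lambda>b m. inv (u m) \<otimes> (c m \<ominus> G (L m) b))"
  have b_rec: "b m = inv (u m) \<otimes> (c m \<ominus> G (L m) b)" if m: "m \<in> W" for m
  proof -
    have "G (L m) (cut b ?r m) = G (L m) b"
      unfolding G_def by (intro arg_cong[where f = F] ext) (simp add: Lr[OF m] cut_apply)
    then show ?thesis using def_wfrec[OF b_def[THEN eq_reflection] wf, of m] by simp
  qed
  have GS: "G X y \<in> S m" if m: "m \<in> W" and y: "\<And>w. w \<in> X \<Longrightarrow> w \<in> W \<Longrightarrow> y w \<in> S m" for X y m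
  proof -
    let ?y = "\<lambda>w. if w \<in> X then y w else \<zero>"
    have y': "?y \<in> W \<rightarrow> S m"
      using y ideal.axioms(1)[OF S(2)[OF m]] by (auto simp: additive_subgroup.zero_closed)
    have "G X y = F (\<lambda>w. ?y w \<oslash> w)"
      unfolding G_def
    proof (rule F_cong)
      have "?y w \<oslash> w \<in> carrier R" if "w \<in> W" for w using y' S(1)[OF m] A_quo[OF that] that by blast
      then show "(\<lambda>w. ?y w \<oslash> w) \<in> W \<rightarrow> carrier R" by blast
      moreover have "(if w \<in> X then y w \<oslash> w else \<zero>) = ?y w \<oslash> w" if "w \<in> W" for w
        using quo_zero[OF W_carrier[OF that] W_nonzero[OF that]] by simp
      ultimately show "(\<lambda>w. if w \<in> X then y w \<oslash> w else \<zero>) \<in> W \<rightarrow> carrier R"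
        "\<And>w. w \<in> W \<Longrightarrow> (if w \<in> X then y w \<oslash> w else \<zero>) = ?y w \<oslash> w" by auto
    qed
    with stable[OF m y'] show ?thesis by simp
  qed
  note u = u_unit_and_eq
  have bA: "m \<in> W \<Longrightarrow> b m \<in> A" for m
  proof (induction m rule: wf_induct_rule[OF wf])
    case (1 m)
    let ?y = "\<lambda>w. if w \<in> L m then b w else \<zero>"
    have "?y \<in> W \<rightarrow> A" using 1 Lr[OF \<open>m \<in> W\<close>] A.zero_closed by auto
    from G_closed[OF this] have "G (L m) ?y \<in> A" .
    moreover have "G (L m) ?y = G (L m) b"
      unfolding G_def by (intro arg_cong[where f = F] ext) simp
    ultimately have "c m \<ominus> G (L m) b \<in> A" using c \<open>m \<in> W\<close> by (auto simp: minus_eq)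
    then show ?case using b_rec[OF \<open>m \<in> W\<close>] u(1)[OF \<open>m \<in> W\<close>] A.I_l_closed by simp
  qed
  then have bW: "b \<in> W \<rightarrow> A" by blast
  have constW: "(\<lambda>_. b m) \<in> W \<rightarrow> A" if "m \<in> W" for m using bA that by blast
  have diffW: "(\<lambda>w. b w \<ominus> b m) \<in> W \<rightarrow> A" if "m \<in> W" for m using bA that by (auto simp: minus_eq)
  have Gc: "G X y \<in> carrier R" if "y \<in> W \<rightarrow> A" for X y using G_closed[OF that] A.Icarr by blast
  note carr = Gc[OF bW] Gc[OF constW] Gc[OF diffW]
  have bc: "b m \<in> carrier R" if "m \<in> W" for m using A.Icarr[OF bA[OF that]] .
  have uc: "u m \<in> carrier R" if "m \<in> W" for m by (rule Units_closed[OF u(1)[OF that]])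
  have cc: "c m \<in> carrier R" if "m \<in> W" for m using c that A.Icarr by blast
  have star: "c m = u m \<otimes> b m \<oplus> G (L m) b" if m: "m \<in> W" for m
  proof -
    have "u m \<otimes> b m = c m \<ominus> G (L m) b"
      unfolding b_rec[OF m] using u(1)[OF m] cc[OF m] carr(1) by (subst m_assoc[symmetric]) auto
    moreover have "c m = (c m \<ominus> G (L m) b) \<oplus> G (L m) b" using cc[OF m] carr(1)[of "L m"] by algebra
    ultimately show ?thesis by simp
  qed
  have GX: "G X b = G X (\<lambda>w. b w \<ominus> b m) \<oplus> G X (\<lambda>_. b m)" if m: "m \<in> W" for X m
  proof -
    have "G X (\<lambda>w. (b w \<ominus> b m) \<oplus> b m) = G X b"
    proof (rule G_cong[OF _ bW])
      show "(\<lambda>w. (b w \<ominus> b m) \<oplus> b m) \<in> W \<rightarrow> A" using diffW[OF m] bA[OF m] by blast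
      show "(b w \<ominus> b m) \<oplus> b m = b w" if "w \<in> W" for w using bc[OF m] bc[OF that] by algebra
    qed
    with G_add[OF diffW[OF m] constW[OF m]] show ?thesis by simp
  qed
  have D: "m \<in> W \<Longrightarrow> l \<in> W \<Longrightarrow> m divides l \<Longrightarrow> b l \<ominus> b m \<in> S m" for m l
  proof (induction l rule: wf_induct_rule[OF wf])
    case (1 l)
    note m = \<open>m \<in> W\<close> and l = \<open>l \<in> W\<close>
    interpret S: ideal "S m" R by (rule S(2)[OF m])
    define E where "E = {w \<in> L l. m divides w}"
    have "w \<in> L l" if "w \<in> L m" for w
      using that divides_trans'[OF \<open>m divides l\<close>, of w] W_carrier[OF m] by (auto simp: L_def)
    then have Ll: "L l = L m \<union> E" "L m \<inter> E = {}" by (auto simp: E_def L_def)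
    have IH: "b w \<ominus> b m \<in> S m" if "w \<in> E" for w
      using 1(1)[of w] that Lr[OF l] m by (auto simp: E_def)
    have d: "G E (\<lambda>w. b w \<ominus> b m) \<in> S m" by (rule GS[OF m IH])
    define g h k where "g = G (L m) b" and "h = G E (\<lambda>w. b w \<ominus> b m)" and "k = G E (\<lambda>_. b m)"
    have carr': "g \<in> carrier R" "h \<in> carrier R" "k \<in> carrier R" "b m \<in> carrier R" "b l \<in> carrier R"
      "u m \<in> carrier R" "u l \<in> carrier R"
      using carr bc uc m l by (auto simp: g_def h_def k_def)
    have "b m \<ominus> u l \<otimes> b m = (b m \<ominus> u m \<otimes> b m) \<oplus> k"
      using G_split[OF constW[OF m] Ll(2)] u(2)[OF m bA[OF m]] u(2)[OF l bA[OF m]] by (simp add: Ll(1) k_def)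
    then have "k = (b m \<ominus> u l \<otimes> b m) \<ominus> (b m \<ominus> u m \<otimes> b m)"
      using carr' by (metis (no_types, lifting) a_comm add.inv_solve_right' minus_closed m_closed minus_eq)
    then have k: "k = u m \<otimes> b m \<ominus> u l \<otimes> b m" using carr' by algebra
    have "c l = u l \<otimes> b l \<oplus> (g \<oplus> (h \<oplus> k))"
      using star[OF l] G_split[OF bW Ll(2)] GX[OF m, of E] by (simp add: Ll(1) g_def h_def k_def)
    then have "c l \<ominus> c m = (u l \<otimes> b l \<oplus> (g \<oplus> (h \<oplus> k))) \<ominus> (u m \<otimes> b m \<oplus> g)"
      using star[OF m] by (simp add: g_def)
    also have "\<dots> = u l \<otimes> (b l \<ominus> b m) \<oplus> h" unfolding k using carr' by algebra
    finally have "u l \<otimes> (b l \<ominus> b m) \<oplus> h \<in> S m" using chain[OF m l] 1 by simp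
    then have "(u l \<otimes> (b l \<ominus> b m) \<oplus> h) \<ominus> h \<in> S m" using d by (simp add: minus_eq h_def)
    moreover have "(u l \<otimes> (b l \<ominus> b m) \<oplus> h) \<ominus> h = u l \<otimes> (b l \<ominus> b m)" using carr' by algebra
    ultimately have "inv (u l) \<otimes> (u l \<otimes> (b l \<ominus> b m)) \<in> S m"
      using u(1)[OF l] S.I_l_closed by simp
    moreover have "inv (u l) \<otimes> (u l \<otimes> (b l \<ominus> b m)) = b l \<ominus> b m"
      using u(1)[OF l] carr' by (subst m_assoc[symmetric]) auto
    ultimately show ?case by simp
  qed
  show ?thesis
  proof (intro bexI[of _ "G W b"] ballI)
    show "G W b \<in> A" by (rule G_closed[OF bW])
    fix m assume m: "m \<in> W"
    define E where "E = {w \<in> W. m divides w}"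
    have Ll: "W = L m \<union> E" "L m \<inter> E = {}" by (auto simp: E_def L_def)
    have d: "G E (\<lambda>w. b w \<ominus> b m) \<in> S m" by (rule GS[OF m D[OF m]]) (auto simp: E_def)
    define g h k where "g = G (L m) b" and "h = G E (\<lambda>w. b w \<ominus> b m)" and "k = G E (\<lambda>_. b m)"
    have carr': "g \<in> carrier R" "h \<in> carrier R" "k \<in> carrier R" "b m \<in> carrier R" "u m \<in> carrier R"
      using carr bc uc m by (auto simp: g_def h_def k_def)
    have "b m = (b m \<ominus> u m \<otimes> b m) \<oplus> k"
      using G_split[OF constW[OF m] Ll(2)] u(2)[OF m bA[OF m]] G_const[OF bA[OF m]] Ll(1) by (simp add: k_def)
    then have "k = b m \<ominus> (b m \<ominus> u m \<otimes> b m)"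
      using carr' by (metis (no_types, lifting) a_comm add.inv_solve_right' minus_closed m_closed minus_eq)
    then have k: "k = u m \<otimes> b m" using carr' by algebra
    have "G W b = g \<oplus> (h \<oplus> k)"
      using G_split[OF bW Ll(2)] GX[OF m, of E] Ll(1) by (simp add: g_def h_def k_def)
    then have "G W b \<ominus> c m = (g \<oplus> (h \<oplus> k)) \<ominus> (u m \<otimes> b m \<oplus> g)" using star[OF m] by (simp add: g_def)
    also have "\<dots> = h" unfolding k using carr' by algebra
    finally show "G W b \<ominus> c m \<in> S m" using d by (simp add: h_def)
  qed
qed

lemma F_quo_closed: "y \<in> W \<rightarrow> A \<Longrightarrow> F (\<lambda>w. y w \<oslash> w) \<in> A"
  using A_quo by (intro F_closed) (auto simp: Pi_iff)

lemma F_quo_mult: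
  assumes "y \<in> W \<rightarrow> A" "r \<in> carrier R"
  shows "F (\<lambda>w. (r \<otimes> y w) \<oslash> w) = r \<otimes> F (\<lambda>w. y w \<oslash> w)"
proof -
  have y: "(\<lambda>w. y w \<oslash> w) \<in> W \<rightarrow> carrier R" using assms(1) A_quo by (auto simp: Pi_iff)
  have *: "(r \<otimes> y w) \<oslash> w = r \<otimes> (y w \<oslash> w)" if "w \<in> W" for w
    by (rule quo_mult[OF W_carrier W_nonzero W_divides]) (use that assms in auto)
  have "F (\<lambda>w. (r \<otimes> y w) \<oslash> w) = F (\<lambda>w. r \<otimes> (y w \<oslash> w))"
    using y assms(2) * by (intro F_cong) (auto simp: Pi_iff)
  with F_smult[OF y assms(2)] show ?thesis by simp
qed

text \<open>The moduli that occur below are the submodules \<open>(p / q) A \<inter> A\<close> of \<open>A\<close>; they are stable under \<open>F\<close> because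
  \<open>F\<close> is linear.\<close>

theorem scaled_chain_limit:
  assumes wf: "wf {(v, w). v \<in> W \<and> w \<in> W \<and> \<not> w divides v}"
    and c: "c \<in> W \<rightarrow> A"
    and pq: "\<And>m. m \<in> W \<Longrightarrow> p m \<in> carrier R" "\<And>m. m \<in> W \<Longrightarrow> q m \<in> carrier R"
    and chain: "\<And>m l. \<lbrakk>m \<in> W; l \<in> W; m divides l\<rbrakk> \<Longrightarrow> \<exists>a\<in>A. q m \<otimes> (c l \<ominus> c m) = p m \<otimes> a"
  shows "\<exists>\<beta>\<in>A. \<forall>m\<in>W. \<exists>a\<in>A. q m \<otimes> (\<beta> \<ominus> c m) = p m \<otimes> a"
proof -
  define S where "S m = {b \<in> A. \<exists>a\<in>A. q m \<otimes> b = p m \<otimes> a}" for m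
  note Ac = A.Icarr
  have "\<exists>\<beta>\<in>A. \<forall>m\<in>W. \<beta> \<ominus> c m \<in> S m"
  proof (rule chain_limit[OF wf c])
    fix m assume m: "m \<in> W"
    note mc = pq[OF m]
    show "S m \<subseteq> A" by (auto simp: S_def)
    show "ideal (S m) R"
    proof (rule idealI')
      show "S m \<subseteq> carrier R" using Ac by (auto simp: S_def)
      show "\<zero> \<in> S m" using A.zero_closed mc by (auto simp: S_def intro!: bexI[of _ \<zero>])
      fix x y assume "x \<in> S m" "y \<in> S m"
      then obtain a b where ab: "x \<in> A" "y \<in> A" "a \<in> A" "b \<in> A" "q m \<otimes> x = p m \<otimes> a" "q m \<otimes> y = p m \<otimes> b"
        by (auto simp: S_def)
      then have "q m \<otimes> (x \<oplus> y) = p m \<otimes> (a \<oplus> b)" using mc Ac by (simp add: r_distr)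
      with ab show "x \<oplus> y \<in> S m" unfolding S_def using A.a_closed by blast
    next
      fix x r assume "x \<in> S m" and r: "r \<in> carrier R"
      then obtain a where a: "x \<in> A" "a \<in> A" "q m \<otimes> x = p m \<otimes> a" by (auto simp: S_def)
      have "q m \<otimes> (r \<otimes> x) = r \<otimes> (q m \<otimes> x)" using mc Ac[OF a(1)] r by (simp add: m_lcomm)
      also have "\<dots> = p m \<otimes> (r \<otimes> a)" using mc Ac[OF a(2)] r by (simp add: a(3) m_lcomm)
      finally show *: "r \<otimes> x \<in> S m" unfolding S_def using a r A.I_l_closed by blast
      with m_comm[OF r Ac[OF a(1)]] show "x \<otimes> r \<in> S m" by simp
    qed
    {
      fix y assume y: "y \<in> W \<rightarrow> S m"
      then have "\<forall>w\<in>W. \<exists>a\<in>A. q m \<otimes> y w = p m \<otimes> a" by (auto simp: S_def)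
      then obtain a where a: "\<And>w. w \<in> W \<Longrightarrow> a w \<in> A" "\<And>w. w \<in> W \<Longrightarrow> q m \<otimes> y w = p m \<otimes> a w" by metis
      have yA: "y \<in> W \<rightarrow> A" and aA: "a \<in> W \<rightarrow> A" using y a(1) by (auto simp: S_def)
      have mult_closed: "(\<lambda>w. (r \<otimes> z w) \<oslash> w) \<in> W \<rightarrow> carrier R" if "r \<in> carrier R" "z \<in> W \<rightarrow> A" for r z
        using that A_quo A.I_l_closed by (auto simp: Pi_iff)
      have "q m \<otimes> F (\<lambda>w. y w \<oslash> w) = F (\<lambda>w. (q m \<otimes> y w) \<oslash> w)"
        using F_quo_mult[OF yA mc(2)] by simp
      also have "\<dots> = F (\<lambda>w. (p m \<otimes> a w) \<oslash> w)"
        using mc a(2) by (intro F_cong mult_closed yA aA) auto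
      also have "\<dots> = p m \<otimes> F (\<lambda>w. a w \<oslash> w)" using F_quo_mult[OF aA] mc by simp
      finally show "F (\<lambda>w. y w \<oslash> w) \<in> S m"
        using F_quo_closed[OF yA] F_quo_closed[OF aA] unfolding S_def by blast
    }
    fix l assume l: "l \<in> W" "m divides l"
    have "c l \<ominus> c m \<in> A" using c l(1) m by (auto simp: minus_eq)
    with chain[OF m l] show "c l \<ominus> c m \<in> S m" unfolding S_def by blast
  qed
  then show ?thesis unfolding S_def by blast
qed

end

section \<open>Retractions from separability\<close>

context valuation_dom_max
begin

text \<open>The vectors \<open>(a / w)\<close>, extended by zero outside the image of \<open>W\<close> in \<open>\<Lambda>\<close>, form a uniserial submodule because they
  depend linearly on \<open>a\<close>. It is pure: if \<open>r z\<close> is such a vector with \<open>r \<noteq> 0\<close>, then \<open>r\<close> divides \<open>a\<close>, and \<open>a / r\<close> is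
  again a common multiple of \<open>W\<close>. The projection along a complement is the retraction.\<close>

lemma retraction_of_separable:
  fixes \<Lambda> :: "'i set"
  assumes sep: "separable R (power_module R \<Lambda>)" and j: "inj_on j W" "j ` W \<subseteq> \<Lambda>"
    and W: "W \<subseteq> carrier R" "W \<inter> common_multiples W = {}" "W \<noteq> {}"
  shows "\<exists>F. retraction R P J W F"
proof -
  let ?M = "power_module R \<Lambda>" and ?A = "common_multiples W"
  interpret M: module R ?M by (rule module_power_module[OF is_cring])
  interpret A: ideal ?A R by (rule common_multiples_ideal[OF W(1)])
  note pm = power_module_simps
  have tf: "torsion_free R ?M" by (rule torsion_free_power_module)
  have Wc: "w \<in> carrier R" and W0: "w \<noteq> \<zero>" if "w \<in> W" for w
    using that W A.zero_closed by auto
  have Wd: "w divides a" if "w \<in> W" "a \<in> ?A" for w a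
    using that unfolding common_multiples_def by blast
  define emb :: "('a \<Rightarrow> 'a) \<Rightarrow> ('i \<Rightarrow> 'a)" where
    "emb y = (\<lambda>i\<in>\<Lambda>. if i \<in> j ` W then y (inv_into W j i) else \<zero>)" for y
  have emb_j: "emb y (j w) = y w" if "w \<in> W" for y w
    using that j by (auto simp: emb_def)
  have emb_out: "emb y i = \<zero>" if "i \<in> \<Lambda>" "i \<notin> j ` W" for y i using that by (simp add: emb_def)
  have emb_c: "emb y \<in> carrier ?M" if "y \<in> W \<rightarrow> carrier R" for y
    using funcset_mem[OF that] j by (auto simp: emb_def pm)
  have eqI: "x = x'" if "x \<in> carrier ?M" "x' \<in> carrier ?M" "\<And>w. w \<in> W \<Longrightarrow> x (j w) = x' (j w)"
    "\<And>i. i \<in> \<Lambda> \<Longrightarrow> i \<notin> j ` W \<Longrightarrow> x i = x' i" for x x'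
    using that(3,4) by (intro power_module_eqI[OF that(1,2)]) blast
  have emb_add: "emb (\<lambda>w. y w \<oplus> y' w) = emb y \<oplus>\<^bsub>?M\<^esub> emb y'"
    if "y \<in> W \<rightarrow> carrier R" "y' \<in> W \<rightarrow> carrier R" for y y'
  proof (rule eqI)
    show "emb (\<lambda>w. y w \<oplus> y' w) \<in> carrier ?M" using that by (intro emb_c) auto
    show "emb y \<oplus>\<^bsub>?M\<^esub> emb y' \<in> carrier ?M" using that emb_c by simp
  qed (use j that in \<open>auto simp: emb_j emb_out pm(3)\<close>)
  have emb_smult: "emb (\<lambda>w. r \<otimes> y w) = r \<odot>\<^bsub>?M\<^esub> emb y"
    if "y \<in> W \<rightarrow> carrier R" "r \<in> carrier R" for y r
  proof (rule eqI)
    show "emb (\<lambda>w. r \<otimes> y w) \<in> carrier ?M" using that by (intro emb_c) auto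
    show "r \<odot>\<^bsub>?M\<^esub> emb y \<in> carrier ?M" using that emb_c by simp
  qed (use j that in \<open>auto simp: emb_j emb_out pm(4)\<close>)
  have emb_cong: "emb y = emb y'" if "\<And>w. w \<in> W \<Longrightarrow> y w = y' w" for y y'
    using that j(1) by (auto simp: emb_def fun_eq_iff)
  define \<phi> where "\<phi> a = emb (\<lambda>w. a \<oslash> w)" for a
  have quo_W: "(\<lambda>w. a \<oslash> w) \<in> W \<rightarrow> carrier R" if "a \<in> ?A" for a
    using quo_closed[OF Wc W0 Wd] that by blast
  have \<phi>c: "\<phi> a \<in> carrier ?M" if "a \<in> ?A" for a unfolding \<phi>_def by (rule emb_c[OF quo_W[OF that]])
  have \<phi>_add: "\<phi> (a \<oplus> b) = \<phi> a \<oplus>\<^bsub>?M\<^esub> \<phi> b" if "a \<in> ?A" "b \<in> ?A" for a b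
    unfolding \<phi>_def emb_add[OF quo_W[OF that(1)] quo_W[OF that(2)], symmetric]
    by (rule emb_cong) (use that quo_add[OF Wc W0 Wd Wd] in blast)
  have \<phi>_smult: "\<phi> (r \<otimes> a) = r \<odot>\<^bsub>?M\<^esub> \<phi> a" if "a \<in> ?A" "r \<in> carrier R" for r a
    unfolding \<phi>_def emb_smult[OF quo_W[OF that(1)] that(2), symmetric]
    by (rule emb_cong) (use that quo_mult[OF Wc W0 Wd] in blast)
  have \<phi>_inj: "a = b" if "a \<in> ?A" "b \<in> ?A" "\<phi> a = \<phi> b" for a b
  proof -
    from W(3) obtain w where w: "w \<in> W" by blast
    have "a \<oslash> w = b \<oslash> w" using that(3) emb_j[OF w] unfolding \<phi>_def by metis
    then show ?thesis using mult_quo[OF Wc[OF w] W0[OF w] Wd[OF w]] that(1,2) by metis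
  qed
  define U where "U = \<phi> ` ?A"
  have Us: "submodule U R ?M"
  proof (rule M.submoduleI')
    show "U \<subseteq> carrier ?M" using \<phi>c by (auto simp: U_def)
    have "\<phi> (\<zero> \<otimes> \<zero>) = \<zero>\<^bsub>?M\<^esub>" using \<phi>_smult[of \<zero> \<zero>] \<phi>c[of \<zero>] A.zero_closed by simp
    then show "\<zero>\<^bsub>?M\<^esub> \<in> U" using A.zero_closed by (auto simp: U_def intro!: image_eqI[of _ _ \<zero>])
    fix x y assume "x \<in> U" "y \<in> U"
    then obtain a b where "a \<in> ?A" "x = \<phi> a" "b \<in> ?A" "y = \<phi> b" by (auto simp: U_def)
    then show "x \<oplus>\<^bsub>?M\<^esub> y \<in> U" unfolding U_def
      using \<phi>_add[of a b] A.a_closed[of a b] by (intro image_eqI[of _ _ "a \<oplus> b"]) auto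
  next
    fix r x assume "r \<in> carrier R" "x \<in> U"
    then obtain a where "r \<in> carrier R" "a \<in> ?A" "x = \<phi> a" by (auto simp: U_def)
    then show "r \<odot>\<^bsub>?M\<^esub> x \<in> U" unfolding U_def
      using \<phi>_smult[of a r] A.I_l_closed[of a r] by (intro image_eqI[of _ _ "r \<otimes> a"]) auto
  qed
  note U = M.submodule_closed[OF Us]
  have pure: "pure_submodule U R ?M"
    unfolding M.pure_submodule_iff[OF tf domain_axioms]
  proof (intro conjI Us ballI impI)
    fix r z assume r: "r \<in> carrier R - {\<zero>}" and z: "z \<in> carrier ?M" and "r \<odot>\<^bsub>?M\<^esub> z \<in> U"
    then obtain a where a: "a \<in> ?A" "r \<odot>\<^bsub>?M\<^esub> z = \<phi> a" by (auto simp: U_def)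
    have zc: "z i \<in> carrier R" if "i \<in> \<Lambda>" for i using z that by (auto simp: pm)
    have ri: "r \<otimes> z i = \<phi> a i" if "i \<in> \<Lambda>" for i using a(2) that by (metis pm(4) restrict_apply')
    have rw: "a = r \<otimes> (w \<otimes> z (j w))" if w: "w \<in> W" for w
    proof -
      have jw: "j w \<in> \<Lambda>" using w j by blast
      have "a = w \<otimes> (a \<oslash> w)" using mult_quo[OF Wc[OF w] W0[OF w] Wd[OF w a(1)]] by simp
      also have "a \<oslash> w = r \<otimes> z (j w)" using ri[OF jw] emb_j[OF w] by (simp add: \<phi>_def)
      finally show ?thesis using m_lcomm[OF Wc[OF w], of r "z (j w)"] r zc[OF jw] by simp
    qed
    from W(3) obtain w0 where w0: "w0 \<in> W" by blast
    define b where "b = w0 \<otimes> z (j w0)"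
    have b: "b \<in> carrier R" "a = r \<otimes> b" using rw[OF w0] Wc[OF w0] zc j(2) w0 by (auto simp: b_def)
    have bw: "b = w \<otimes> z (j w)" if w: "w \<in> W" for w
      using rw[OF w] b r Wc[OF w] zc[of "j w"] j(2) w m_lcancel[of r b "w \<otimes> z (j w)"] by auto
    have bA: "b \<in> ?A" unfolding common_multiples_def
    proof (intro CollectI conjI ballI b(1))
      fix w assume w: "w \<in> W"
      then have "z (j w) \<in> carrier R" using zc j(2) by blast
      with bw[OF w] show "w divides b" unfolding factor_def by blast
    qed
    have "z = \<phi> b"
    proof (rule eqI[OF z \<phi>c[OF bA]])
      fix w assume w: "w \<in> W"
      then have zw: "z (j w) \<in> carrier R" using zc j(2) by blast
      have "b \<oslash> w = z (j w)" by (rule quo_eqI[OF Wc[OF w] W0[OF w] zw bw[OF w]])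
      then show "z (j w) = \<phi> b (j w)" using emb_j[OF w] by (simp add: \<phi>_def)
    next
      fix i assume i: "i \<in> \<Lambda>" "i \<notin> j ` W"
      then have "r \<otimes> z i = \<zero>" using ri[OF i(1)] emb_out[OF i] by (simp add: \<phi>_def)
      then have "z i = \<zero>" using integral[of r "z i"] r zc[OF i(1)] by auto
      then show "z i = \<phi> b i" using emb_out[OF i] by (simp add: \<phi>_def)
    qed
    with bA show "z \<in> U" by (auto simp: U_def)
  qed
  have uni: "uniserial R (?M\<lparr>carrier := U\<rparr>)"
    unfolding M.uniserial_iff[OF Us]
  proof (intro ballI)
    fix x y assume "x \<in> U" "y \<in> U"
    then obtain a b where ab: "a \<in> ?A" "x = \<phi> a" "b \<in> ?A" "y = \<phi> b" by (auto simp: U_def)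
    from divides_total[OF A.Icarr[OF ab(1)] A.Icarr[OF ab(3)]]
    show "\<exists>r\<in>carrier R. x = r \<odot>\<^bsub>?M\<^esub> y \<or> y = r \<odot>\<^bsub>?M\<^esub> x"
    proof
      assume "a divides b"
      then obtain r where r: "r \<in> carrier R" "b = r \<otimes> a"
        using A.Icarr[OF ab(1)] by (auto simp: factor_def m_comm)
      with \<phi>_smult[OF ab(1) r(1)] ab show ?thesis by blast
    next
      assume "b divides a"
      then obtain r where r: "r \<in> carrier R" "a = r \<otimes> b"
        using A.Icarr[OF ab(3)] by (auto simp: factor_def m_comm)
      with \<phi>_smult[OF ab(3) r(1)] ab show ?thesis by blast
    qed
  qed
  from sep pure uni obtain K where K: "submodule K R ?M" "U \<inter> K = {\<zero>\<^bsub>?M\<^esub>}" "U <+>\<^bsub>?M\<^esub> K = carrier ?M"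
    unfolding separable_def direct_summand_def by blast
  note K' = M.submodule_closed[OF K(1)]
  define F where "F y = (THE a. a \<in> ?A \<and> (\<exists>k\<in>K. emb y = \<phi> a \<oplus>\<^bsub>?M\<^esub> k))" for y
  have F_eq: "F y = a" if y: "y \<in> W \<rightarrow> carrier R" and a: "a \<in> ?A" "k \<in> K" "emb y = \<phi> a \<oplus>\<^bsub>?M\<^esub> k" for y a k
    unfolding F_def
  proof (rule the_equality)
    show "a \<in> ?A \<and> (\<exists>k\<in>K. emb y = \<phi> a \<oplus>\<^bsub>?M\<^esub> k)" using a by blast
    fix b assume "b \<in> ?A \<and> (\<exists>k\<in>K. emb y = \<phi> b \<oplus>\<^bsub>?M\<^esub> k)"
    then obtain l where b: "b \<in> ?A" "l \<in> K" "emb y = \<phi> b \<oplus>\<^bsub>?M\<^esub> l" by blast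
    have c: "\<phi> a \<in> carrier ?M" "\<phi> b \<in> carrier ?M" "k \<in> carrier ?M" "l \<in> carrier ?M"
      using \<phi>c a b K'(1) by auto
    have "\<phi> b \<ominus>\<^bsub>?M\<^esub> \<phi> a = ((\<phi> b \<oplus>\<^bsub>?M\<^esub> l) \<ominus>\<^bsub>?M\<^esub> l) \<ominus>\<^bsub>?M\<^esub> \<phi> a" using c by algebra
    also have "\<dots> = ((\<phi> a \<oplus>\<^bsub>?M\<^esub> k) \<ominus>\<^bsub>?M\<^esub> l) \<ominus>\<^bsub>?M\<^esub> \<phi> a" using a(3) b(3) by simp
    also have "\<dots> = k \<ominus>\<^bsub>?M\<^esub> l" using c by algebra
    finally have "\<phi> b \<ominus>\<^bsub>?M\<^esub> \<phi> a \<in> K" using K'(5)[OF a(2) b(2)] by simp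
    moreover have "\<phi> b \<ominus>\<^bsub>?M\<^esub> \<phi> a \<in> U" using U(5) a b unfolding U_def by blast
    ultimately have "\<phi> b \<ominus>\<^bsub>?M\<^esub> \<phi> a = \<zero>\<^bsub>?M\<^esub>" using K(2) by blast
    then have "\<phi> b = \<phi> a" using M.M.minus_eq_zero_iff c by blast
    then show "b = a" using \<phi>_inj a b by blast
  qed
  have F_ex: "\<exists>k\<in>K. F y \<in> ?A \<and> emb y = \<phi> (F y) \<oplus>\<^bsub>?M\<^esub> k" if y: "y \<in> W \<rightarrow> carrier R" for y
  proof -
    have "emb y \<in> U <+>\<^bsub>?M\<^esub> K" using emb_c[OF y] K(3) by simp
    then obtain a k where "a \<in> ?A" "k \<in> K" "emb y = \<phi> a \<oplus>\<^bsub>?M\<^esub> k" by (auto simp: set_add_def' U_def)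
    with F_eq[OF y this] show ?thesis by blast
  qed
  have ret: "retraction R P J W F"
  proof (unfold_locales)
    show "W \<subseteq> carrier R" "W \<inter> ?A = {}" by (rule W)+
    show "F y \<in> ?A" if "y \<in> W \<rightarrow> carrier R" for y using F_ex[OF that] by blast
    show "F y = F y'" if "\<And>w. w \<in> W \<Longrightarrow> y w = y' w" for y y'
      using emb_cong[OF that] by (simp add: F_def)
    show "F (\<lambda>w. a \<oslash> w) = a" if a: "a \<in> ?A" for a
      using a K'(2) \<phi>c[OF a] by (intro F_eq[OF quo_W[OF a], of _ "\<zero>\<^bsub>?M\<^esub>"]) (simp_all add: \<phi>_def)
    show "F (\<lambda>w. y w \<oplus> y' w) = F y \<oplus> F y'"
      if y: "y \<in> W \<rightarrow> carrier R" "y' \<in> W \<rightarrow> carrier R" for y y'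
    proof -
      from F_ex[OF y(1)] F_ex[OF y(2)] obtain k k' where k: "k \<in> K" "F y \<in> ?A" "emb y = \<phi> (F y) \<oplus>\<^bsub>?M\<^esub> k"
        "k' \<in> K" "F y' \<in> ?A" "emb y' = \<phi> (F y') \<oplus>\<^bsub>?M\<^esub> k'" by blast
      show ?thesis
      proof (rule F_eq)
        show "(\<lambda>w. y w \<oplus> y' w) \<in> W \<rightarrow> carrier R" using y by (auto simp: Pi_iff)
        show "F y \<oplus> F y' \<in> ?A" "k \<oplus>\<^bsub>?M\<^esub> k' \<in> K" using k K'(3) by auto
        have c: "\<phi> (F y) \<in> carrier ?M" "\<phi> (F y') \<in> carrier ?M" "k \<in> carrier ?M" "k' \<in> carrier ?M"
          using \<phi>c k K'(1) by auto
        have "emb (\<lambda>w. y w \<oplus> y' w) = (\<phi> (F y) \<oplus>\<^bsub>?M\<^esub> k) \<oplus>\<^bsub>?M\<^esub> (\<phi> (F y') \<oplus>\<^bsub>?M\<^esub> k')"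
          using emb_add[OF y] k by simp
        also have "\<dots> = (\<phi> (F y) \<oplus>\<^bsub>?M\<^esub> \<phi> (F y')) \<oplus>\<^bsub>?M\<^esub> (k \<oplus>\<^bsub>?M\<^esub> k')" using c by algebra
        finally show "emb (\<lambda>w. y w \<oplus> y' w) = \<phi> (F y \<oplus> F y') \<oplus>\<^bsub>?M\<^esub> (k \<oplus>\<^bsub>?M\<^esub> k')"
          using \<phi>_add[OF k(2,5)] by simp
      qed
    qed
    show "F (\<lambda>w. r \<otimes> y w) = r \<otimes> F y" if y: "y \<in> W \<rightarrow> carrier R" "r \<in> carrier R" for y r
    proof -
      from F_ex[OF y(1)] obtain k where k: "k \<in> K" "F y \<in> ?A" "emb y = \<phi> (F y) \<oplus>\<^bsub>?M\<^esub> k" by blast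
      show ?thesis
      proof (rule F_eq)
        show "(\<lambda>w. r \<otimes> y w) \<in> W \<rightarrow> carrier R" using y by (auto simp: Pi_iff)
        show "r \<otimes> F y \<in> ?A" "r \<odot>\<^bsub>?M\<^esub> k \<in> K" using k K'(6) y A.I_l_closed by auto
        show "emb (\<lambda>w. r \<otimes> y w) = \<phi> (r \<otimes> F y) \<oplus>\<^bsub>?M\<^esub> r \<odot>\<^bsub>?M\<^esub> k"
          using emb_smult[OF y] k \<phi>_smult[OF k(2) y(2)] \<phi>c[OF k(2)] K'(1) y(2) by (simp add: M.smult_r_distr)
      qed
    qed
  qed
  show ?thesis using ret by blast
qed

text \<open>With respect to a well-order of the whole type, the elements not dividing any earlier one are cofinal, and on
  them the given order agrees with strict divisibility.\<close>

lemma well_ordered_cofinal: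
  assumes W0: "W0 \<subseteq> carrier R"
  obtains W where "W \<subseteq> W0" "wf {(v, w). v \<in> W \<and> w \<in> W \<and> \<not> w divides v}"
    "\<And>a. a \<in> W0 \<Longrightarrow> \<exists>w\<in>W. a divides w"
proof -
  obtain r :: "'a rel" where r: "well_order_on UNIV r" using well_order_on by blast
  then have wf: "wf (r - Id)" by (simp add: well_order_on_def)
  have tot: "(v, w) \<in> r - Id \<or> (w, v) \<in> r - Id" if "v \<noteq> w" for v w
    using r that by (auto simp: well_order_on_def linear_order_on_def total_on_def)
  define W where "W = {w \<in> W0. \<forall>v\<in>W0. (v, w) \<in> r - Id \<longrightarrow> \<not> w divides v}"
  show thesis
  proof (rule that[of W])
    show "W \<subseteq> W0" by (auto simp: W_def)
    have ord: "(v, w) \<in> r - Id" if vw: "v \<in> W" "w \<in> W" "\<not> w divides v" for v w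
    proof (rule ccontr)
      assume "(v, w) \<notin> r - Id"
      moreover have "v \<noteq> w" using vw W0 divides_refl' by (auto simp: W_def)
      ultimately have "(w, v) \<in> r - Id" using tot by blast
      then have "\<not> v divides w" using vw(1,2) unfolding W_def by blast
      moreover have "v \<in> carrier R" "w \<in> carrier R" using vw W0 by (auto simp: W_def)
      ultimately show False using divides_total[of v w] vw(3) by blast
    qed
    have "{(v, w). v \<in> W \<and> w \<in> W \<and> \<not> w divides v} \<subseteq> r - Id"
    proof (rule subrelI)
      fix v w assume "(v, w) \<in> {(v, w). v \<in> W \<and> w \<in> W \<and> \<not> w divides v}"
      then show "(v, w) \<in> r - Id" by (intro ord) simp_all
    qed
    with wf show "wf {(v, w). v \<in> W \<and> w \<in> W \<and> \<not> w divides v}" by (rule wf_subset)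
    fix a assume a: "a \<in> W0"
    have "a \<in> {w \<in> W0. a divides w}" using a divides_refl' W0 by blast
    from wfE_min[OF wf this] obtain w where w: "w \<in> W0" "a divides w"
      and min: "\<And>v. (v, w) \<in> r - Id \<Longrightarrow> v \<notin> {w \<in> W0. a divides w}" by blast
    have "\<not> w divides v" if "v \<in> W0" "(v, w) \<in> r - Id" for v
      using min[OF that(2)] that(1) divides_trans'[OF w(2)] a W0 by blast
    with w show "\<exists>w\<in>W. a divides w" unfolding W_def by blast
  qed
qed

end

section \<open>Cofinal sequences in localizations\<close>

text \<open>The sequence consists of the denominators of generators of the localization. If \<open>s\<close> divided none of them, they
  would all divide \<open>s\<close>, so all fractions would have a representative with denominator \<open>s\<close>, in contrast to
  \<open>1 / (s e)\<close> for a nonunit \<open>e\<close>.\<close>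

lemma (in primeideal) localization_cofinal_sequence:
  assumes vd: "valuation_dom R" and cg: "countably_generated_module R (localization R I)"
    and e: "e \<in> carrier R - I" "e \<notin> Units R"
  obtains t :: "nat \<Rightarrow> 'a" where "\<And>n. t n \<in> carrier R - I"
    "\<And>s. s \<in> carrier R - I \<Longrightarrow> \<exists>n. s divides t n"
proof -
  interpret valuation_dom R by (rule vd)
  let ?V = "localization R I"
  interpret V: module R ?V using cg by (simp add: countably_generated_module_def)
  from cg obtain S where S: "countable S" "S \<subseteq> carrier ?V" "(\<lambda>N. submodule N R ?V) hull S = carrier ?V"
    by (auto simp: countably_generated_module_def)
  have "\<forall>X\<in>S. \<exists>a s. a \<in> carrier R \<and> s \<in> carrier R - I \<and> X = fraction R I a s"
    using S(2) by (auto simp: carrier_localization)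
  then obtain num den where fr: "\<And>X. X \<in> S \<Longrightarrow> num X \<in> carrier R" "\<And>X. X \<in> S \<Longrightarrow> den X \<in> carrier R - I"
    "\<And>X. X \<in> S \<Longrightarrow> X = fraction R I (num X) (den X)" by metis
  have cof: "\<exists>X\<in>S. s divides den X" if s: "s \<in> carrier R - I" for s
  proof (rule ccontr)
    assume none: "\<not> ?thesis"
    let ?N = "{fraction R I x s |x. x \<in> carrier R}"
    have "submodule ?N R ?V"
    proof (rule V.submoduleI')
      show "?N \<subseteq> carrier ?V" using fraction_closed s by blast
      have "\<zero>\<^bsub>?V\<^esub> = fraction R I \<zero> s"
        unfolding zero_localization using s comp_one by (intro fraction_eqI1) auto
      then show "\<zero>\<^bsub>?V\<^esub> \<in> ?N" by blast
      fix a b assume "a \<in> ?N" "b \<in> ?N"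
      then obtain x y where x: "x \<in> carrier R" "a = fraction R I x s" "y \<in> carrier R" "b = fraction R I y s" by blast
      have "a \<oplus>\<^bsub>?V\<^esub> b = fraction R I (x \<otimes> s \<oplus> y \<otimes> s) (s \<otimes> s)"
        using add_localization[OF x(1) s x(3) s] x by simp
      also have "\<dots> = fraction R I (x \<oplus> y) s"
      proof (rule fraction_eqI1)
        have sc: "s \<in> carrier R" using s by simp
        show "(x \<otimes> s \<oplus> y \<otimes> s) \<otimes> s = (x \<oplus> y) \<otimes> (s \<otimes> s)" using x(1,3) sc by algebra
      qed (use x s comp_mult in auto)
      finally show "a \<oplus>\<^bsub>?V\<^esub> b \<in> ?N" using x by blast
    next
      fix r a assume "r \<in> carrier R" "a \<in> ?N"
      then obtain x where x: "r \<in> carrier R" "x \<in> carrier R" "a = fraction R I x s" by blast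
      then show "r \<odot>\<^bsub>?V\<^esub> a \<in> ?N" using smult_localization[OF x(1,2) s] by auto
    qed
    moreover have "S \<subseteq> ?N"
    proof
      fix X assume X: "X \<in> S"
      have "\<not> s divides den X" using none X by blast
      then obtain r where r: "r \<in> carrier R" "s = den X \<otimes> r"
        using divides_total[of s "den X"] s fr(2)[OF X] by (auto simp: factor_def)
      have "X = fraction R I (num X \<otimes> r) s"
        by (subst fr(3)[OF X], rule fraction_eqI1) (use fr[OF X] r s in \<open>auto simp: m_ac\<close>)
      then show "X \<in> ?N" using fr(1)[OF X] r(1) by blast
    qed
    ultimately have "carrier ?V \<subseteq> ?N" using hull_minimal[of S ?N "\<lambda>N. submodule N R ?V"] S(3) by simp
    moreover have se: "s \<otimes> e \<in> carrier R - I" using comp_mult s e by blast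
    ultimately have "fraction R I \<one> (s \<otimes> e) \<in> ?N" using fraction_closed[of \<one> "s \<otimes> e"] by blast
    then obtain x where x: "x \<in> carrier R" "fraction R I \<one> (s \<otimes> e) = fraction R I x s" by blast
    then obtain v where v: "v \<in> carrier R - I" "v \<otimes> (\<one> \<otimes> s) = v \<otimes> (x \<otimes> (s \<otimes> e))"
      using fraction_eq_iff[OF one_closed se x(1) s] by blast
    have nz: "v \<noteq> \<zero>" "s \<noteq> \<zero>" using v s a_subgroup additive_subgroup.zero_closed[OF is_additive_subgroup] by auto
    have "s \<otimes> \<one> = s \<otimes> (e \<otimes> x)"
      using v m_lcancel[of v "s" "x \<otimes> (s \<otimes> e)"] nz s e x(1) by (auto simp: m_ac)
    then have "\<one> = e \<otimes> x" using m_lcancel[of s \<one> "e \<otimes> x"] nz s e x(1) by auto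
    then show False using e x(1) m_comm[of e x] by (auto simp: Units_def)
  qed
  have "S \<noteq> {}" using cof[OF comp_one] by blast
  with S(1) obtain f :: "nat \<Rightarrow> ('a \<times> 'a) set" where f: "range f = S"
    by (metis range_from_nat_into)
  show thesis
  proof (rule that[of "\<lambda>n. den (f n)"])
    show "den (f n) \<in> carrier R - I" for n using fr(2) f by blast
    show "\<exists>n. s divides den (f n)" if "s \<in> carrier R - I" for s using cof[OF that] f by blast
  qed
qed

section \<open>Limits of coherent families\<close>

text \<open>A family of residues modulo the principal ideals that are not contained in an ideal \<open>A\<close> which comes from the
  localization at \<open>J\<close>; it represents a Cauchy net of a quotient of that localization.\<close>

locale coherent_family = valuation_dom_max +
  fixes A :: "'a set" and c :: "'a \<Rightarrow> 'a"
  assumes A_ideal: "ideal A R" and A_proper: "A \<noteq> carrier R"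
    and A_not_multiple: "\<lbrakk>b \<in> carrier R; b \<noteq> \<zero>\<rbrakk> \<Longrightarrow> A \<noteq> J #> b"
    and A_divisible: "\<lbrakk>s \<in> carrier R; s \<notin> J; a \<in> carrier R; s \<otimes> a \<in> A\<rbrakk> \<Longrightarrow> a \<in> A"
    and c_closed: "\<lbrakk>a \<in> carrier R; a \<notin> A\<rbrakk> \<Longrightarrow> c a \<in> carrier R"
    and c_coherent: "\<lbrakk>a \<in> carrier R; b \<in> carrier R; b \<notin> A; a divides b\<rbrakk> \<Longrightarrow> a divides (c b \<ominus> c a)"
begin

sublocale A: ideal A R by (rule A_ideal)

lemma one_notin_A: "\<one> \<notin> A"
  using A.one_imp_carrier A_proper by blast

lemma notin_A_nonzero: "w \<notin> A \<Longrightarrow> w \<noteq> \<zero>"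
  using A.zero_closed by blast

lemma notin_A_divides:
  assumes "w \<in> carrier R" "w \<notin> A" "a \<in> A" shows "w divides a"
  using divides_total[OF assms(1) A.Icarr[OF assms(3)]] ideal_divides[OF A_ideal assms(3), of w] assms(2) by blast

lemma limit_extend:
assumes that: "a \<in> carrier R" "w \<in> carrier R" "w \<notin> A" "a divides w" "l \<in> carrier R" "w divides (l \<ominus> c w)"
shows "a divides (l \<ominus> c a)"
proof -
  have aA: "a \<notin> A" using ideal_divides[OF A_ideal _ that(4)] that(3) by blast
  have "a divides ((l \<ominus> c w) \<oplus> (c w \<ominus> c a))"
    by (rule divides_add[OF that(1) divides_trans'[OF that(4,6,1)] c_coherent[OF that(1-4)]])
  moreover have "(l \<ominus> c w) \<oplus> (c w \<ominus> c a) = l \<ominus> c a"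
    using that(5) c_closed[OF that(2,3)] c_closed[OF that(1) aA] by algebra
  ultimately show ?thesis by simp
qed

text \<open>If \<open>r\<close> were a common multiple outside \<open>A\<close>, then \<open>A = r P\<close>. This is excluded if \<open>P = J\<close>; otherwise some element
  of \<open>P\<close> outside \<open>J\<close> can be cancelled.\<close>

lemma common_multiple_in_A:
  assumes rc: "r \<in> carrier R" and rd: "\<And>w. \<lbrakk>w \<in> carrier R; w \<notin> A\<rbrakk> \<Longrightarrow> w divides r"
  shows "r \<in> A"
proof (rule ccontr)
  assume rA: "r \<notin> A"
  have rP: "r \<otimes> p \<in> A" if p: "p \<in> P" for p
  proof (rule ccontr)
    assume "r \<otimes> p \<notin> A"
    from rd[OF _ this] rc P.Icarr[OF p] obtain d where d: "d \<in> carrier R" "r = r \<otimes> p \<otimes> d"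
      by (auto simp: factor_def)
    then have "r \<otimes> \<one> = r \<otimes> (p \<otimes> d)" using rc P.Icarr[OF p] by (simp add: m_assoc)
    then have "\<one> = p \<otimes> d" using m_lcancel[of r \<one> "p \<otimes> d"] notin_A_nonzero[OF rA] rc P.Icarr[OF p] d(1) by simp
    then have "\<one> \<in> P" using P.I_r_closed[OF p d(1)] by simp
    then show False using P.one_imp_carrier P.I_notcarr by blast
  qed
  show False
  proof (cases "J = P")
    case True
    have "A = J #> r"
    proof (intro equalityI subsetI)
      fix a assume a: "a \<in> A"
      from notin_A_divides[OF rc rA a] obtain t where t: "t \<in> carrier R" "a = r \<otimes> t" by (auto simp: factor_def)
      have "t \<in> P"
      proof (rule ccontr)
        assume "t \<notin> P"
        then have tu: "t \<in> Units R" using unitI t by blast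
        then have "r = a \<otimes> inv t" using t rc by (simp add: m_assoc)
        then show False using rA A.I_r_closed[OF a] tu by simp
      qed
      then show "a \<in> J #> r"
        using True t m_comm[OF rc t(1)] unfolding r_coset_def by auto
    next
      fix a assume "a \<in> J #> r"
      then obtain p where "p \<in> P" "a = p \<otimes> r" using True by (auto simp: r_coset_def)
      then show "a \<in> A" using rP[of p] rc P.Icarr[of p] by (simp add: m_comm)
    qed
    with A_not_multiple[OF rc notin_A_nonzero[OF rA]] show False by blast
  next
    case False
    then obtain p where p: "p \<in> P" "p \<notin> J" using J_subset_P by blast
    have "p \<otimes> r \<in> A" using rP[OF p(1)] rc P.Icarr[OF p(1)] by (simp add: m_comm)
    with A_divisible[OF P.Icarr[OF p(1)] p(2) rc] rA show False by blast
  qed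
qed

text \<open>Some multiple of \<open>A\<close> by an element of the field of fractions fits between \<open>w' R\<close> and \<open>w R\<close>, so that
  congruences modulo \<open>w\<close> can be read modulo multiples of \<open>A\<close>.\<close>

definition interpolated :: "'a \<Rightarrow> 'a \<Rightarrow> bool" where
  "interpolated w w' \<longleftrightarrow> w divides w' \<and> (\<exists>\<alpha>\<in>A. \<alpha> \<noteq> \<zero> \<and> (\<forall>a\<in>A. (\<alpha> \<otimes> w) divides (w' \<otimes> a)))"

text \<open>Choose \<open>W\<close> cofinal outside \<open>A\<close> and multiply \<open>c\<close> by an element \<open>a0\<close> of \<open>A\<close> to get a chain in \<open>A\<close>. Replacing \<open>c w\<close> by
  \<open>c (n w)\<close>, where a multiple of \<open>A\<close> fits between \<open>n w R\<close> and \<open>w R\<close>, makes the moduli multiples of \<open>A\<close> without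
  losing the congruences modulo \<open>w\<close>. The limit is divisible by \<open>a0\<close>.\<close>

lemma limit_if_interpolated:
  fixes \<Lambda> :: "'i set"
  assumes sep: "separable R (power_module R \<Lambda>)"
    and W0: "W0 \<subseteq> carrier R - A" "\<And>a. a \<in> carrier R - A \<Longrightarrow> \<exists>w\<in>W0. a divides w"
      "inj_on j W0" "j ` W0 \<subseteq> \<Lambda>"
    and interp: "\<And>w. w \<in> carrier R - A \<Longrightarrow> \<exists>w'\<in>carrier R - A. interpolated w w'"
  shows "\<exists>l\<in>carrier R. \<forall>a\<in>carrier R - A. a divides (l \<ominus> c a)"
proof -
  obtain w' where "interpolated \<one> w'" using interp one_notin_A one_closed by blast
  then obtain a0 where a0: "a0 \<in> A" "a0 \<noteq> \<zero>" unfolding interpolated_def by blast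
  obtain W where W: "W \<subseteq> W0" "wf {(v, w). v \<in> W \<and> w \<in> W \<and> \<not> w divides v}"
    "\<And>a. a \<in> W0 \<Longrightarrow> \<exists>w\<in>W. a divides w" using well_ordered_cofinal[of W0] W0(1) by blast
  have Wc: "w \<in> carrier R" "w \<notin> A" if "w \<in> W" for w using that W(1) W0(1) by auto
  have Wcof: "\<exists>w\<in>W. a divides w" if a: "a \<in> carrier R - A" for a
  proof -
    from W0(2)[OF a] obtain w0 where "w0 \<in> W0" "a divides w0" by blast
    moreover from W(3)[OF this(1)] obtain w where "w \<in> W" "w0 divides w" by blast
    ultimately show ?thesis using divides_trans'[of a w0 w] a by blast
  qed
  have AW: "common_multiples W = A"
  proof (intro equalityI subsetI)
    fix r assume "r \<in> A"
    then show "r \<in> common_multiples W" using notin_A_divides Wc A.Icarr unfolding common_multiples_def by blast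
  next
    fix r assume r: "r \<in> common_multiples W"
    show "r \<in> A"
    proof (rule common_multiple_in_A)
      show "r \<in> carrier R" using r by (simp add: common_multiples_def)
      fix w assume w: "w \<in> carrier R" "w \<notin> A"
      with Wcof[of w] obtain v where "v \<in> W" "w divides v" by blast
      with r divides_trans'[of w v r] w show "w divides r" unfolding common_multiples_def by blast
    qed
  qed
  have "W \<noteq> {}" using Wcof[of \<one>] one_notin_A by blast
  moreover have "inj_on j W" "j ` W \<subseteq> \<Lambda>" "W \<subseteq> carrier R" "W \<inter> common_multiples W = {}"
    using W0 W(1) AW inj_on_subset by (blast+)
  ultimately obtain F where F: "retraction R P J W F"
    using retraction_of_separable[OF sep, of j W] by blast
  interpret F: retraction R P J W F by (rule F)
  \<comment> \<open>The least choice of \<open>n w\<close> makes \<open>n\<close> monotone.\<close>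
  have "\<exists>v\<in>W. interpolated w v \<and> (\<forall>v'\<in>W. \<not> v divides v' \<longrightarrow> \<not> interpolated w v')" if w: "w \<in> W" for w
  proof -
    from interp Wc[OF w] obtain w' where w': "w' \<in> carrier R" "w' \<notin> A" "interpolated w w'" by blast
    from Wcof[of w'] w' obtain v where v: "v \<in> W" "w' divides v" by blast
    from w'(3) obtain \<alpha> where \<alpha>: "\<alpha> \<in> A" "\<alpha> \<noteq> \<zero>" "\<And>a. a \<in> A \<Longrightarrow> (\<alpha> \<otimes> w) divides (w' \<otimes> a)"
      by (auto simp: interpolated_def)
    have "(\<alpha> \<otimes> w) divides (v \<otimes> a)" if a: "a \<in> A" for a
    proof (rule divides_trans'[OF \<alpha>(3)[OF a]])
      show "(w' \<otimes> a) divides (v \<otimes> a)"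
        using divides_mult_left[OF A.Icarr[OF a] w'(1) v(2)] m_comm[OF A.Icarr[OF a]] w'(1) Wc(1)[OF v(1)] by simp
      show "\<alpha> \<otimes> w \<in> carrier R" using A.Icarr[OF \<alpha>(1)] Wc[OF w] by simp
    qed
    moreover have "w divides v"
      using w'(3) divides_trans'[OF _ v(2), of w] Wc(1)[OF w] by (auto simp: interpolated_def)
    ultimately have "v \<in> {v \<in> W. interpolated w v}" using v(1) \<alpha>(1,2) by (auto simp: interpolated_def)
    from wfE_min[OF W(2) this] obtain z where "z \<in> W" "interpolated w z"
      "\<And>y. (y, z) \<in> {(v, w). v \<in> W \<and> w \<in> W \<and> \<not> w divides v} \<Longrightarrow> y \<notin> {v \<in> W. interpolated w v}" by blast
    then show ?thesis by blast
  qed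
  then obtain n where n: "\<And>w. w \<in> W \<Longrightarrow> n w \<in> W" "\<And>w. w \<in> W \<Longrightarrow> interpolated w (n w)"
    "\<And>w v. \<lbrakk>w \<in> W; v \<in> W; interpolated w v\<rbrakk> \<Longrightarrow> n w divides v" by metis
  then obtain \<alpha> where \<alpha>: "\<And>w. w \<in> W \<Longrightarrow> \<alpha> w \<in> A" "\<And>w. w \<in> W \<Longrightarrow> \<alpha> w \<noteq> \<zero>"
    "\<And>w a. \<lbrakk>w \<in> W; a \<in> A\<rbrakk> \<Longrightarrow> (\<alpha> w \<otimes> w) divides (n w \<otimes> a)"
    unfolding interpolated_def by metis
  have n_mono: "n m divides n l" if "m \<in> W" "l \<in> W" "m divides l" for m l
  proof (rule n(3)[OF that(1) n(1)[OF that(2)]])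
    have c': "\<alpha> l \<in> carrier R" "m \<in> carrier R" "l \<in> carrier R" using \<alpha>(1) that Wc A.Icarr by auto
    have "(\<alpha> l \<otimes> m) divides (n l \<otimes> a)" if a: "a \<in> A" for a
      using divides_trans'[OF divides_mult_left[OF c'(1,2) \<open>m divides l\<close>] \<alpha>(3)[OF \<open>l \<in> W\<close> a]] c' by simp
    moreover have "m divides n l"
      using n(2)[OF that(2)] divides_trans'[OF that(3), of "n l"] c' by (auto simp: interpolated_def)
    ultimately show "interpolated m (n l)" using \<alpha>[OF that(2)] by (auto simp: interpolated_def)
  qed
  note Ac = A.Icarr
  have nc: "n w \<in> carrier R" "c (n w) \<in> carrier R" if "w \<in> W" for w using n(1)[OF that] Wc c_closed by auto
  define C where "C w = a0 \<otimes> c (n w)" for w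
  have "\<exists>\<beta>\<in>F.A. \<forall>m\<in>W. \<exists>a\<in>F.A. \<alpha> m \<otimes> (\<beta> \<ominus> C m) = (a0 \<otimes> n m) \<otimes> a"
  proof (rule F.scaled_chain_limit[OF W(2)])
    show "C \<in> W \<rightarrow> F.A" using nc A.I_r_closed[OF a0(1)] by (auto simp: C_def AW)
    fix m assume m: "m \<in> W"
    note mc = Ac[OF \<alpha>(1)[OF m]] nc[OF m] Ac[OF a0(1)]
    show "a0 \<otimes> n m \<in> carrier R" "\<alpha> m \<in> carrier R" using mc by auto
    fix l assume l: "l \<in> W" "m divides l"
    have "n m divides (c (n l) \<ominus> c (n m))"
      using c_coherent[OF nc(1)[OF m] nc(1)[OF l(1)]] Wc(2)[OF n(1)[OF l(1)]] n_mono[OF m l] by blast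
    then obtain d where d: "d \<in> carrier R" "c (n l) \<ominus> c (n m) = n m \<otimes> d" by (auto simp: factor_def)
    have CC: "C l \<ominus> C m = a0 \<otimes> (n m \<otimes> d)"
      unfolding C_def d(2)[symmetric] using mc nc[OF l(1)] by algebra
    have "\<alpha> m \<otimes> (C l \<ominus> C m) = (a0 \<otimes> n m) \<otimes> (\<alpha> m \<otimes> d)" unfolding CC using mc d(1) by algebra
    then show "\<exists>a\<in>F.A. \<alpha> m \<otimes> (C l \<ominus> C m) = (a0 \<otimes> n m) \<otimes> a"
      unfolding AW using A.I_r_closed[OF \<alpha>(1)[OF m] d(1)] by blast
  qed
  then obtain \<beta> where \<beta>: "\<beta> \<in> A" "\<And>m. m \<in> W \<Longrightarrow> \<exists>a\<in>A. \<alpha> m \<otimes> (\<beta> \<ominus> C m) = (a0 \<otimes> n m) \<otimes> a"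
    unfolding AW by blast
  have lim: "\<exists>e\<in>carrier R. \<beta> = a0 \<otimes> (c (n w) \<oplus> w \<otimes> e)" if w: "w \<in> W" for w
  proof -
    note wc = Ac[OF \<alpha>(1)[OF w]] nc[OF w] Ac[OF a0(1)] Ac[OF \<beta>(1)] Wc(1)[OF w]
    from \<beta>(2)[OF w] obtain a where a: "a \<in> A" "\<alpha> w \<otimes> (\<beta> \<ominus> C w) = (a0 \<otimes> n w) \<otimes> a" by blast
    from \<alpha>(3)[OF w a(1)] obtain e where e: "e \<in> carrier R" "n w \<otimes> a = \<alpha> w \<otimes> w \<otimes> e" by (auto simp: factor_def)
    have Cc: "C w \<in> carrier R" using wc by (simp add: C_def)
    have "\<alpha> w \<otimes> (\<beta> \<ominus> C w) = a0 \<otimes> (n w \<otimes> a)" using wc a Ac[OF a(1)] by (simp add: m_assoc)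
    also have "\<dots> = \<alpha> w \<otimes> (a0 \<otimes> (w \<otimes> e))" unfolding e(2) using wc e(1) by algebra
    finally have "\<beta> \<ominus> C w = a0 \<otimes> (w \<otimes> e)"
      using m_lcancel[of "\<alpha> w" "\<beta> \<ominus> C w" "a0 \<otimes> (w \<otimes> e)"] \<alpha>(2)[OF w] wc Cc e(1) by simp
    moreover have "\<beta> = (\<beta> \<ominus> C w) \<oplus> C w" using wc Cc by algebra
    ultimately have "\<beta> = a0 \<otimes> (w \<otimes> e) \<oplus> a0 \<otimes> c (n w)" by (simp add: C_def)
    also have "\<dots> = a0 \<otimes> (c (n w) \<oplus> w \<otimes> e)" using wc e(1) by algebra
    finally show ?thesis using e(1) by blast
  qed
  obtain w1 where w1: "w1 \<in> W" using \<open>W \<noteq> {}\<close> by blast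
  from lim[OF w1] obtain e1 where e1: "e1 \<in> carrier R" "\<beta> = a0 \<otimes> (c (n w1) \<oplus> w1 \<otimes> e1)" by blast
  define l where "l = c (n w1) \<oplus> w1 \<otimes> e1"
  have l: "l \<in> carrier R" "\<beta> = a0 \<otimes> l"
    using e1 nc(2)[OF w1] Wc(1)[OF w1] by (auto simp: l_def)
  have "w divides (l \<ominus> c w)" if w: "w \<in> W" for w
  proof -
    note wc = nc[OF w] Ac[OF a0(1)] Wc(1)[OF w] c_closed[OF Wc[OF w]]
    from lim[OF w] obtain e where e: "e \<in> carrier R" "\<beta> = a0 \<otimes> (c (n w) \<oplus> w \<otimes> e)" by blast
    then have leq: "l = c (n w) \<oplus> w \<otimes> e"
      using m_lcancel[of a0 l "c (n w) \<oplus> w \<otimes> e"] l a0(2) wc by simp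
    have "w divides n w" using n(2)[OF w] by (simp add: interpolated_def)
    from c_coherent[OF wc(4) nc(1)[OF w] Wc(2)[OF n(1)[OF w]] this]
    have "w divides ((w \<otimes> e) \<oplus> (c (n w) \<ominus> c w))"
      using e(1) wc(4) by (intro divides_add) auto
    moreover have "(w \<otimes> e) \<oplus> (c (n w) \<ominus> c w) = l \<ominus> c w" unfolding leq using wc e(1) by algebra
    ultimately show ?thesis by simp
  qed
  with limit_extend Wcof Wc l(1) show ?thesis by (metis Diff_iff)
qed

text \<open>If no multiple of \<open>A\<close> fits below \<open>w R\<close> in this sense, each \<open>t\<close> with \<open>w t\<close> outside \<open>A\<close> satisfies \<open>t A = A\<close>, and the remaining \<open>t\<close> form a prime ideal.\<close>

lemma prime_if_not_interpolated:
  assumes w: "w \<in> carrier R" "w \<notin> A" "\<And>w'. \<lbrakk>w' \<in> carrier R; w' \<notin> A\<rbrakk> \<Longrightarrow> \<not> interpolated w w'"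
  shows "primeideal {t \<in> carrier R. w \<otimes> t \<in> A} R"
proof -
  define L where "L = {t \<in> carrier R. w \<otimes> t \<in> A}"
  have tA: "\<exists>a\<in>A. \<alpha> = t \<otimes> a" if t: "t \<in> carrier R" "t \<notin> L" and \<alpha>: "\<alpha> \<in> A" for t \<alpha>
  proof (cases "\<alpha> = \<zero>")
    case True
    then show ?thesis using A.zero_closed t by (intro bexI[of _ \<zero>]) auto
  next
    case False
    have wt: "w \<otimes> t \<in> carrier R" "w \<otimes> t \<notin> A" "w divides (w \<otimes> t)" using t w by (auto simp: L_def factor_def)
    with w(3)[OF wt(1,2)] \<alpha> False obtain a where a: "a \<in> A" "\<not> (\<alpha> \<otimes> w) divides (w \<otimes> t \<otimes> a)"
      unfolding interpolated_def by blast
    note cc = A.Icarr[OF \<alpha>] A.Icarr[OF a(1)] t(1) w(1)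
    have "\<not> \<alpha> divides (t \<otimes> a)"
    proof
      assume "\<alpha> divides (t \<otimes> a)"
      from divides_mult_left[OF w(1) cc(1) this] a(2) show False using cc by (simp add: m_ac)
    qed
    with divides_total[of \<alpha> "t \<otimes> a"] cc have "(t \<otimes> a) divides \<alpha>" by simp
    then obtain d where "d \<in> carrier R" "\<alpha> = t \<otimes> (a \<otimes> d)" using cc by (auto simp: factor_def m_assoc)
    with A.I_r_closed[OF a(1)] show ?thesis by blast
  qed
  have Lideal: "ideal L R"
  proof (rule idealI')
    fix x r assume "x \<in> L" "r \<in> carrier R"
    then have *: "x \<in> carrier R" "w \<otimes> x \<in> A" "r \<in> carrier R" by (auto simp: L_def)
    then have "w \<otimes> (r \<otimes> x) = r \<otimes> (w \<otimes> x)" using w(1) by (simp add: m_lcomm)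
    with * A.I_l_closed[OF *(2,3)] show "r \<otimes> x \<in> L" by (simp add: L_def)
    with * show "x \<otimes> r \<in> L" by (simp add: m_comm)
  qed (use w(1) A.zero_closed A.a_closed in \<open>auto simp: L_def r_distr\<close>)
  have oneL: "\<one> \<notin> L" using w by (simp add: L_def)
  have "primeideal L R"
  proof (rule primeidealI[OF Lideal is_cring])
    show "carrier R \<noteq> L" using oneL by blast
    fix t t' assume t: "t \<in> carrier R" "t' \<in> carrier R" "t \<otimes> t' \<in> L"
    show "t \<in> L \<or> t' \<in> L"
    proof (cases "t \<in> L")
      case False
      have "t \<noteq> \<zero>" using False A.zero_closed w(1) by (auto simp: L_def)
      have "w \<otimes> (t \<otimes> t') \<in> A" using t(3) by (simp add: L_def)
      from tA[OF t(1) False this] obtain a where a: "a \<in> A" "w \<otimes> (t \<otimes> t') = t \<otimes> a" by blast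
      then have "t \<otimes> (w \<otimes> t') = t \<otimes> a" using t w(1) by (simp add: m_lcomm)
      with m_lcancel[OF \<open>t \<noteq> \<zero>\<close> t(1), of "w \<otimes> t'" a] t(2) w(1) A.Icarr[OF a(1)] have "w \<otimes> t' = a" by simp
      with a(1) t(2) show ?thesis by (simp add: L_def)
    qed simp
  qed
  then show ?thesis by (simp add: L_def)
qed

text \<open>In this case \<open>A = w L\<close> with \<open>L\<close> properly contained in \<open>J\<close>, and there is a cofinal sequence \<open>a n\<close> outside \<open>A\<close>.
  Multiples of \<open>A\<close> need not fit between its members, so the vectors of quotients of \<open>A\<close> are replaced by those of the
  ideal \<open>B\<close> of common multiples of a chain of divisors \<open>d n\<close> of an element \<open>e \<in> B\<close> in \<open>J\<close> outside \<open>L\<close>. If \<open>e (a n)\<close>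
  divides \<open>a (n + 1)\<close>, then \<open>a (n + 1) B\<close> lies between \<open>e (a (n + 1)) R\<close> and \<open>e (a n) R\<close>, as the chain \<open>e (c (a (n + 1)))\<close>
  requires.\<close>

lemma limit_over_prime:
  fixes \<Lambda> :: "'i set"
  assumes sep: "separable R (power_module R \<Lambda>)"
    and countable: "\<And>W. \<lbrakk>countable W; W \<subseteq> carrier R\<rbrakk> \<Longrightarrow> \<exists>j. inj_on j W \<and> j ` W \<subseteq> \<Lambda>"
    and w: "w \<in> carrier R" "w \<notin> A" and L_def: "L = {t \<in> carrier R. w \<otimes> t \<in> A}"
    and Lprime: "primeideal L R" and cg: "countably_generated_module R (localization R L)"
  shows "\<exists>l\<in>carrier R. \<forall>a\<in>carrier R - A. a divides (l \<ominus> c a)"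
proof -
  have Lideal: "ideal L R" by (rule primeideal.axioms(1)[OF Lprime])
  have "L \<subseteq> J"
  proof
    fix t assume t: "t \<in> L"
    show "t \<in> J"
    proof (rule ccontr)
      assume tJ: "t \<notin> J"
      have tw: "t \<in> carrier R" "w \<otimes> t \<in> A" using t unfolding L_def by blast+
      then have "t \<otimes> w \<in> A" using m_comm[OF w(1) tw(1)] by simp
      with A_divisible[OF tw(1) tJ w(1)] w(2) show False by blast
    qed
  qed
  moreover have "L \<noteq> J"
  proof
    assume LJ: "L = J"
    have "A = J #> w"
    proof (intro equalityI subsetI)
      fix a assume a: "a \<in> A"
      from notin_A_divides[OF w(1,2) a] obtain t where t: "t \<in> carrier R" "a = w \<otimes> t" by (auto simp: factor_def)
      with a have "t \<in> L" unfolding L_def by blast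
      then have "t \<in> J" using LJ by blast
      with t m_comm[OF w(1) t(1)] show "a \<in> J #> w" unfolding r_coset_def by auto
    next
      fix a assume "a \<in> J #> w"
      then obtain t where t: "t \<in> J" "a = t \<otimes> w" unfolding r_coset_def by blast
      then have "t \<in> carrier R" "w \<otimes> t \<in> A" using LJ unfolding L_def by blast+
      then show "a \<in> A" using t(2) m_comm[OF w(1)] by simp
    qed
    with A_not_multiple[OF w(1) notin_A_nonzero[OF w(2)]] show False by blast
  qed
  ultimately obtain e where e: "e \<in> J" "e \<notin> L" by blast
  have ec: "e \<in> carrier R" and e0: "e \<noteq> \<zero>" using e J.Icarr additive_subgroup.zero_closed[OF ideal.axioms(1)[OF Lideal]] by blast+
  obtain d where d: "\<And>n. d n \<in> carrier R" "\<And>n. d n divides e" "\<And>n. d n divides d (Suc n)"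
    "\<And>n. \<not> d (Suc n) divides d n" using divisor_chain[OF e(1) e0] by blast
  have d_mono: "d i divides d k" if "i \<le> k" for i k :: nat
    using that
  proof (induction k rule: dec_induct)
    case (step k)
    then show ?case using divides_trans'[OF _ d(3)[of k] d(1)] by blast
  qed (rule divides_refl'[OF d(1)])
  have d_strict: "d i divides d k \<Longrightarrow> i \<le> k" for i k :: nat
  proof (rule ccontr)
    assume "d i divides d k" "\<not> i \<le> k"
    then have "d (Suc k) divides d k"
      using divides_trans'[OF d_mono[of "Suc k" i] _ d(1)] by auto
    with d(4) show False by blast
  qed
  have d_inj: "inj d" using d_strict d_mono by (intro injI antisym) (metis order_refl)+
  define g where "g = inv_into UNIV d"
  have g: "g (d n) = n" for n using d_inj by (simp add: g_def)
  let ?D = "range d"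
  have D: "?D \<subseteq> carrier R" "countable ?D" using d(1) by auto
  obtain j where "inj_on j ?D" "j ` ?D \<subseteq> \<Lambda>" using countable[OF D(2,1)] by blast
  moreover have "?D \<inter> common_multiples ?D = {}" using d(4) by (auto simp: common_multiples_def)
  ultimately obtain F where F: "retraction R P J ?D F"
    using retraction_of_separable[OF sep _ _ D(1)] by blast
  interpret F: retraction R P J ?D F by (rule F)
  have wfD: "wf {(v, w). v \<in> ?D \<and> w \<in> ?D \<and> \<not> w divides v}"
  proof (rule wf_subset[OF wf_inv_image[OF wf_less_than, of g]])
    show "{(v, w). v \<in> ?D \<and> w \<in> ?D \<and> \<not> w divides v} \<subseteq> inv_image less_than g"
    proof (rule subrelI)
      fix v w assume "(v, w) \<in> {(v, w). v \<in> ?D \<and> w \<in> ?D \<and> \<not> w divides v}"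
      then obtain i k where "v = d i" "w = d k" "\<not> d k divides d i" by blast
      then show "(v, w) \<in> inv_image less_than g" using d_mono[of k i] by (auto simp: g not_le[symmetric])
    qed
  qed
  have eB: "e \<in> F.A" using ec d(2) unfolding common_multiples_def by blast
  have eU: "e \<notin> Units R" using nonunit e(1) J_subset_P by blast
  obtain \<tau> :: "nat \<Rightarrow> 'a" where \<tau>: "\<And>n. \<tau> n \<in> carrier R - L" "\<And>s. s \<in> carrier R - L \<Longrightarrow> \<exists>n. s divides \<tau> n"
    using primeideal.localization_cofinal_sequence[OF Lprime valuation_dom_axioms cg _ eU] ec e(2)
    by (metis DiffI)
  \<comment> \<open>The factor \<open>e\<close> ensures that \<open>e (a n)\<close> divides \<open>a (n + 1)\<close> for \<open>a n = w (t n)\<close>.\<close>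
  define t where "t = rec_nat (\<tau> 0) (\<lambda>n s. (e \<otimes> s) \<otimes> \<tau> (Suc n))"
  have t_Suc: "t (Suc n) = (e \<otimes> t n) \<otimes> \<tau> (Suc n)" and t_0: "t 0 = \<tau> 0" for n by (simp_all add: t_def)
  have t: "t n \<in> carrier R - L" for n
  proof (induction n)
    case (Suc n)
    have "e \<in> carrier R - L" using ec e(2) by blast
    then show ?case
      unfolding t_Suc using Suc \<tau>(1) by (intro primeideal.comp_mult[OF Lprime])
  qed (simp only: t_0 \<tau>(1))
  have \<tau>t: "\<tau> n divides t n" for n
  proof (cases n)
    case 0 then show ?thesis using \<tau>(1)[of 0] by (simp add: t_0 divides_refl')
  next
    case (Suc k)
    then show ?thesis using \<tau>(1)[of n] t[of k] ec divides_mult[of "\<tau> n" "\<tau> n" "e \<otimes> t k"]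
      by (simp add: t_Suc divides_refl')
  qed
  define a where "a n = w \<otimes> t n" for n
  have ac: "a n \<in> carrier R" "a n \<notin> A" "c (a n) \<in> carrier R" for n
  proof -
    have "t n \<in> carrier R" "w \<otimes> t n \<notin> A" using t[of n] unfolding L_def by blast+
    then show "a n \<in> carrier R" "a n \<notin> A" using w(1) by (simp_all add: a_def)
    then show "c (a n) \<in> carrier R" by (rule c_closed)
  qed
  have a_step: "(e \<otimes> a n) divides a (Suc n)" for n
  proof -
    have "a (Suc n) = (e \<otimes> a n) \<otimes> \<tau> (Suc n)"
      using w(1) ec t[of n] \<tau>(1)[of "Suc n"] by (simp add: a_def t_Suc m_ac)
    then show ?thesis using \<tau>(1)[of "Suc n"] by (auto simp: factor_def)
  qed
  have a_mono: "a i divides a k" if "i \<le> k" for i k :: nat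
    using that
  proof (induction k rule: dec_induct)
    case (step k)
    have "a k divides (e \<otimes> a k)" using ac(1)[of k] ec divides_mult[of "a k" "a k" e] divides_refl' by blast
    then have "a k divides a (Suc k)" using a_step[of k] divides_trans' ac(1) by blast
    then show ?case using step divides_trans'[OF _ _ ac(1)] by blast
  qed (rule divides_refl'[OF ac(1)])
  define C where "C v = e \<otimes> c (a (Suc (g v)))" for v
  have "\<exists>\<beta>\<in>F.A. \<forall>m\<in>?D. \<exists>b\<in>F.A. \<one> \<otimes> (\<beta> \<ominus> C m) = a (Suc (g m)) \<otimes> b"
  proof (rule F.scaled_chain_limit[OF wfD])
    show "C \<in> ?D \<rightarrow> F.A" using F.A.I_r_closed[OF eB] ac by (auto simp: C_def)
    fix m assume m: "m \<in> ?D"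
    show "a (Suc (g m)) \<in> carrier R" "\<one> \<in> carrier R" using ac by auto
    fix l assume l: "l \<in> ?D" "m divides l"
    then have "g m \<le> g l" using m d_strict by (auto simp: g)
    then have "a (Suc (g m)) divides a (Suc (g l))" by (intro a_mono) simp
    then have "a (Suc (g m)) divides (c (a (Suc (g l))) \<ominus> c (a (Suc (g m))))"
      using c_coherent ac by blast
    then obtain q where q: "q \<in> carrier R" "c (a (Suc (g l))) \<ominus> c (a (Suc (g m))) = a (Suc (g m)) \<otimes> q"
      by (auto simp: factor_def)
    have "\<one> \<otimes> (C l \<ominus> C m) = e \<otimes> (c (a (Suc (g l))) \<ominus> c (a (Suc (g m))))"
      unfolding C_def using ac(3)[of "Suc (g l)"] ac(3)[of "Suc (g m)"] ec by algebra
    also have "\<dots> = a (Suc (g m)) \<otimes> (e \<otimes> q)" unfolding q(2) using ac(1)[of "Suc (g m)"] ec q(1) by algebra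
    finally show "\<exists>b\<in>F.A. \<one> \<otimes> (C l \<ominus> C m) = a (Suc (g m)) \<otimes> b" using F.A.I_r_closed[OF eB q(1)] by blast
  qed
  then obtain \<beta> where \<beta>: "\<beta> \<in> F.A" "\<And>n. \<exists>b\<in>F.A. \<one> \<otimes> (\<beta> \<ominus> C (d n)) = a (Suc n) \<otimes> b"
    using g by auto
  have lim: "\<exists>q\<in>carrier R. \<beta> = e \<otimes> (c (a (Suc n)) \<oplus> a n \<otimes> q)" for n
  proof -
    from \<beta>(2)[of n] obtain b where b: "b \<in> F.A" "\<one> \<otimes> (\<beta> \<ominus> C (d n)) = a (Suc n) \<otimes> b" by blast
    from a_step[of n] obtain x where x: "x \<in> carrier R" "a (Suc n) = e \<otimes> a n \<otimes> x" by (auto simp: factor_def)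
    have cc: "\<beta> \<in> carrier R" "b \<in> carrier R" "C (d n) \<in> carrier R"
      using \<beta>(1) b(1) F.A.Icarr ec ac by (auto simp: C_def)
    have "\<beta> = (\<beta> \<ominus> C (d n)) \<oplus> C (d n)" using cc by algebra
    also have "\<dots> = e \<otimes> a n \<otimes> x \<otimes> b \<oplus> e \<otimes> c (a (Suc n))" using b(2) cc by (simp add: C_def g x(2))
    also have "\<dots> = e \<otimes> (c (a (Suc n)) \<oplus> a n \<otimes> (x \<otimes> b))"
      using cc x(1) ac(1)[of n] ac(3)[of "Suc n"] ec by algebra
    finally show ?thesis using x(1) cc(2) by blast
  qed
  from lim[of 0] obtain q0 where q0: "q0 \<in> carrier R" "\<beta> = e \<otimes> (c (a (Suc 0)) \<oplus> a 0 \<otimes> q0)" by blast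
  define l where "l = c (a (Suc 0)) \<oplus> a 0 \<otimes> q0"
  have l: "l \<in> carrier R" "\<beta> = e \<otimes> l" using q0 ac(1)[of 0] ac(3)[of "Suc 0"] by (auto simp: l_def)
  have al: "a n divides (l \<ominus> c (a n))" for n
  proof -
    from lim[of n] obtain q where q: "q \<in> carrier R" "\<beta> = e \<otimes> (c (a (Suc n)) \<oplus> a n \<otimes> q)" by blast
    then have leq: "l = c (a (Suc n)) \<oplus> a n \<otimes> q"
      using m_lcancel[of e l "c (a (Suc n)) \<oplus> a n \<otimes> q"] l e0 ec ac by simp
    have "a n divides ((a n \<otimes> q) \<oplus> (c (a (Suc n)) \<ominus> c (a n)))"
      using q(1) c_coherent[OF ac(1,1,2) a_mono, of n "Suc n"] ac(1)[of n] by (intro divides_add) auto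
    moreover have "(a n \<otimes> q) \<oplus> (c (a (Suc n)) \<ominus> c (a n)) = l \<ominus> c (a n)"
      unfolding leq using ac(1)[of n] ac(3)[of n] ac(3)[of "Suc n"] q(1) by algebra
    ultimately show ?thesis by simp
  qed
  have "\<exists>n. x divides a n" if x: "x \<in> carrier R" "x \<notin> A" for x
  proof (cases "x divides w")
    case True
    have "w divides a 0" using t[of 0] by (auto simp: a_def factor_def)
    with True show ?thesis using divides_trans'[OF _ _ x(1)] by blast
  next
    case False
    with divides_total[OF x(1) w(1)] obtain s where s: "s \<in> carrier R" "x = w \<otimes> s" by (auto simp: factor_def)
    with x(2) have "s \<in> carrier R - L" by (simp add: L_def)
    from \<tau>(2)[OF this] obtain n where "s divides \<tau> n" by blast
    then have "s divides t n" using divides_trans'[OF _ \<tau>t s(1)] by blast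
    then show ?thesis using divides_mult_left[OF w(1) s(1)] s(2) by (auto simp: a_def)
  qed
  with limit_extend al ac l(1) show ?thesis by (metis Diff_iff)
qed

text \<open>The assumptions \<open>cofinal\<close> and \<open>countable\<close> say that \<open>\<Lambda>\<close> is large enough to index the well-ordered sets in both cases.\<close>

theorem limit_exists:
  fixes \<Lambda> :: "'i set"
  assumes cg: "\<And>L. primeideal L R \<Longrightarrow> countably_generated_module R (localization R L)"
    and sep: "separable R (power_module R \<Lambda>)"
    and cofinal: "\<And>A. \<lbrakk>ideal A R; A \<noteq> {\<zero>}; A \<noteq> carrier R\<rbrakk> \<Longrightarrow>
      \<exists>W\<subseteq>carrier R - A. (\<forall>a\<in>carrier R - A. \<exists>w\<in>W. a divides w) \<and> (\<exists>j. inj_on j W \<and> j ` W \<subseteq> \<Lambda>)"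
    and countable: "\<And>W. \<lbrakk>countable W; W \<subseteq> carrier R\<rbrakk> \<Longrightarrow> \<exists>j. inj_on j W \<and> j ` W \<subseteq> \<Lambda>"
  shows "\<exists>l\<in>carrier R. \<forall>a\<in>carrier R - A. a divides (l \<ominus> c a)"
proof (cases "\<forall>w\<in>carrier R - A. \<exists>w'\<in>carrier R - A. interpolated w w'")
  case True
  then obtain w' where "interpolated \<one> w'" using one_notin_A one_closed by blast
  then have "A \<noteq> {\<zero>}" unfolding interpolated_def by blast
  from cofinal[OF A_ideal this A_proper] obtain W j where W: "W \<subseteq> carrier R - A"
    "\<And>a. a \<in> carrier R - A \<Longrightarrow> \<exists>w\<in>W. a divides w" "inj_on j W" "j ` W \<subseteq> \<Lambda>" by metis
  with True limit_if_interpolated[OF sep W] show ?thesis by blast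
next
  case False
  then obtain w where w: "w \<in> carrier R" "w \<notin> A" "\<And>w'. \<lbrakk>w' \<in> carrier R; w' \<notin> A\<rbrakk> \<Longrightarrow> \<not> interpolated w w'" by blast
  note L = prime_if_not_interpolated[OF this]
  show ?thesis by (rule limit_over_prime[OF sep countable w(1,2) refl L cg[OF L]])
qed

end

section \<open>Maximality from limits\<close>

lemma (in cring) r_coset_ideal:
  assumes "ideal I R" "a \<in> carrier R" shows "ideal (I #> a) R"
proof -
  interpret I: ideal I R by fact
  have iff: "x \<in> I #> a \<longleftrightarrow> (\<exists>i\<in>I. x = i \<otimes> a)" for x by (auto simp: r_coset_def)
  show ?thesis
  proof (rule idealI')
    show "I #> a \<subseteq> carrier R" using assms(2) I.Icarr by (auto simp: iff)
    show "\<zero> \<in> I #> a" using assms(2) I.zero_closed by (auto simp: iff intro!: bexI[of _ \<zero>])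
    fix x y assume "x \<in> I #> a" "y \<in> I #> a"
    then obtain i i' where "i \<in> I" "x = i \<otimes> a" "i' \<in> I" "y = i' \<otimes> a" by (auto simp: iff)
    then show "x \<oplus> y \<in> I #> a"
      unfolding iff using assms(2) by (intro bexI[of _ "i \<oplus> i'"]) (auto simp: l_distr I.Icarr)
  next
    fix x r assume "x \<in> I #> a" and r: "r \<in> carrier R"
    then obtain i where i: "i \<in> I" "x = i \<otimes> a" by (auto simp: iff)
    note ic = I.Icarr[OF i(1)]
    show "r \<otimes> x \<in> I #> a" unfolding iff
      using i r assms(2) ic I.I_l_closed[OF i(1) r] by (intro bexI[of _ "r \<otimes> i"]) (auto simp: m_assoc)
    then show "x \<otimes> r \<in> I #> a" using i r assms(2) ic m_comm[of x r] by simp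
  qed
qed

context valuation_dom_max
begin

interpretation JP: primeideal J R by (rule J_prime)

interpretation V: cring V by (rule JP.cring_localization)

lemma fraction_mult_denom:
  assumes "a \<in> carrier R" "s \<in> carrier R - J"
  shows "fraction R J a s \<otimes>\<^bsub>V\<^esub> of_R s = of_R a"
proof -
  have "fraction R J a s \<otimes>\<^bsub>V\<^esub> of_R s = fraction R J (a \<otimes> s) (s \<otimes> \<one>)"
    using assms one_notin_J by (intro JP.mult_localization) auto
  also have "\<dots> = of_R a" using assms one_notin_J by (subst fraction_eq_iff) (auto simp: m_ac)
  finally show ?thesis .
qed

lemma fraction_eq_mult:
  assumes "a \<in> carrier R" "s \<in> carrier R - J"
  shows "fraction R J a s = of_R a \<otimes>\<^bsub>V\<^esub> fraction R J \<one> s"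
  using assms JP.mult_localization[OF assms(1) one_notin_J one_closed assms(2)] by simp

lemma valuation_ring_localization: "valuation_ring V"
proof (rule valuation_ringI[OF V.is_cring])
  have *: "fraction R J a s divides\<^bsub>V\<^esub> fraction R J b t"
    if ab: "a \<in> carrier R" "s \<in> carrier R - J" "b \<in> carrier R" "t \<in> carrier R - J" "(a \<otimes> t) divides (b \<otimes> s)" for a s b t
  proof -
    from ab(5) obtain c where c: "c \<in> carrier R" "b \<otimes> s = a \<otimes> t \<otimes> c" by (auto simp: factor_def)
    have "fraction R J a s \<otimes>\<^bsub>V\<^esub> of_R c = fraction R J (a \<otimes> c) (s \<otimes> \<one>)"
      using ab c(1) one_notin_J by (intro JP.mult_localization) auto
    also have "\<dots> = fraction R J b t"
      using ab(1-4) c by (subst fraction_eq_iff) (auto simp: m_ac)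
    finally show ?thesis using of_R_closed[OF c(1)] by (auto simp: factor_def)
  qed
  fix x y assume "x \<in> carrier V" "y \<in> carrier V"
  then obtain a s b t where "a \<in> carrier R" "s \<in> carrier R - J" "x = fraction R J a s"
    "b \<in> carrier R" "t \<in> carrier R - J" "y = fraction R J b t" by (auto simp: JP.carrier_localization)
  with *[of a s b t] *[of b t a s] divides_total[of "a \<otimes> t" "b \<otimes> s"]
  show "x divides\<^bsub>V\<^esub> y \<or> y divides\<^bsub>V\<^esub> x" by auto
qed

lemma fraction_in_image_J:
  assumes "a \<in> carrier R" "s \<in> carrier R - J"
  shows "fraction R J a s \<in> of_R ` J \<longleftrightarrow> a \<in> J"
proof
  assume "fraction R J a s \<in> of_R ` J"
  then obtain j where j: "j \<in> J" "fraction R J a s = of_R j" by blast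
  then have "a \<otimes> \<one> = j \<otimes> s" using fraction_eq_iff[OF assms J.Icarr[OF j(1)] one_notin_J] by blast
  then show "a \<in> J" using j assms J.I_r_closed by simp
next
  assume "a \<in> J"
  from fraction_in_J[OF this assms(2)] show "fraction R J a s \<in> of_R ` J" by blast
qed

lemma maximalideal_localization: "maximalideal (of_R ` J) V"
proof (rule maximalidealI)
  show "ideal (of_R ` J) V"
  proof (rule V.idealI')
    show "of_R ` J \<subseteq> carrier V" using of_R_closed J.Icarr by blast
    show "\<zero>\<^bsub>V\<^esub> \<in> of_R ` J" unfolding JP.zero_localization by (rule imageI[OF J.zero_closed])
    fix x y assume "x \<in> of_R ` J" "y \<in> of_R ` J"
    then obtain a b where "a \<in> J" "x = of_R a" "b \<in> J" "y = of_R b" by blast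
    then show "x \<oplus>\<^bsub>V\<^esub> y \<in> of_R ` J"
      using of_R_add[OF J.Icarr J.Icarr] J.a_closed by (metis imageI)
  next
    fix x r assume x: "x \<in> of_R ` J" and r: "r \<in> carrier V"
    then obtain a b s where a: "a \<in> J" "x = of_R a" and b: "b \<in> carrier R" "s \<in> carrier R - J" "r = fraction R J b s"
      by (auto simp: JP.carrier_localization)
    have "r \<otimes>\<^bsub>V\<^esub> x = fraction R J (b \<otimes> a) (s \<otimes> \<one>)"
      unfolding a(2) b(3) using J.Icarr[OF a(1)] b one_notin_J by (intro JP.mult_localization) auto
    also have "\<dots> = fraction R J (b \<otimes> a) s" using b by simp
    finally show *: "r \<otimes>\<^bsub>V\<^esub> x \<in> of_R ` J"
      using fraction_in_image_J[of "b \<otimes> a" s] J.I_l_closed[OF a(1) b(1)] J.Icarr[OF a(1)] b by simp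
    have "x \<in> carrier V" using a of_R_closed J.Icarr by simp
    with * V.m_comm[OF r] show "x \<otimes>\<^bsub>V\<^esub> r \<in> of_R ` J" by simp
  qed
  have "\<one> \<notin> J" using one_notin_J by simp
  then have "\<one>\<^bsub>V\<^esub> \<notin> of_R ` J"
    using fraction_in_image_J[OF one_closed one_notin_J] unfolding JP.one_localization by blast
  then show "carrier V \<noteq> of_R ` J" using V.one_closed by blast
  fix I assume I: "ideal I V" "of_R ` J \<subseteq> I" "I \<subseteq> carrier V"
  show "I = of_R ` J \<or> I = carrier V"
  proof (rule disjCI)
    assume "I \<noteq> carrier V"
    have "x \<in> of_R ` J" if x: "x \<in> I" for x
    proof (rule ccontr)
      assume nx: "x \<notin> of_R ` J"
      from x I(3) obtain a s where a: "a \<in> carrier R" "s \<in> carrier R - J" "x = fraction R J a s"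
        by (auto simp: JP.carrier_localization)
      with nx fraction_in_image_J have aJ: "a \<in> carrier R - J" by blast
      have "x \<otimes>\<^bsub>V\<^esub> fraction R J s a = fraction R J (a \<otimes> s) (s \<otimes> a)"
        unfolding a(3) using a aJ by (intro JP.mult_localization) auto
      also have "\<dots> = \<one>\<^bsub>V\<^esub>"
        unfolding JP.one_localization using a aJ one_notin_J JP.comp_mult[OF a(2) aJ]
        by (subst fraction_eq_iff) (auto simp: m_comm)
      finally have "\<one>\<^bsub>V\<^esub> \<in> I"
        using ideal.I_r_closed[OF I(1) x, of "fraction R J s a"] JP.fraction_closed[of s a] a(2) aJ by auto
      then show False using ideal.one_imp_carrier[OF I(1)] \<open>I \<noteq> carrier V\<close> by blast
    qed
    with I(2) show "I = of_R ` J" by blast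
  qed
qed

text \<open>After subtracting one of its members, a Cauchy net in a quotient of \<open>V\<close> eventually takes values in the maximal ideal,
  which consists of elements of \<open>R\<close>. So it can be represented by a family in \<open>R\<close> that is coherent modulo the
  ideals \<open>a R\<close>.\<close>

theorem maximal_if_limits:
  assumes limits: "\<And>A c. coherent_family R P J A c \<Longrightarrow> \<exists>l\<in>carrier R. \<forall>a\<in>carrier R - A. a divides (l \<ominus> c a)"
  shows "maximal_valuation_ring V"
  unfolding maximal_valuation_ring_def
proof (intro conjI exI[of _ "of_R ` J"] valuation_ring_localization maximalideal_localization allI impI)
  let ?P = "of_R ` J"
  fix A' assume A'h: "ideal A' V \<and> A' \<noteq> carrier V \<and> (\<forall>a\<in>carrier V - {\<zero>\<^bsub>V\<^esub>}. A' \<noteq> ?P #>\<^bsub>V\<^esub> a)"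
  then have A': "ideal A' V" "A' \<noteq> carrier V" "\<And>a. \<lbrakk>a \<in> carrier V; a \<noteq> \<zero>\<^bsub>V\<^esub>\<rbrakk> \<Longrightarrow> A' \<noteq> ?P #>\<^bsub>V\<^esub> a" by blast+
  note VR = valuation_ring_localization
  have Pideal: "ideal ?P V" using maximalideal_localization by (simp add: maximalideal.axioms(1))
  define A where "A = {a \<in> carrier R. of_R a \<in> A'}"
  have A: "ideal A R" unfolding A_def by (rule ring_hom_ring.ideal_vimage[OF ring_hom_ringI2[OF ring_axioms V.ring_axioms ring_hom_cring.homh[OF of_R_hom]] A'(1)])
  have frac: "fraction R J a s \<in> A' \<longleftrightarrow> a \<in> A" if a: "a \<in> carrier R" "s \<in> carrier R - J" for a s
  proof
    assume "fraction R J a s \<in> A'"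
    then have "fraction R J a s \<otimes>\<^bsub>V\<^esub> of_R s \<in> A'" using ideal.I_r_closed[OF A'(1)] of_R_closed a(2) by simp
    then show "a \<in> A" using a fraction_mult_denom[OF a] unfolding A_def by simp
  next
    assume "a \<in> A"
    then have "of_R a \<otimes>\<^bsub>V\<^esub> fraction R J \<one> s \<in> A'"
      using ideal.I_r_closed[OF A'(1)] JP.fraction_closed[OF one_closed a(2)] unfolding A_def by blast
    then show "fraction R J a s \<in> A'" using fraction_eq_mult[OF a] by simp
  qed
  have oneA: "\<one> \<notin> A"
  proof
    assume "\<one> \<in> A"
    then have "\<one>\<^bsub>V\<^esub> \<in> A'" unfolding A_def JP.one_localization by blast
    with ideal.one_imp_carrier[OF A'(1)] A'(2) show False by blast
  qed
  have A_div: "a \<in> A" if "s \<in> carrier R" "s \<notin> J" "a \<in> carrier R" "s \<otimes> a \<in> A" for s a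
  proof -
    have "fraction R J (s \<otimes> a) s \<in> A'" using frac[of "s \<otimes> a" s] that by simp
    moreover have "fraction R J (s \<otimes> a) s = of_R a" using that one_notin_J by (subst fraction_eq_iff) (auto simp: m_comm)
    ultimately show ?thesis using that by (simp add: A_def)
  qed
  have A_ne: "A \<noteq> J #> b" if b: "b \<in> carrier R" "b \<noteq> \<zero>" for b
  proof
    assume AJ: "A = J #> b"
    have "A' = ?P #>\<^bsub>V\<^esub> of_R b"
    proof (intro equalityI subsetI)
      fix x assume x: "x \<in> A'"
      then have "x \<in> carrier V" by (rule ideal.Icarr[OF A'(1)])
      then obtain a s where a: "a \<in> carrier R" "s \<in> carrier R - J" "x = fraction R J a s"
        by (auto simp: JP.carrier_localization)
      with x frac have "a \<in> J #> b" unfolding AJ[symmetric] by blast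
      then obtain j where j: "j \<in> J" "a = j \<otimes> b" unfolding r_coset_def by blast
      note jc = J.Icarr[OF j(1)]
      have "x = fraction R J j s \<otimes>\<^bsub>V\<^esub> of_R b"
        unfolding a(3) j(2) using JP.mult_localization[OF jc a(2) b(1) one_notin_J] a(2) by simp
      moreover have "fraction R J j s \<in> ?P" using fraction_in_image_J[OF jc a(2)] j(1) by blast
      ultimately show "x \<in> ?P #>\<^bsub>V\<^esub> of_R b" unfolding r_coset_def by blast
    next
      fix x assume "x \<in> ?P #>\<^bsub>V\<^esub> of_R b"
      then obtain j where j: "j \<in> J" "x = of_R j \<otimes>\<^bsub>V\<^esub> of_R b" unfolding r_coset_def by blast
      then have "x = of_R (j \<otimes> b)" using of_R_mult[OF J.Icarr[OF j(1)] b(1)] by simp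
      moreover have "j \<otimes> b \<in> A" unfolding AJ r_coset_def using j(1) by blast
      ultimately show "x \<in> A'" unfolding A_def by blast
    qed
    moreover have "of_R b \<noteq> \<zero>\<^bsub>V\<^esub>" using of_R_eq_iff[OF b(1) zero_closed] b(2) by (simp add: JP.zero_localization)
    ultimately show False using A'(3)[OF of_R_closed[OF b(1)]] by blast
  qed
  \<comment> \<open>The ideals \<open>a J\<close> with \<open>a\<close> outside \<open>A\<close> are cofinal among the ideals above \<open>A'\<close>, and congruence modulo
    \<open>a J\<close> descends from the localization to the base ring.\<close>
  define B where "B a = ?P #>\<^bsub>V\<^esub> of_R a" for a
  have Bideal: "ideal (B a) V" if "a \<in> carrier R" for a
    unfolding B_def by (rule V.r_coset_ideal[OF Pideal of_R_closed[OF that]])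
  have B_iff: "x \<in> B a \<longleftrightarrow> (\<exists>j\<in>J. x = of_R (j \<otimes> a))" if "a \<in> carrier R" for x a
    unfolding B_def r_coset_def using of_R_mult[OF J.Icarr that] by auto
  have B_mono: "B b \<subseteq> B a" if ab: "a \<in> carrier R" "b \<in> carrier R" "a divides b" for a b
  proof
    fix x assume "x \<in> B b"
    then obtain j where j: "j \<in> J" "x = of_R (j \<otimes> b)" using B_iff[OF ab(2)] by blast
    from ab(3) obtain r where r: "r \<in> carrier R" "b = a \<otimes> r" by (auto simp: factor_def)
    have "x = of_R ((j \<otimes> r) \<otimes> a)" unfolding j(2) r(2) using J.Icarr[OF j(1)] r(1) ab(1) by (simp add: m_ac)
    with J.I_r_closed[OF j(1) r(1)] show "x \<in> B a" using B_iff[OF ab(1)] by blast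
  qed
  have AB: "A' \<subset> B a" if a: "a \<in> carrier R" "a \<notin> A" for a
  proof -
    have aA': "of_R a \<notin> A'" using a unfolding A_def by blast
    have "A' \<subseteq> B a"
    proof
      fix x assume x: "x \<in> A'"
      note xc = ideal.Icarr[OF A'(1) x]
      have "\<not> x divides\<^bsub>V\<^esub> of_R a"
      proof
        assume "x divides\<^bsub>V\<^esub> of_R a"
        then obtain v where "v \<in> carrier V" "of_R a = x \<otimes>\<^bsub>V\<^esub> v" unfolding factor_def by blast
        then show False using aA' ideal.I_r_closed[OF A'(1) x] by simp
      qed
      then obtain v where v: "v \<in> carrier V" "x = of_R a \<otimes>\<^bsub>V\<^esub> v"
        using valuation_ring_divides_total[OF VR xc of_R_closed[OF a(1)]] unfolding factor_def by blast
      have "v \<in> ?P"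
      proof (rule ccontr)
        assume "v \<notin> ?P"
        then have u: "v \<in> Units V" using valuation_ring_unit[OF VR maximalideal_localization v(1)] by blast
        then have "of_R a = x \<otimes>\<^bsub>V\<^esub> inv\<^bsub>V\<^esub> v" 
            using V.m_assoc[OF of_R_closed[OF a(1)] v(1) V.Units_inv_closed[OF u]] V.Units_r_inv[OF u]
              V.r_one[OF of_R_closed[OF a(1)]] by (simp only: v(2))
        then show False using aA' ideal.I_r_closed[OF A'(1) x] V.Units_inv_closed[OF u] by simp
      qed
      then show "x \<in> B a" unfolding B_def r_coset_def v(2) using V.m_comm[OF of_R_closed[OF a(1)] v(1)] by blast
    qed
    moreover have "A' \<noteq> B a"
    proof -
      have "\<zero> \<in> A" using A by (simp add: additive_subgroup.zero_closed ideal.axioms(1))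
      then have "a \<noteq> \<zero>" using a by blast
      then have "of_R a \<noteq> \<zero>\<^bsub>V\<^esub>" using of_R_eq_iff[OF a(1) zero_closed] by (simp add: JP.zero_localization)
      then show ?thesis unfolding B_def by (rule A'(3)[OF of_R_closed[OF a(1)]])
    qed
    ultimately show ?thesis by blast
  qed
  show "complete_ring (V Quot A')"
    unfolding complete_ring_def
  proof (intro allI impI)
    fix D :: "('a \<times> 'a) set set set set" and leq y
    assume "directed_preorder D leq \<and> Cauchy_net (V Quot A') D leq y"
    then have D: "D \<noteq> {}" "\<And>i. i \<in> D \<Longrightarrow> leq i i"
      "\<And>i j k. \<lbrakk>i \<in> D; j \<in> D; k \<in> D; leq i j; leq j k\<rbrakk> \<Longrightarrow> leq i k"
      "\<And>i j. \<lbrakk>i \<in> D; j \<in> D\<rbrakk> \<Longrightarrow> \<exists>k\<in>D. leq i k \<and> leq j k"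
      and y: "Cauchy_net (V Quot A') D leq y"
      unfolding directed_preorder_def reflp_on_def transp_on_def by blast+
    have "\<forall>i\<in>D. \<exists>v\<in>carrier V. y i = A' +>\<^bsub>V\<^esub> v"
      using y quotient_carrier[OF VR A'(1)] unfolding Cauchy_net_def by blast
    then obtain x where x: "\<And>i. i \<in> D \<Longrightarrow> x i \<in> carrier V" "\<And>i. i \<in> D \<Longrightarrow> y i = A' +>\<^bsub>V\<^esub> x i" by metis
    have xD: "x \<in> D \<rightarrow> carrier V" using x(1) by blast
    have "Cauchy_net (V Quot A') D leq (\<lambda>i. A' +>\<^bsub>V\<^esub> x i)"
      using y x(2) unfolding Cauchy_net_def Pi_def by auto
    then have Cauchy: "\<And>B. \<lbrakk>ideal B V; A' \<subset> B\<rbrakk> \<Longrightarrow> \<exists>k\<in>D. \<forall>i\<in>D. \<forall>j\<in>D. leq k i \<and> leq k j \<longrightarrow> x i \<ominus>\<^bsub>V\<^esub> x j \<in> B"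
      unfolding Cauchy_net_quotient_iff[OF VR A'(1) xD] by blast
    have "\<forall>a\<in>carrier R - A. \<exists>k\<in>D. \<forall>i\<in>D. \<forall>j\<in>D. leq k i \<and> leq k j \<longrightarrow> x i \<ominus>\<^bsub>V\<^esub> x j \<in> B a"
      using Cauchy Bideal AB by blast
    then obtain k where k: "\<And>a. \<lbrakk>a \<in> carrier R; a \<notin> A\<rbrakk> \<Longrightarrow> k a \<in> D"
      "\<And>a i j. \<lbrakk>a \<in> carrier R; a \<notin> A; i \<in> D; j \<in> D; leq (k a) i; leq (k a) j\<rbrakk> \<Longrightarrow> x i \<ominus>\<^bsub>V\<^esub> x j \<in> B a"
      by (metis DiffI)
    define k1 where "k1 = k \<one>"
    have k1: "k1 \<in> D" using k(1)[OF one_closed oneA] by (simp add: k1_def)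
    have "\<forall>a\<in>carrier R - A. \<exists>m\<in>D. leq (k a) m \<and> leq k1 m" using D(4) k(1) k1 by blast
    then obtain m where m: "\<And>a. \<lbrakk>a \<in> carrier R; a \<notin> A\<rbrakk> \<Longrightarrow> m a \<in> D"
      "\<And>a. \<lbrakk>a \<in> carrier R; a \<notin> A\<rbrakk> \<Longrightarrow> leq (k a) (m a)" "\<And>a. \<lbrakk>a \<in> carrier R; a \<notin> A\<rbrakk> \<Longrightarrow> leq k1 (m a)"
      by (metis DiffI)
    have "\<exists>d\<in>J. x (m a) \<ominus>\<^bsub>V\<^esub> x k1 = of_R d" if a: "a \<in> carrier R" "a \<notin> A" for a
    proof -
      have "x (m a) \<ominus>\<^bsub>V\<^esub> x k1 \<in> B \<one>"
        using k(2)[OF one_closed oneA m(1)[OF a] k1] m(3)[OF a] D(2)[OF k1] by (simp add: k1_def)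
      then obtain j where "j \<in> J" "x (m a) \<ominus>\<^bsub>V\<^esub> x k1 = of_R (j \<otimes> \<one>)" using B_iff[OF one_closed] by blast
      then show ?thesis using J.Icarr by auto
    qed
    then obtain \<delta> where \<delta>: "\<And>a. \<lbrakk>a \<in> carrier R; a \<notin> A\<rbrakk> \<Longrightarrow> \<delta> a \<in> J"
      "\<And>a. \<lbrakk>a \<in> carrier R; a \<notin> A\<rbrakk> \<Longrightarrow> x (m a) \<ominus>\<^bsub>V\<^esub> x k1 = of_R (\<delta> a)" by metis
    have \<delta>c: "\<delta> a \<in> carrier R" if "a \<in> carrier R" "a \<notin> A" for a using J.Icarr \<delta>(1) that by blast
    have "coherent_family R P J A \<delta>"
    proof (intro coherent_family.intro coherent_family_axioms.intro valuation_dom_max_axioms A)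
      show "A \<noteq> carrier R" using oneA by blast
      show "\<And>b. b \<in> carrier R \<Longrightarrow> b \<noteq> \<zero> \<Longrightarrow> A \<noteq> J #> b" by (rule A_ne)
      show "\<And>s a. \<lbrakk>s \<in> carrier R; s \<notin> J; a \<in> carrier R; s \<otimes> a \<in> A\<rbrakk> \<Longrightarrow> a \<in> A" by (rule A_div)
      show "\<And>a. a \<in> carrier R \<Longrightarrow> a \<notin> A \<Longrightarrow> \<delta> a \<in> carrier R" by (rule \<delta>c)
      fix a b assume ab: "a \<in> carrier R" "b \<in> carrier R" "b \<notin> A" "a divides b"
      have aA: "a \<notin> A" using ideal_divides[OF A _ ab(4)] ab(3) by blast
      note a = ab(1) aA and b = ab(2,3)
      from D(4)[OF m(1)[OF a] m(1)[OF b]] obtain n where n: "n \<in> D" "leq (m a) n" "leq (m b) n" by blast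
      have 1: "x (m b) \<ominus>\<^bsub>V\<^esub> x n \<in> B a"
        using k(2)[OF b m(1)[OF b] n(1) m(2)[OF b]] D(3)[OF k(1)[OF b] m(1)[OF b] n(1) m(2)[OF b] n(3)]
          B_mono[OF ab(1,2,4)] by blast
      have 2: "x (m a) \<ominus>\<^bsub>V\<^esub> x n \<in> B a"
        using k(2)[OF a m(1)[OF a] n(1) m(2)[OF a]] D(3)[OF k(1)[OF a] m(1)[OF a] n(1) m(2)[OF a] n(2)] by blast
      interpret Ba: ideal "B a" V by (rule Bideal[OF ab(1)])
      have "(x (m b) \<ominus>\<^bsub>V\<^esub> x n) \<ominus>\<^bsub>V\<^esub> (x (m a) \<ominus>\<^bsub>V\<^esub> x n) \<in> B a"
        unfolding V.minus_eq[of "x (m b) \<ominus>\<^bsub>V\<^esub> x n"] by (rule Ba.a_closed[OF 1 Ba.a_inv_closed[OF 2]])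
      moreover have "(x (m b) \<ominus>\<^bsub>V\<^esub> x n) \<ominus>\<^bsub>V\<^esub> (x (m a) \<ominus>\<^bsub>V\<^esub> x n)
          = (x (m b) \<ominus>\<^bsub>V\<^esub> x k1) \<ominus>\<^bsub>V\<^esub> (x (m a) \<ominus>\<^bsub>V\<^esub> x k1)"
        using x(1)[OF m(1)[OF a]] x(1)[OF m(1)[OF b]] x(1)[OF n(1)] x(1)[OF k1] by algebra
      ultimately have "of_R (\<delta> b \<ominus> \<delta> a) \<in> B a"
        using \<delta>(2)[OF a] \<delta>(2)[OF b] of_R_minus[OF \<delta>c[OF b] \<delta>c[OF a]] by simp
      then obtain j where j: "j \<in> J" "of_R (\<delta> b \<ominus> \<delta> a) = of_R (j \<otimes> a)" using B_iff[OF ab(1)] by blast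
      then have "\<delta> b \<ominus> \<delta> a = a \<otimes> j"
        using of_R_eq_iff[of "\<delta> b \<ominus> \<delta> a" "j \<otimes> a"] \<delta>c[OF a] \<delta>c[OF b] J.Icarr[OF j(1)] ab(1) by (simp add: m_comm)
      then show "a divides (\<delta> b \<ominus> \<delta> a)" using J.Icarr[OF j(1)] unfolding factor_def by blast
    qed
    from limits[OF this] obtain l where l: "l \<in> carrier R"
      "\<And>a. \<lbrakk>a \<in> carrier R; a \<notin> A\<rbrakk> \<Longrightarrow> a divides (l \<ominus> \<delta> a)" by blast
    define lim where "lim = x k1 \<oplus>\<^bsub>V\<^esub> of_R l"
    have lim: "lim \<in> carrier V" using x(1)[OF k1] of_R_closed[OF l(1)] by (simp add: lim_def)
    have "net_converges (V Quot A') D leq (\<lambda>i. A' +>\<^bsub>V\<^esub> x i) (A' +>\<^bsub>V\<^esub> lim)"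
      unfolding net_converges_quotient_iff[OF VR A'(1) xD lim]
    proof (intro allI impI)
      fix C assume C: "ideal C V \<and> A' \<subset> C"
      then interpret C: ideal C V by blast
      from C obtain v where v: "v \<in> C" "v \<notin> A'" by blast
      then obtain a s where a: "a \<in> carrier R" "s \<in> carrier R - J" "v = fraction R J a s"
        using C.Icarr[OF v(1)] by (auto simp: JP.carrier_localization)
      have aA: "a \<notin> A" using frac[OF a(1,2)] v(2) a(3) by blast
      have aC: "of_R a \<in> C"
        using C.I_r_closed[OF v(1), of "of_R s"] fraction_mult_denom[OF a(1,2)] a(2,3) of_R_closed by simp
      note a = a(1) aA
      have "B a \<subseteq> C"
      proof
        fix z assume "z \<in> B a"
        then obtain j where j: "j \<in> J" "z = of_R (j \<otimes> a)" using B_iff[OF a(1)] by blast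
        note jc = J.Icarr[OF j(1)]
        show "z \<in> C"
          unfolding j(2) of_R_mult[OF jc a(1)] by (rule C.I_l_closed[OF aC of_R_closed[OF jc]])
      qed
      have "x i \<ominus>\<^bsub>V\<^esub> lim \<in> C" if i: "i \<in> D" "leq (m a) i" for i
      proof -
        have 1: "x i \<ominus>\<^bsub>V\<^esub> x (m a) \<in> C"
          using k(2)[OF a i(1) m(1)[OF a] D(3)[OF k(1)[OF a] m(1)[OF a] i(1) m(2)[OF a] i(2)] m(2)[OF a]]
            \<open>B a \<subseteq> C\<close> by blast
        from l(2)[OF a] obtain r where r: "r \<in> carrier R" "l \<ominus> \<delta> a = a \<otimes> r" by (auto simp: factor_def)
        have "\<delta> a \<ominus> l = \<ominus> (l \<ominus> \<delta> a)" using l(1) \<delta>c[OF a] by algebra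
        also have "\<dots> = a \<otimes> (\<ominus> r)" unfolding r(2) using a(1) r(1) by (simp add: r_minus)
        finally have "of_R (\<delta> a \<ominus> l) = of_R a \<otimes>\<^bsub>V\<^esub> of_R (\<ominus> r)" using of_R_mult a(1) r(1) by simp
        then have "of_R (\<delta> a \<ominus> l) \<in> C" using C.I_r_closed[OF aC] of_R_closed r(1) by simp
        then have 2: "of_R (\<delta> a) \<ominus>\<^bsub>V\<^esub> of_R l \<in> C" using of_R_minus[OF \<delta>c[OF a] l(1)] by simp
        have "x i \<ominus>\<^bsub>V\<^esub> lim = (x i \<ominus>\<^bsub>V\<^esub> x (m a)) \<oplus>\<^bsub>V\<^esub> ((x (m a) \<ominus>\<^bsub>V\<^esub> x k1) \<ominus>\<^bsub>V\<^esub> of_R l)"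
          unfolding lim_def using x(1)[OF i(1)] x(1)[OF m(1)[OF a]] x(1)[OF k1] of_R_closed[OF l(1)] by algebra
        also have "\<dots> = (x i \<ominus>\<^bsub>V\<^esub> x (m a)) \<oplus>\<^bsub>V\<^esub> (of_R (\<delta> a) \<ominus>\<^bsub>V\<^esub> of_R l)" unfolding \<delta>(2)[OF a] ..
        finally show ?thesis using C.a_closed[OF 1 2] by simp
      qed
      with m(1)[OF a] show "\<exists>k\<in>D. \<forall>i\<in>D. leq k i \<longrightarrow> x i \<ominus>\<^bsub>V\<^esub> lim \<in> C" by blast
    qed
    then have "net_converges (V Quot A') D leq y (A' +>\<^bsub>V\<^esub> lim)"
      using x(2) unfolding net_converges_def by auto
    then show "\<exists>l. net_converges (V Quot A') D leq y l" by blast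
  qed
qed

text \<open>For a fixed nonzero element \<open>a0\<close> of \<open>A\<close>, the quotients \<open>a0 / w\<close> with \<open>w\<close> outside \<open>A\<close> generate an ideal.
  Each element of a countable generating set is a multiple of some \<open>a0 / w\<close>, and these \<open>w\<close> are cofinal: otherwise
  the generators would all be proper multiples of one \<open>a0 / w\<close>, and could not generate it.\<close>

lemma countable_cofinal:
  assumes cg: "\<And>I. ideal I R \<Longrightarrow> countably_generated_ideal I R"
    and A: "ideal A R" "A \<noteq> {\<zero>}" "A \<noteq> carrier R"
  shows "\<exists>W\<subseteq>carrier R - A. (\<forall>a\<in>carrier R - A. \<exists>w\<in>W. a divides w) \<and> countable W"
proof -
  interpret A: ideal A R by (rule A(1))
  obtain a0 where a0: "a0 \<in> A" "a0 \<noteq> \<zero>" using A(2) A.zero_closed by blast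
  note a0c = A.Icarr[OF a0(1)]
  have dvd: "w \<noteq> \<zero>" "w divides a0" if "w \<in> carrier R - A" for w
    using that A.zero_closed divides_total[of w a0] a0c ideal_divides[OF A(1) a0(1), of w] by auto
  define q where "q w = a0 \<oslash> w" for w
  have q: "q w \<in> carrier R" "w \<otimes> q w = a0" "q w \<noteq> \<zero>" if w: "w \<in> carrier R - A" for w
  proof -
    show qc: "q w \<in> carrier R" and "w \<otimes> q w = a0"
      using quo_closed mult_quo dvd[OF w] w by (auto simp: q_def)
    then show "q w \<noteq> \<zero>" using a0(2) w by auto
  qed
  have q_anti: "v divides w" if vw: "v \<in> carrier R - A" "w \<in> carrier R - A" "q w divides q v" for v w
  proof -
    from vw(3) obtain r where r: "r \<in> carrier R" "q v = q w \<otimes> r" by (auto simp: factor_def)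
    have "q w \<otimes> w = q w \<otimes> (v \<otimes> r)"
    proof -
      have "q w \<otimes> w = v \<otimes> q v" using q(2)[OF vw(1)] q(2)[OF vw(2)] q(1)[OF vw(2)] vw(2) m_comm[of "q w" w] by simp
      also have "\<dots> = q w \<otimes> (v \<otimes> r)" unfolding r(2) using q(1)[OF vw(2)] vw(1) r(1) by (simp add: m_lcomm)
      finally show ?thesis .
    qed
    then have "w = v \<otimes> r" using m_lcancel[OF q(3) q(1), OF vw(2,2), of w "v \<otimes> r"] vw r(1) by simp
    with r(1) show ?thesis by (auto simp: factor_def)
  qed
  define C where "C = {x \<in> carrier R. \<exists>w\<in>carrier R - A. q w divides x}"
  have qC: "q w \<in> C" if "w \<in> carrier R - A" for w
    using that q(1)[OF that] divides_refl' by (auto simp: C_def)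
  have one: "\<one> \<in> carrier R - A" using A.one_imp_carrier A(3) by blast
  have "ideal C R"
  proof (rule idealI')
    have "q \<one> divides \<zero>" using q(1)[OF one] by (auto simp: factor_def intro!: bexI[of _ \<zero>])
    with one show "\<zero> \<in> C" unfolding C_def by blast
    fix x y assume "x \<in> C" "y \<in> C"
    then obtain v w where v: "v \<in> carrier R - A" "q v divides x" "x \<in> carrier R"
      and w: "w \<in> carrier R - A" "q w divides y" "y \<in> carrier R" unfolding C_def by blast
    from divides_total[OF q(1)[OF v(1)] q(1)[OF w(1)]] show "x \<oplus> y \<in> C"
    proof
      assume "q v divides q w"
      then have "q v divides (x \<oplus> y)"
        using divides_add[OF q(1)[OF v(1)] v(2)] divides_trans'[OF _ w(2) q(1)[OF v(1)]] by blast
      with v w show ?thesis unfolding C_def by blast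
    next
      assume "q w divides q v"
      then have "q w divides (x \<oplus> y)"
        using divides_add[OF q(1)[OF w(1)] _ w(2)] divides_trans'[OF _ v(2) q(1)[OF w(1)]] by blast
      with v w show ?thesis unfolding C_def by blast
    qed
  next
    fix x r assume "x \<in> C" and r: "r \<in> carrier R"
    then obtain v where v: "v \<in> carrier R - A" "q v divides x" "x \<in> carrier R" unfolding C_def by blast
    with divides_mult[OF q(1)[OF v(1)] v(2) r] r show "r \<otimes> x \<in> C" unfolding C_def by blast
    with m_comm[OF r v(3)] show "x \<otimes> r \<in> C" by simp
  qed (auto simp: C_def)
  from cg[OF this] obtain S where S: "countable S" "S \<subseteq> carrier R" "C = Idl S"
    by (auto simp: countably_generated_ideal_def)
  have "\<exists>w\<in>carrier R - A. q w divides s" if "s \<in> S" for s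
    using genideal_self[OF S(2)] S(3) that unfolding C_def by blast
  then obtain f where f: "\<And>s. s \<in> S \<Longrightarrow> f s \<in> carrier R - A" "\<And>s. s \<in> S \<Longrightarrow> q (f s) divides s" by metis
  have "\<exists>s\<in>S. a divides f s" if a: "a \<in> carrier R - A" for a
  proof -
    have "\<exists>s\<in>S. s divides q a"
    proof (rule ccontr)
      assume none: "\<not> ?thesis"
      have "S \<subseteq> P #> q a"
      proof
        fix s assume s: "s \<in> S"
        then have sc: "s \<in> carrier R" using S(2) by blast
        from none s divides_total[OF sc q(1)[OF a]] obtain t where t: "t \<in> carrier R" "s = q a \<otimes> t"
          by (auto simp: factor_def)
        have "t \<in> P"
        proof (rule ccontr)
          assume "t \<notin> P"
          then have tu: "t \<in> Units R" using unitI t(1) by blast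
          then have "q a = s \<otimes> inv t" using t q(1)[OF a] by (simp add: m_assoc)
          then have "s divides q a" using tu by (auto simp: factor_def)
          with none s show False by blast
        qed
        then show "s \<in> P #> q a" unfolding r_coset_def t(2) using m_comm[OF q(1)[OF a] t(1)] by blast
      qed
      then have "C \<subseteq> P #> q a"
        using genideal_minimal[OF r_coset_ideal[OF P.is_ideal q(1)[OF a]]] S(3) by blast
      with qC[OF a] obtain p where p: "p \<in> P" "q a = p \<otimes> q a" unfolding r_coset_def by blast
      then have "q a \<otimes> \<one> = q a \<otimes> p" using q(1)[OF a] P.Icarr[OF p(1)] m_comm by simp
      then have "\<one> = p" using m_lcancel[OF q(3)[OF a] q(1)[OF a], of \<one> p] P.Icarr[OF p(1)] by simp
      then show False using p(1) P.one_imp_carrier P.I_notcarr by blast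
    qed
    then obtain s where s: "s \<in> S" "s divides q a" by blast
    have "q (f s) divides q a" by (rule divides_trans'[OF f(2)[OF s(1)] s(2) q(1)[OF f(1)[OF s(1)]]])
    with q_anti[OF a f(1)[OF s(1)]] s(1) show ?thesis by blast
  qed
  then show ?thesis using f(1) S(1) by (intro exI[of _ "f ` S"]) auto
qed

end

section \<open>The equivalences\<close>

(* Condition (1) is the conjunction of the two statements quantified over \<Lambda>. Ranging over index
   sets of the arbitrary type 'i covers all index sets; those of type 'a include R itself. *)
theorem theorem8:
  fixes R :: "('a, 'c) ring_scheme" and P J :: "'a set"
  assumes "valuation_domain R"
    and "maximalideal P R"
    and "\<And>L. primeideal L R \<Longrightarrow> countably_generated_module R (localization R L)"
    and "J = (\<Inter>n::nat. P [^]\<^bsub>ideals_set R\<^esub> n)"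
  shows "primeideal J R \<and>
    (((\<forall>\<Lambda>::'i set. separable R (power_module R \<Lambda>)) \<and>
      (\<forall>\<Lambda>::'a set. separable R (power_module R \<Lambda>)))
       \<longleftrightarrow> separable R (power_module R (carrier R))) \<and>
    (separable R (power_module R (carrier R)) \<longleftrightarrow> maximal_valuation_ring (localization R J)) \<and>
    ((\<forall>I. ideal I R \<longrightarrow> countably_generated_ideal I R) \<longrightarrow>
      (maximal_valuation_ring (localization R J) \<longleftrightarrow>
       separable R (power_module R (UNIV :: nat set))))"
proof -
  interpret valuation_dom R by (rule valuation_domainD[OF assms(1)])
  interpret valuation_dom_max R P J 
    by (intro valuation_dom_max.intro valuation_dom_max_axioms.intro valuation_dom_axioms assms(2,4))
  have 21: "maximal_valuation_ring (localization R J)" if "separable R (power_module R (carrier R))"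
  proof (rule maximal_if_limits, erule coherent_family.limit_exists[OF _ assms(3) that])
    fix A assume "ideal A R"
    show "\<exists>W\<subseteq>carrier R - A. (\<forall>a\<in>carrier R - A. \<exists>w\<in>W. a divides\<^bsub>R\<^esub> w) \<and> (\<exists>j. inj_on j W \<and> j ` W \<subseteq> carrier R)"
      by (intro exI[of _ "carrier R - A"] conjI exI[of _ "\<lambda>x. x"]) (auto intro: divides_refl')
  next
    fix W assume "W \<subseteq> carrier R"
    then show "\<exists>j. inj_on j W \<and> j ` W \<subseteq> carrier R" by (intro exI[of _ "\<lambda>x. x"]) auto
  qed
  have 22: "maximal_valuation_ring (localization R J)"
    if sep: "separable R (power_module R (UNIV :: nat set))" and cg: "\<And>I. ideal I R \<Longrightarrow> countably_generated_ideal I R"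
  proof (rule maximal_if_limits, erule coherent_family.limit_exists[OF _ assms(3) sep])
    fix A assume "ideal A R" "A \<noteq> {\<zero>\<^bsub>R\<^esub>}" "A \<noteq> carrier R"
    from countable_cofinal[OF cg this]
    show "\<exists>W\<subseteq>carrier R - A. (\<forall>a\<in>carrier R - A. \<exists>w\<in>W. a divides\<^bsub>R\<^esub> w) \<and>
      (\<exists>j :: 'a \<Rightarrow> nat. inj_on j W \<and> j ` W \<subseteq> UNIV)" by (metis countable_def subset_UNIV)
  next
    fix W :: "'a set" assume "countable W"
    then show "\<exists>j :: 'a \<Rightarrow> nat. inj_on j W \<and> j ` W \<subseteq> UNIV" by (auto simp: countable_def)
  qed
  have 3: "separable R (power_module R \<Lambda>)" "separable R (power_module R \<Lambda>')" "separable R (power_module R N)"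
    if "maximal_valuation_ring (localization R J)" for \<Lambda> :: "'i set" and \<Lambda>' :: "'a set" and N :: "nat set"
    using that by (rule separable_if_maximal)+
  have 23: "(\<forall>I. ideal I R \<longrightarrow> countably_generated_ideal I R) \<longrightarrow>
      separable R (power_module R (UNIV :: nat set)) \<longrightarrow> maximal_valuation_ring (localization R J)"
    using 22 by blast
  show ?thesis using J_prime 21 23 3 by blast
qed

end
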